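(* Let $m,n\ge 1$ be integers and let $T$ be an $m$-multilinear Calderón–Zygmund operator on $\mathbb{R}^n$ associated to a kernel $K$. Then there is a constant $A_3$, depending only on $K$, $n$, $m$, and $\|T\|_{(L^2(\mathbb{R}^n))^m\to L^{2/m}(\mathbb{R}^n)}$, such that the following holds. Let $t>0$ and $l\in\{1,\ldots,m\}$. If $\nu_1,\ldots,\nu_l$ are measures of the form $\nu_i=\sum_{j=1}^N a_{i,j}\delta_{x_{i,j}}$ with $N$ a positive integer, $x_{i,j}\in\mathbb{R}^n$ and $a_{i,j}\in\mathbb{R}$, and if $f_{l+1},\ldots,f_m\in L^1(\mathbb{R}^n)\cap L^\infty(\mathbb{R}^n)$ satisfy $\|f_i\|_{L^\infty(\mathbb{R}^n)}\le t^{\frac1m}$ for all $i\in\{l+1,\ldots,m\}$, then \[ \left|\{|T(\nu_1,\ldots,\nu_l,f_{l+1},\ldots,f_m)|>t\}\right|\le A_3\,t^{-\frac1m}\left(\prod_{i=1}^l\|\nu_i\|^{\frac1m}\right)\left(\prod_{i=l+1}^m\|f_i\|_{L^1(\mathbb{R}^n)}^{\frac1m}\right). \]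
   Context: $|A|$ denotes the Lebesgue measure of $A\subseteq\mathbb{R}^n$, $\delta_x$ is the unit point mass at $x$, and $\|\nu\|$ is the total variation of a real-valued Borel measure $\nu$ on $\mathbb{R}^n$. Empty products equal $1$. A (measurable) function $K:\mathbb{R}^{n(m+1)}\to\mathbb{C}$ is an $m$-multilinear Calderón–Zygmund kernel if there exist $C_K,\delta>0$ such that: (1) (size) $|K(x,y_1,\ldots,y_m)|\le \dfrac{C_K}{\left(\sum_{i=1}^m|x-y_i|\right)^{nm}}$ for all $x,y_1,\ldots,y_m\in\mathbb{R}^n$ with $x\ne y_j$ for some $j$; (2) (smoothness) $|K(x,y_1,\ldots,y_m)-K(x',y_1,\ldots,y_m)|\le \dfrac{C_K|x-x'|^\delta}{\left(\sum_{i=1}^m|x-y_i|\right)^{nm+\delta}}$ whenever $|x-x'|\le\frac12\max_{1\le i\le m}|x-y_i|$, and, for each $j\in\{1,\ldots,m\}$, $|K(x,y_1,\ldots,y_j,\ldots,y_m)-K(x,y_1,\ldots,y_j',\ldots,y_m)|\le \dfrac{C_K|y_j-y_j'|^\delta}{\left(\sum_{i=1}^m|x-y_i|\right)^{nm+\delta}}$ whenever $|y_j-y_j'|\le\frac12\max_{1\le i\le m}|x-y_i|$. A bounded multilinear operator $T:(L^2(\mathbb{R}^n))^m\to L^{\frac2m}(\mathbb{R}^n)$ is an $m$-multilinear Calderón–Zygmund operator associated to a kernel $K$ if $K$ is an $m$-multilinear Calderón–Zygmund kernel and \[ T(f_1,\ldots,f_m)(x)=\int_{(\mathbb{R}^n)^m}K(x,y_1,\ldots,y_m)f_1(y_1)\cdots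 f_m(y_m)\,dy_1\cdots dy_m \] for almost every $x\in\mathbb{R}^n\setminus\bigcap_{i=1}^m\operatorname{supp}f_i$. For real-valued Borel measures $\nu_1,\ldots,\nu_m$ on $\mathbb{R}^n$ and $x\in\mathbb{R}^n\setminus\bigcap_{i=1}^m\operatorname{supp}\nu_i$, define \[ T(\nu_1,\ldots,\nu_m)(x)=\int_{(\mathbb{R}^n)^m}K(x,y_1,\ldots,y_m)\,d\nu_1(y_1)\cdots d\nu_m(y_m). \] A function $f$ in a slot of $T$ alongside measures is identified with the measure $f(y)\,dy$. Thus, in the claim, $T(\nu_1,\ldots,\nu_l,f_{l+1},\ldots,f_m)(x)$ is defined by integrating $K(x,y_1,\ldots,y_m)$ against $d\nu_1(y_1)\cdots d\nu_l(y_l)\,f_{l+1}(y_{l+1})\cdots f_m(y_m)\,dy_{l+1}\cdots dy_m$, for all $x$ outside a finite set (which has measure zero). *)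

theory Defs
  imports "HOL-Probability.Probability"
begin

text \<open>
  Points of $(\mathbb{R}^n)^m$ are the extensional functions in
  \<^term>\<open>{1..m} \<rightarrow>\<^sub>E (UNIV :: (real ^ 'n) set)\<close>, the space of
  \<^term>\<open>Pi\<^sub>M {1..m} (\<lambda>_. lborel :: (real ^ 'n) measure)\<close>. The dimension $n$ is
  \<^term>\<open>CARD('n)\<close>.
\<close>

type_synonym 'n kernel = "real ^ 'n \<Rightarrow> (nat \<Rightarrow> real ^ 'n) \<Rightarrow> complex"

type_synonym 'n func = "real ^ 'n \<Rightarrow> complex"

type_synonym 'n multi_op = "(nat \<Rightarrow> 'n func) \<Rightarrow> 'n func"

definition cz_kernel :: "nat \<Rightarrow> ('n::finite) kernel \<Rightarrow> bool" where
  "cz_kernel m K \<longleftrightarrow>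
     (\<lambda>(x, y). K x y) \<in> borel_measurable (completion (lborel \<Otimes>\<^sub>M Pi\<^sub>M {1..m} (\<lambda>_. lborel))) \<and>
     (\<exists>C>0. \<exists>\<delta>>0.
        (\<forall>x. \<forall>y \<in> {1..m} \<rightarrow>\<^sub>E UNIV. (\<exists>j\<in>{1..m}. x \<noteq> y j) \<longrightarrow>
           norm (K x y) \<le> C / (\<Sum>i=1..m. norm (x - y i)) ^ (CARD('n) * m)) \<and>
        (\<forall>x x'. \<forall>y \<in> {1..m} \<rightarrow>\<^sub>E UNIV.
           norm (x - x') \<le> 1 / 2 * Max ((\<lambda>i. norm (x - y i)) ` {1..m}) \<longrightarrow>
           norm (K x y - K x' y) \<le>
             C * norm (x - x') powr \<delta>
               / (\<Sum>i=1..m. norm (x - y i)) powr (real (CARD('n) * m) + \<delta>)) \<and>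
        (\<forall>j\<in>{1..m}. \<forall>x. \<forall>y \<in> {1..m} \<rightarrow>\<^sub>E UNIV. \<forall>z.
           norm (y j - z) \<le> 1 / 2 * Max ((\<lambda>i. norm (x - y i)) ` {1..m}) \<longrightarrow>
           norm (K x y - K x (y(j := z))) \<le>
             C * norm (y j - z) powr \<delta>
               / (\<Sum>i=1..m. norm (x - y i)) powr (real (CARD('n) * m) + \<delta>)))"

definition lp_space :: "real \<Rightarrow> ('n::finite) func set" where
  "lp_space p = {f \<in> borel_measurable lebesgue. integrable lebesgue (\<lambda>x. norm (f x) powr p)}"

definition lp_norm :: "real \<Rightarrow> ('n::finite) func \<Rightarrow> real" where
  "lp_norm p f = (LINT x|lebesgue. norm (f x) powr p) powr (1 / p)"

definition linf_norm :: "('n::finite) func \<Rightarrow> ereal" where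
  "linf_norm f = esssup lebesgue (\<lambda>x. ereal (norm (f x)))"

definition linf_space :: "('n::finite) func set" where
  "linf_space = {f \<in> borel_measurable lebesgue. linf_norm f < \<infinity>}"

text \<open>
  The support of an element of an $L^p$ space, i.e. the essential support of any representative;
  it is also the support of the measure $f(y)\,dy$.
\<close>

definition fun_supp :: "('n::finite) func \<Rightarrow> (real ^ 'n) set" where
  "fun_supp f = {x. \<forall>U. open U \<and> x \<in> U \<longrightarrow> \<not> (AE y in lebesgue. y \<in> U \<longrightarrow> f y = 0)}"

text \<open>
  Operators act on representatives of $L^2$ classes. All identities between values of \<open>T\<close>
  hold almost everywhere, and equivalent arguments give equivalent values.
\<close>

definition mult_op_bound :: "nat \<Rightarrow> ('n::finite) multi_op \<Rightarrow> real \<Rightarrow> bool" where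
  "mult_op_bound m T B \<longleftrightarrow> 0 \<le> B \<and>
     (\<forall>f \<in> {1..m} \<rightarrow>\<^sub>E lp_space 2. lp_norm (2 / real m) (T f) \<le> B * (\<Prod>i=1..m. lp_norm 2 (f i)))"

definition mult_op_norm :: "nat \<Rightarrow> ('n::finite) multi_op \<Rightarrow> real" where
  "mult_op_norm m T = Inf {B. mult_op_bound m T B}"

definition bounded_mult_op :: "nat \<Rightarrow> ('n::finite) multi_op \<Rightarrow> bool" where
  "bounded_mult_op m T \<longleftrightarrow>
     (\<forall>f \<in> {1..m} \<rightarrow>\<^sub>E lp_space 2. T f \<in> lp_space (2 / real m)) \<and>
     (\<forall>f \<in> {1..m} \<rightarrow>\<^sub>E lp_space 2. \<forall>g \<in> {1..m} \<rightarrow>\<^sub>E lp_space 2.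
        (\<forall>i\<in>{1..m}. AE x in lebesgue. f i x = g i x) \<longrightarrow> (AE x in lebesgue. T f x = T g x)) \<and>
     (\<forall>f \<in> {1..m} \<rightarrow>\<^sub>E lp_space 2. \<forall>j\<in>{1..m}. \<forall>u \<in> lp_space 2. \<forall>v \<in> lp_space 2. \<forall>a b :: complex.
        AE x in lebesgue.
          T (f(j := (\<lambda>y. a * u y + b * v y))) x = a * T (f(j := u)) x + b * T (f(j := v)) x) \<and>
     (\<exists>B. mult_op_bound m T B)"

definition cz_operator :: "nat \<Rightarrow> ('n::finite) kernel \<Rightarrow> 'n multi_op \<Rightarrow> bool" where
  "cz_operator m K T \<longleftrightarrow> cz_kernel m K \<and> bounded_mult_op m T \<and>
     (\<forall>f \<in> {1..m} \<rightarrow>\<^sub>E lp_space 2. AE x in lebesgue. x \<notin> (\<Inter>i\<in>{1..m}. fun_supp (f i)) \<longrightarrow>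
        T f x = (LINT y|Pi\<^sub>M {1..m} (\<lambda>_. lebesgue). K x y * (\<Prod>i=1..m. f i (y i))))"

text \<open>
  A real-valued (signed) Borel measure is represented by its set function, of which only the
  values on Borel sets are used. \<open>total_var\<close> is $\|\nu\|$, and \<open>pos_var\<close>, \<open>neg_var\<close> are the
  Jordan components $\nu^+$, $\nu^-$.
\<close>

definition total_var :: "((real ^ 'n::finite) set \<Rightarrow> real) \<Rightarrow> real" where
  "total_var \<nu> =
     (SUP P \<in> {P. finite P \<and> disjoint P \<and> P \<subseteq> sets borel \<and> \<Union>P = UNIV}. \<Sum>E\<in>P. \<bar>\<nu> E\<bar>)"

definition pos_var :: "((real ^ 'n::finite) set \<Rightarrow> real) \<Rightarrow> (real ^ 'n) measure" where
  "pos_var \<nu> = measure_of UNIV (sets borel) (\<lambda>A. SUP B \<in> {B \<in> sets borel. B \<subseteq> A}. ennreal (\<nu> B))"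

definition neg_var :: "((real ^ 'n::finite) set \<Rightarrow> real) \<Rightarrow> (real ^ 'n) measure" where
  "neg_var \<nu> = pos_var (\<lambda>A. - \<nu> A)"

definition meas_supp :: "((real ^ 'n::finite) set \<Rightarrow> real) \<Rightarrow> (real ^ 'n) set" where
  "meas_supp \<nu> = {x. \<forall>U. open U \<and> x \<in> U \<longrightarrow> (\<exists>B \<in> sets borel. B \<subseteq> U \<and> \<nu> B \<noteq> 0)}"

text \<open>
  $T(\nu_1,\dots,\nu_l,f_{l+1},\dots,f_m)(x)$ for the kernel \<open>K\<close>: the integral against
  $\bigotimes_{i \le l} (\nu_i^+ - \nu_i^-)$, expanded by multilinearity over the set \<open>S\<close> of
  indices at which $\nu_i^-$ is chosen. It is meaningful only for \<open>x\<close> outside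
  \<open>common_supp m l \<nu> f\<close>.
\<close>

definition cz_apply ::
  "nat \<Rightarrow> ('n::finite) kernel \<Rightarrow> nat \<Rightarrow> (nat \<Rightarrow> (real ^ 'n) set \<Rightarrow> real) \<Rightarrow> (nat \<Rightarrow> 'n func) \<Rightarrow> 'n func"
where
  "cz_apply m K l \<nu> f x =
     (\<Sum>S\<in>Pow {1..l}. (- 1) ^ card S *
        (LINT y|Pi\<^sub>M {1..m} (\<lambda>i. if i \<in> S then neg_var (\<nu> i)
                              else if i \<le> l then pos_var (\<nu> i) else lebesgue).
           K x y * (\<Prod>i=l+1..m. f i (y i))))"

definition common_supp ::
  "nat \<Rightarrow> nat \<Rightarrow> (nat \<Rightarrow> (real ^ 'n::finite) set \<Rightarrow> real) \<Rightarrow> (nat \<Rightarrow> 'n func) \<Rightarrow> (real ^ 'n) set"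
where
  "common_supp m l \<nu> f = (\<Inter>i\<in>{1..l}. meas_supp (\<nu> i)) \<inter> (\<Inter>i\<in>{l+1..m}. fun_supp (f i))"

definition discrete_measure ::
  "nat \<Rightarrow> (nat \<Rightarrow> real) \<Rightarrow> (nat \<Rightarrow> real ^ 'n::finite) \<Rightarrow> (real ^ 'n) set \<Rightarrow> real"
where
  "discrete_measure N a p A = (\<Sum>j=1..N. a j * measure (return borel (p j)) A)"

end

theory Submission
  imports Defs
begin

text \<open>
  Off the finite set of atoms, \<open>T(\<nu>\<^sub>1, \<dots>, \<nu>\<^sub>l, f\<^bsub>l+1\<^esub>, \<dots>, f\<^sub>m)\<close> is the pointwise limit of its values
  at complex discrete measures in all \<open>m\<close> slots (round the integration variables by simple functions
  that converge to the identity and fix the atoms). By multilinearity and Fatou's lemma it suffices to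
  bound the set where \<open>\<bar>T(b\<^sub>1, \<dots>, b\<^sub>m)\<bar> > 1\<close> by a constant times \<open>D\<close>, for discrete \<open>b\<^sub>i\<close> of mass at
  most \<open>D\<close>.

  Spread each atom \<open>b\<^sub>i{q}\<close> uniformly with density of modulus one over a set of measure \<open>\<bar>b\<^sub>i{q}\<bar>\<close>
  inside a ball about \<open>q\<close>, greedily, so that these sets are disjoint and exhaust the balls. Let \<open>g\<^sub>i\<close>
  be the resulting density and \<open>c\<^sub>i\<close> the map sending each spread point back to its atom. Then \<open>T(g)\<close> is
  controlled by the \<open>L\<^sup>2\<close> bound, the dilated balls by Vitali covering, and off the dilated balls
  \<open>T(b)(x) - T(g)(x)\<close> is the integral of \<open>(K(x, c(y)) - K(x, y)) g\<^sub>1(y\<^sub>1) \<dots> g\<^sub>m(y\<^sub>m)\<close>, which the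
  smoothness of \<open>K\<close> makes integrable in \<open>x\<close>.
\<close>

section \<open>Lebesgue measure of balls and decay integrals\<close>

text \<open>One ball of the right volume per atom would not do: balls about nearby atoms overlap and
  the densities would add up. Here each radius adapts to what is already occupied, growing until the
  free part of the ball has the measure that its atom needs. Nothing of any ball is left uncovered,
  so the union of the balls has measure equal to the total mass, however the atoms cluster. This
  keeps the dilated balls within a multiple of \<open>D\<close>.

  Unit height is tied to the normalization of the level to 1 and of all masses to a common
  \<open>D\<close>: the squared L2 norm of each density is then at most \<open>D\<close>, and
  Chebyshev's inequality with exponent 2/m bounds the level set of T(g) linearly in
  \<open>D\<close>. For the rounding error the same linearity comes from changing one slot at a
  time: slot k is confined to a set of measure at most \<open>D\<close>, the other m - 1 slots are
  integrated over the whole space, and the decay nm + \<delta> of the smoothness condition is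
  exactly enough to leave the power -(n + \<delta>) of |x - y_k|.\<close>

lemma sigma_finite_lebesgue: "sigma_finite_measure (lebesgue :: 'a::euclidean_space measure)"
proof
  obtain A :: "nat \<Rightarrow> 'a set" where A: "range A \<subseteq> sets lborel" "(\<Union>i. A i) = space lborel"
      "\<And>i. emeasure lborel (A i) \<noteq> \<infinity>"
    using sigma_finite_measure.sigma_finite[OF sigma_finite_lborel] by metis
  show "\<exists>A. countable A \<and> A \<subseteq> sets lebesgue \<and> \<Union> A = space lebesgue \<and>
      (\<forall>a\<in>A. emeasure lebesgue (a :: 'a set) \<noteq> \<infinity>)"
    using A by (intro exI[of _ "range A"]) (auto simp: image_subset_iff)
qed

text \<open>Dyadic shells: where \<open>R + norm (x - y)\<close> is comparable to
  \<open>2 ^ k * R\<close>, the integrand is at most \<open>(2 ^ k * R) powr - ?p\<close>, and a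
  ball containing the shell has volume of order \<open>(2 ^ k * R) ^ DIM('a)\<close>. The products
  form a geometric series of ratio \<open>2 powr - \<epsilon>\<close>.\<close>

lemma nn_integral_decay:
  fixes x :: "'a::euclidean_space"
  assumes "\<epsilon> > 0" and "R > 0"
  shows "(\<integral>\<^sup>+ y. ennreal ((R + norm (x - y)) powr - (real DIM('a) + \<epsilon>)) \<partial>lebesgue)
    \<le> ennreal (unit_ball_vol DIM('a) * 2 ^ DIM('a) / (1 - 2 powr - \<epsilon>) * R powr - \<epsilon>)"
proof -
  let ?p = "real DIM('a) + \<epsilon>"
  let ?q = "(2::real) powr - \<epsilon>"
  have shell: "ennreal ((R + norm (x - y)) powr - ?p) \<le>
      (\<Sum>k. ennreal ((2 ^ k * R) powr - ?p) * indicator (ball x (2 ^ Suc k * R)) y)" for y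
  proof -
    \<comment> \<open>The binary logarithm of this ratio selects the shell; \<open>u \<ge> 1\<close>
      makes its floor a natural number.\<close>
    define u where "u = (R + norm (x - y)) / R"
    have "u \<ge> 1" using assms by (simp add: u_def)
    define k where "k = nat \<lfloor>log 2 u\<rfloor>"
    have k: "\<lfloor>log 2 u\<rfloor> = int k" using \<open>u \<ge> 1\<close> by (simp add: k_def)
    then have "2 powr real k \<le> u" "u < 2 powr (real k + 1)"
      using floor_log_eq_powr_iff[of u 2 "int k"] \<open>u \<ge> 1\<close> by auto
    then have "2 ^ k \<le> u" "u < 2 ^ Suc k"
      using powr_realpow[of 2 k] powr_realpow[of 2 "Suc k"] by (auto simp: add.commute)
    then have lo: "2 ^ k * R \<le> R + norm (x - y)" and hi: "R + norm (x - y) < 2 ^ Suc k * R"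
      using \<open>R > 0\<close> unfolding u_def by (simp_all only: pos_le_divide_eq pos_divide_less_eq)
    have "(R + norm (x - y)) powr - ?p \<le> (2 ^ k * R) powr - ?p"
      using lo assms by (intro powr_mono2') auto
    moreover have "y \<in> ball x (2 ^ Suc k * R)"
      using hi \<open>R > 0\<close> by (auto simp: dist_norm)
    ultimately have "ennreal ((R + norm (x - y)) powr - ?p) \<le>
        ennreal ((2 ^ k * R) powr - ?p) * indicator (ball x (2 ^ Suc k * R)) y"
      by (simp add: ennreal_leI)
    also have "\<dots> \<le> (\<Sum>k. ennreal ((2 ^ k * R) powr - ?p) * indicator (ball x (2 ^ Suc k * R)) y)"
      (is "_ \<le> (\<Sum>k. ?g k)")
    proof -
      have "sum ?g {k} \<le> suminf ?g" by (intro sum_le_suminf) auto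
      then show ?thesis by (simp only: sum.insert sum.empty finite.emptyI empty_iff not_False_eq_True add_0_right)
    qed
    finally show ?thesis .
  qed
  have "(\<integral>\<^sup>+ y. ennreal ((R + norm (x - y)) powr - ?p) \<partial>lebesgue) \<le>
      (\<integral>\<^sup>+ y. (\<Sum>k. ennreal ((2 ^ k * R) powr - ?p) * indicator (ball x (2 ^ Suc k * R)) y) \<partial>lborel)"
    unfolding nn_integral_completion by (intro nn_integral_mono shell)
  also have "\<dots> = (\<Sum>k. \<integral>\<^sup>+ y. ennreal ((2 ^ k * R) powr - ?p) *
      indicator (ball x (2 ^ Suc k * R)) y \<partial>lborel)"
    by (rule nn_integral_suminf)
       (intro borel_measurable_times_ennreal borel_measurable_const borel_measurable_indicator, simp)
  also have "\<dots> = (\<Sum>k. ennreal ((2 ^ k * R) powr - ?p) * emeasure lborel (ball x (2 ^ Suc k * R)))"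
    by (intro suminf_cong nn_integral_cmult_indicator) simp
  also have "\<dots> = (\<Sum>k. ennreal (unit_ball_vol DIM('a) * 2 ^ DIM('a) * R powr - \<epsilon> * ?q ^ k))"
  proof (intro suminf_cong)
    fix k
    have "(2::real) ^ k > 0" by simp
    have "(2 ^ k * R) powr - ?p * (unit_ball_vol DIM('a) * (2 ^ Suc k * R) ^ DIM('a)) =
      unit_ball_vol DIM('a) * 2 ^ DIM('a) * ((2 ^ k * R) powr - ?p * (2 ^ k * R) powr real DIM('a))"
    proof -
      have "(2 ^ Suc k * R) ^ DIM('a) = 2 ^ DIM('a) * (2 ^ k * R) ^ DIM('a)"
        by (simp only: power_Suc mult.assoc power_mult_distrib)
      also have "(2 ^ k * R) ^ DIM('a) = (2 ^ k * R) powr real DIM('a)"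
        using assms by (subst powr_realpow) auto
      finally show ?thesis by (simp only: mult_ac)
    qed
    also have "(2 ^ k * R) powr - ?p * (2 ^ k * R) powr real DIM('a) = (2 ^ k * R) powr - \<epsilon>"
      by (simp add: powr_add[symmetric])
    also have "\<dots> = (2 ^ k) powr - \<epsilon> * R powr - \<epsilon>"
      by (rule powr_mult)
    also have "(2 ^ k) powr - \<epsilon> = ?q ^ k"
    proof -
      have "(2 ^ k) powr - \<epsilon> = (2 powr real k) powr - \<epsilon>" by (simp add: powr_realpow)
      also have "\<dots> = ?q powr real k" by (simp only: powr_powr mult.commute)
      also have "\<dots> = ?q ^ k" by (rule powr_realpow) simp
      finally show ?thesis .
    qed
    also have "unit_ball_vol DIM('a) * 2 ^ DIM('a) * (?q ^ k * R powr - \<epsilon>) =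
        unit_ball_vol DIM('a) * 2 ^ DIM('a) * R powr - \<epsilon> * ?q ^ k" by (simp only: mult_ac)
    finally show "ennreal ((2 ^ k * R) powr - ?p) * emeasure lborel (ball x (2 ^ Suc k * R)) =
        ennreal (unit_ball_vol DIM('a) * 2 ^ DIM('a) * R powr - \<epsilon> * ?q ^ k)"
      using assms by (subst emeasure_ball, simp, subst ennreal_mult[symmetric]) simp_all
  qed
  also have "\<dots> = ennreal (unit_ball_vol DIM('a) * 2 ^ DIM('a) * R powr - \<epsilon> * (1 / (1 - ?q)))"
  proof -
    have q: "norm ?q < 1"
      using powr_less_mono[of "-\<epsilon>" 0 2] assms by simp
    have "(\<lambda>k. unit_ball_vol DIM('a) * 2 ^ DIM('a) * R powr - \<epsilon> * ?q ^ k) sums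
        (unit_ball_vol DIM('a) * 2 ^ DIM('a) * R powr - \<epsilon> * (1 / (1 - ?q)))"
      by (intro sums_mult geometric_sums q)
    then show ?thesis
      by (subst suminf_ennreal2) (auto simp: sums_iff)
  qed
  finally show ?thesis by (simp add: mult_ac)
qed

text \<open>On the region \<open>\<rho> \<le> norm (x - y)\<close> one has
  \<open>\<rho> + norm (y - x) \<le> 2 * norm (x - y)\<close>, which reduces the tail to the decay
  integral with \<open>R = \<rho>\<close>. The prefactor \<open>\<rho> powr \<epsilon>\<close>
  cancels the resulting \<open>\<rho> powr - \<epsilon>\<close>, so the bound is uniform in
  \<open>\<rho>\<close>. The value 0, which occurs when a point coincides with its atom, is covered
  by \<open>0 powr \<epsilon> = 0\<close>.\<close>

lemma nn_integral_tail:
  fixes y :: "'a::euclidean_space"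
  assumes "\<epsilon> > 0" and "\<rho> \<ge> 0"
  shows "(\<integral>\<^sup>+ x. ennreal (\<rho> powr \<epsilon>) * (ennreal (norm (x - y) powr - (real DIM('a) + \<epsilon>)) *
      indicator {x. \<rho> \<le> norm (x - y)} x) \<partial>lebesgue)
    \<le> ennreal (2 powr (real DIM('a) + \<epsilon>) * (unit_ball_vol DIM('a) * 2 ^ DIM('a) / (1 - 2 powr - \<epsilon>)))"
    (is "?L \<le> ennreal (?a * ?c)")
proof (cases "\<rho> = 0")
  case True
  then show ?thesis by simp
next
  case False
  with assms have \<rho>: "\<rho> > 0" by simp
  let ?p = "real DIM('a) + \<epsilon>"
  have "norm (x - y) powr - ?p \<le> ?a * (\<rho> + norm (y - x)) powr - ?p" if "\<rho> \<le> norm (x - y)" for x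
  proof -
    have "norm (x - y) powr - ?p = ?a * (2 * norm (x - y)) powr - ?p"
      by (simp add: powr_mult flip: mult.assoc powr_add)
    also have "\<dots> \<le> ?a * (\<rho> + norm (y - x)) powr - ?p"
      using that \<rho> assms by (intro mult_left_mono powr_mono2') (auto simp: norm_minus_commute)
    finally show ?thesis .
  qed
  then have "?L \<le> (\<integral>\<^sup>+ x. ennreal (\<rho> powr \<epsilon>) * (ennreal ?a *
      ennreal ((\<rho> + norm (y - x)) powr - ?p)) \<partial>lebesgue)"
    by (intro nn_integral_mono mult_left_mono)
       (auto simp: indicator_def ennreal_leI simp flip: ennreal_mult)
  also have "\<dots> = ennreal (\<rho> powr \<epsilon>) * (ennreal ?a *
      (\<integral>\<^sup>+ x. ennreal ((\<rho> + norm (y - x)) powr - ?p) \<partial>lebesgue))"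
    unfolding nn_integral_completion by (simp add: nn_integral_cmult)
  also have "\<dots> \<le> ennreal (\<rho> powr \<epsilon>) * (ennreal ?a * ennreal (?c * \<rho> powr - \<epsilon>))"
    by (intro mult_left_mono nn_integral_decay assms \<rho>) auto
  also have "\<dots> = ennreal (?a * ?c)"
  proof -
    have "1 - 2 powr - \<epsilon> \<ge> (0::real)"
      using powr_mono[of "-\<epsilon>" 0 2] assms by simp
    then have c: "?c \<ge> 0" by simp
    have \<rho>\<epsilon>: "\<rho> powr \<epsilon> * \<rho> powr - \<epsilon> = 1" using \<rho> by (simp flip: powr_add)
    have "ennreal r * (ennreal a * ennreal (c * s)) = ennreal (a * c)"
      if "c \<ge> 0" "r * s = 1" "a \<ge> 0" "r \<ge> 0" "s \<ge> 0" for r a c s :: real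
    proof -
      have "r * (a * (c * s)) = a * c" using that(2) by algebra
      then show ?thesis using that by (simp flip: ennreal_mult)
    qed
    from this[OF c \<rho>\<epsilon> powr_ge_zero powr_ge_zero powr_ge_zero] show ?thesis .
  qed
  finally show ?thesis .
qed

text \<open>Intermediate value theorem in the radius: the measure of the free part vanishes at
  radius 0, grows no faster than the volume of the ball, and reaches any \<open>w\<close> because
  \<open>F\<close> has finite measure.\<close>

lemma ball_Diff_measure_eq:
  fixes x :: "'a::euclidean_space"
  assumes F: "F \<in> lmeasurable" and "w \<ge> 0"
  obtains r where "r \<ge> 0" "measure lebesgue (ball x r - F) = w"
proof -
  let ?v = "unit_ball_vol DIM('a)"
  let ?n = "DIM('a)"
  let ?f = "\<lambda>r. measure lebesgue (ball x r - F)"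
  have FS[simp]: "F \<in> sets lebesgue" using F by (rule fmeasurableD)
  have ball: "measure lebesgue (ball x r) = ?v * r ^ ?n" if "r \<ge> 0" for r
    using content_ball[OF that, of x] by simp
  have mono: "?f r \<le> ?f s" if "r \<le> s" for r s
    using that by (intro measure_mono_fmeasurable) (auto intro!: fmeasurable.Diff F)
  have diff: "?f s - ?f r \<le> ?v * s ^ ?n - ?v * r ^ ?n" if "0 \<le> r" "r \<le> s" for r s
  proof -
    have "?f s \<le> measure lebesgue ((ball x r - F) \<union> (ball x s - ball x r))"
      by (intro measure_mono_fmeasurable)
         (auto intro!: fmeasurable.Un fmeasurable.Diff F)
    also have "\<dots> \<le> ?f r + measure lebesgue (ball x s - ball x r)"
      by (intro measure_Un_le) (use F in auto)
    also have "measure lebesgue (ball x s - ball x r) = ?v * s ^ ?n - ?v * r ^ ?n"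
      using that ball[of r] ball[of s] by (subst measurable_measure_Diff) auto
    finally show ?thesis by simp
  qed
  have "continuous_on {0..} ?f"
    unfolding continuous_on_def
  proof
    fix a :: real assume a: "a \<in> {0..}"
    have bd: "\<bar>?f r - ?f a\<bar> \<le> \<bar>?v * r ^ ?n - ?v * a ^ ?n\<bar>" if "r \<ge> 0" for r
      using diff[of r a] diff[of a r] mono[of r a] mono[of a r] that a by (cases "r \<le> a") auto
    have "((\<lambda>r. ?v * r ^ ?n) \<longlongrightarrow> ?v * a ^ ?n) (at a within {0..})"
      by (intro tendsto_intros)
    then have "((\<lambda>r. \<bar>?v * r ^ ?n - ?v * a ^ ?n\<bar>) \<longlongrightarrow> 0) (at a within {0..})"
      by (intro tendsto_rabs_zero LIM_zero)
    moreover have "\<forall>\<^sub>F r in at a within {0..}. norm (?f r - ?f a) \<le> \<bar>?v * r ^ ?n - ?v * a ^ ?n\<bar>"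
      unfolding eventually_at_filter using bd by (intro always_eventually) simp
    ultimately have "((\<lambda>r. ?f r - ?f a) \<longlongrightarrow> 0) (at a within {0..})"
      by (rule Lim_null_comparison[rotated])
    then show "(?f \<longlongrightarrow> ?f a) (at a within {0..})"
      by (simp add: LIM_zero_iff)
  qed
  moreover have "\<exists>s\<ge>0. w \<le> ?f s"
  proof -
    define s where "s = (w + measure lebesgue F) / ?v + 1"
    have "(w + measure lebesgue F) / ?v \<ge> 0" using assms by simp
    then have "s \<ge> 1" by (simp add: s_def)
    then have "s \<le> s ^ ?n" by (simp add: self_le_power)
    then have "?v * s \<le> ?v * s ^ ?n" by (intro mult_left_mono) auto
    moreover have "?v * s \<ge> w + measure lebesgue F"
    proof -
      have v: "?v > 0" by simp
      have "v * (a / v) = a" if "v > 0" for v a :: real using that by simp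
      from this[OF v] have "?v * ((w + measure lebesgue F) / ?v) = w + measure lebesgue F" .
      then show ?thesis unfolding s_def distrib_left using v by linarith
    qed
    moreover have "measure lebesgue (ball x s) \<le> ?f s + measure lebesgue F"
    proof -
      have "measure lebesgue (ball x s) \<le> measure lebesgue ((ball x s - F) \<union> F)"
        by (intro measure_mono_fmeasurable) (auto intro!: fmeasurable.Un fmeasurable.Diff F)
      also have "\<dots> \<le> ?f s + measure lebesgue F"
        by (intro measure_Un_le) (use F in auto)
      finally show ?thesis .
    qed
    moreover have "measure lebesgue (ball x s) = ?v * s ^ ?n" using ball[of s] \<open>s \<ge> 1\<close> by simp
    ultimately have "w \<le> ?f s" by linarith
    then show ?thesis using \<open>s \<ge> 1\<close> by (intro exI[of _ s]) simp
  qed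
  ultimately obtain s where s: "s \<ge> 0" "w \<le> ?f s" and c: "continuous_on {0..s} ?f"
    by (meson atLeastatMost_subset_iff atLeast_iff continuous_on_subset subsetI atLeastAtMost_iff)
  obtain r where "0 \<le> r" "r \<le> s" "?f r = w"
    using IVT'[of ?f 0 w s] s c assms by auto
  then show thesis using that by blast
qed

text \<open>The new piece is a ball minus everything already taken. Since the earlier pieces fill
  their balls exactly, old and new pieces together again fill the union of all balls.\<close>

lemma ball_partition:
  fixes w :: "'a::euclidean_space \<Rightarrow> real"
  assumes "finite Q" and "\<And>q. q \<in> Q \<Longrightarrow> w q \<ge> 0"
  shows "\<exists>r E. (\<forall>q\<in>Q. E q \<subseteq> ball q (r q) \<and> E q \<in> lmeasurable \<and> measure lebesgue (E q) = w q) \<and>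
    disjoint_family_on E Q \<and> \<Union>(E ` Q) = (\<Union>q\<in>Q. ball q (r q))"
  using assms
proof (induction Q)
  case empty
  then show ?case by (auto simp: disjoint_family_on_def)
next
  case (insert p Q)
  then have "\<And>q. q \<in> Q \<Longrightarrow> w q \<ge> 0" by simp
  from insert.IH[OF this] obtain r E where
     "\<forall>q\<in>Q. E q \<subseteq> ball q (r q) \<and> E q \<in> lmeasurable \<and> measure lebesgue (E q) = w q"
     and IH2: "disjoint_family_on E Q" "\<Union>(E ` Q) = (\<Union>q\<in>Q. ball q (r q))" by blast
  then have IH: "\<And>q. q \<in> Q \<Longrightarrow> E q \<subseteq> ball q (r q)" "\<And>q. q \<in> Q \<Longrightarrow> E q \<in> lmeasurable"
     "\<And>q. q \<in> Q \<Longrightarrow> measure lebesgue (E q) = w q" by auto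
  let ?F = "\<Union>(E ` Q)"
  have F: "?F \<in> lmeasurable" using insert.hyps IH(2) by (intro fmeasurable.finite_UN) auto
  obtain s where s: "s \<ge> 0" "measure lebesgue (ball p s - ?F) = w p"
    using ball_Diff_measure_eq[OF F, of "w p"] insert.prems by auto
  define r' where "r' = r(p := s)"
  define E' where "E' = E(p := ball p s - ?F)"
  have E'r': "E' q = E q \<and> r' q = r q" if "q \<in> Q" for q
    using insert.hyps(2) that by (auto simp: E'_def r'_def)
  then have "\<Union>(E' ` Q) = ?F" "(\<Union>q\<in>Q. ball q (r' q)) = (\<Union>q\<in>Q. ball q (r q))"
    by simp_all
  moreover have "E' p = ball p s - ?F" by (simp add: E'_def)
  ultimately have un: "\<Union>(E' ` insert p Q) = (\<Union>q\<in>insert p Q. ball q (r' q))"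
    using IH2(2) by (auto simp: r'_def)
  have "disjoint_family_on E' (insert p Q)"
    using IH2(1) insert.hyps unfolding disjoint_family_on_def E'_def by auto
  moreover have "\<forall>q\<in>insert p Q. E' q \<subseteq> ball q (r' q) \<and> E' q \<in> lmeasurable \<and> measure lebesgue (E' q) = w q"
    using IH s(2) F by (auto simp: E'_def r'_def intro!: fmeasurable.Diff)
  ultimately show ?case using un by blast
qed

text \<open>The covering lemma is applied to the dilated balls, so the selected ones stay disjoint
  after shrinking to the original radii. Enlarging the dilated radius five times costs the factor
  \<open>(5 * c) ^ DIM('a)\<close>.\<close>

lemma emeasure_Union_dilated_balls_le:
  fixes a :: "'i \<Rightarrow> 'a::euclidean_space"
  assumes "finite Q" and "c \<ge> 1"
  shows "emeasure lebesgue (\<Union>i\<in>Q. ball (a i) (c * r i))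
    \<le> ennreal ((5 * c) ^ DIM('a)) * emeasure lebesgue (\<Union>i\<in>Q. ball (a i) (r i))"
proof -
  \<comment> \<open>Nonpositive radii give empty balls; the covering lemma asks for positive
    ones.\<close>
  let ?K = "{i\<in>Q. r i > 0}"
  define B where "B = (\<Sum>i\<in>Q. \<bar>c * r i\<bar>)"
  have B: "c * r i \<le> B" if "i \<in> Q" for i
    using that assms(1) member_le_sum[of i Q "\<lambda>i. \<bar>c * r i\<bar>"] unfolding B_def by auto
  have "(\<Union>i\<in>Q. ball (a i) (c * r i)) \<subseteq> (\<Union>i\<in>?K. ball (a i) (c * r i))"
  proof
    fix x assume "x \<in> (\<Union>i\<in>Q. ball (a i) (c * r i))"
    then obtain i where i: "i \<in> Q" "x \<in> ball (a i) (c * r i)" by auto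
    then have "0 < c * r i" by (metis ball_eq_empty emptyE not_less)
    then have "r i > 0" using assms(2) by (simp add: zero_less_mult_iff)
    with i show "x \<in> (\<Union>i\<in>?K. ball (a i) (c * r i))" by auto
  qed
  moreover have "0 < c * r i \<and> c * r i \<le> B" if "i \<in> ?K" for i
    using B that assms(2) by (simp add: zero_less_mult_iff)
  ultimately obtain C where "countable C" and C: "C \<subseteq> ?K"
     and disj: "pairwise (\<lambda>i j. disjnt (ball (a i) (c * r i)) (ball (a j) (c * r j))) C"
     and cover: "(\<Union>i\<in>Q. ball (a i) (c * r i)) \<subseteq> (\<Union>i\<in>C. ball (a i) (5 * (c * r i)))"
    by (rule Vitali_covering_lemma_balls)
  have finC: "finite C" using C assms(1) by (auto intro: finite_subset)
  have sub: "ball (a i) (r i) \<subseteq> ball (a i) (c * r i)" if "i \<in> C" for i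
  proof (rule subset_ball)
    have "r i > 0" using that C by auto
    then show "r i \<le> c * r i" using mult_right_mono[OF assms(2), of "r i"] by simp
  qed
  have disj': "disjoint_family_on (\<lambda>i. ball (a i) (r i)) C"
    using disj sub unfolding disjoint_family_on_def pairwise_def disjnt_def by blast
  have "emeasure lebesgue (\<Union>i\<in>Q. ball (a i) (c * r i)) \<le>
      emeasure lebesgue (\<Union>i\<in>C. ball (a i) (5 * (c * r i)))"
    using cover finC by (intro emeasure_mono) auto
  also have "\<dots> \<le> (\<Sum>i\<in>C. emeasure lebesgue (ball (a i) (5 * (c * r i))))"
    using finC by (intro emeasure_subadditive_finite) auto
  also have "\<dots> = (\<Sum>i\<in>C. ennreal ((5 * c) ^ DIM('a)) * emeasure lebesgue (ball (a i) (r i)))"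
  proof (intro sum.cong refl)
    fix i assume "i \<in> C"
    then have "r i > 0" using C by auto
    have "emeasure lebesgue (ball (a i) (5 * (c * r i))) =
        ennreal (unit_ball_vol DIM('a) * (5 * (c * r i)) ^ DIM('a))"
      using \<open>r i > 0\<close> assms(2) by (simp add: emeasure_ball)
    also have "unit_ball_vol DIM('a) * (5 * (c * r i)) ^ DIM('a) =
        (5 * c) ^ DIM('a) * (unit_ball_vol DIM('a) * r i ^ DIM('a))"
      by (simp add: power_mult_distrib)
    also have "ennreal \<dots> = ennreal ((5 * c) ^ DIM('a)) * emeasure lebesgue (ball (a i) (r i))"
      using \<open>r i > 0\<close> assms(2) by (simp add: emeasure_ball ennreal_mult)
    finally show "emeasure lebesgue (ball (a i) (5 * (c * r i))) =
        ennreal ((5 * c) ^ DIM('a)) * emeasure lebesgue (ball (a i) (r i))" .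
  qed
  also have "\<dots> = ennreal ((5 * c) ^ DIM('a)) * emeasure lebesgue (\<Union>i\<in>C. ball (a i) (r i))"
    using finC disj' by (subst sum_emeasure[symmetric]) (auto simp: sum_distrib_left)
  also have "\<dots> \<le> ennreal ((5 * c) ^ DIM('a)) * emeasure lebesgue (\<Union>i\<in>Q. ball (a i) (r i))"
    using C assms(1) by (intro mult_left_mono emeasure_mono) auto
  finally show ?thesis .
qed

section \<open>Regularity of the kernel\<close>

text \<open>Only the summand \<open>q = (\<lambda>i\<in>I. c i)\<close> survives, and if some
  \<open>c i\<close> leaves \<open>Q\<close> both sides vanish through \<open>u i = 0\<close>. This
  separates the variables of a function of rounded coordinates, whatever \<open>F\<close>
  is.\<close>

lemma PiE_sum_of_bool:
  fixes F :: "('i \<Rightarrow> 'a) \<Rightarrow> 'c::comm_ring_1"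
  assumes "finite I" and "finite Q" and "\<And>i. i \<in> I \<Longrightarrow> c i \<in> Q \<or> u i = 0"
  shows "F (\<lambda>i\<in>I. c i) * (\<Prod>i\<in>I. u i) = (\<Sum>q\<in>I \<rightarrow>\<^sub>E Q. F q * (\<Prod>i\<in>I. of_bool (c i = q i) * u i))"
proof (cases "\<forall>i\<in>I. c i \<in> Q")
  case True
  have "(\<Sum>q\<in>I \<rightarrow>\<^sub>E Q. F q * (\<Prod>i\<in>I. of_bool (c i = q i) * u i)) =
      (\<Sum>q\<in>I \<rightarrow>\<^sub>E Q. if q = (\<lambda>i\<in>I. c i) then F (\<lambda>i\<in>I. c i) * (\<Prod>i\<in>I. u i) else 0)"
  proof (intro sum.cong refl)
    fix q assume q: "q \<in> I \<rightarrow>\<^sub>E Q"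
    show "F q * (\<Prod>i\<in>I. of_bool (c i = q i) * u i) =
        (if q = (\<lambda>i\<in>I. c i) then F (\<lambda>i\<in>I. c i) * (\<Prod>i\<in>I. u i) else 0)"
    proof (cases "q = (\<lambda>i\<in>I. c i)")
      case False
      then obtain i where i: "q i \<noteq> (\<lambda>i\<in>I. c i) i" by blast
      then have "i \<in> I" using PiE_arb[OF q, of i] by (metis restrict_apply)
      with i have "c i \<noteq> q i" by simp
      with \<open>i \<in> I\<close> have "(\<Prod>i\<in>I. of_bool (c i = q i) * u i) = 0"
        using \<open>finite I\<close> by (intro prod_zero) (auto intro!: bexI[of _ i])
      with False show ?thesis by simp
    qed auto
  qed
  also have "\<dots> = F (\<lambda>i\<in>I. c i) * (\<Prod>i\<in>I. u i)"
    using True assms by (subst sum.delta) (auto simp: finite_PiE)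
  finally show ?thesis ..
next
  case False
  then obtain i where i: "i \<in> I" "c i \<notin> Q" by auto
  then have "u i = 0" using assms(3) by auto
  then have "(\<Prod>i\<in>I. u i) = 0" "(\<Prod>i\<in>I. of_bool (c i = q i) * u i) = 0" for q
    using \<open>finite I\<close> i by (auto intro!: prod_zero bexI[of _ i])
  then show ?thesis by (simp only: mult_zero_right sum.neutral_const)
qed

lemma simple_functions_to_identity:
  obtains F :: "nat \<Rightarrow> 'a::{metric_space,second_countable_topology} \<Rightarrow> 'a"
  where "\<And>k. F k \<in> borel \<rightarrow>\<^sub>M borel" "\<And>k. finite (range (F k))" "\<And>y. (\<lambda>k. F k y) \<longlonglongrightarrow> y"
proof -
  obtain F :: "nat \<Rightarrow> 'a \<Rightarrow> 'a" where F: "\<forall>k. simple_function borel (F k)"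
      "\<forall>y\<in>space borel. (\<lambda>k. F k y) \<longlonglongrightarrow> y"
    using borel_measurable_implies_sequence_metric[of "\<lambda>y::'a. y" borel undefined] by auto
  show thesis
  proof (rule that[of F])
    fix k
    show "F k \<in> borel \<rightarrow>\<^sub>M borel" using F by (intro borel_measurable_simple_function) auto
    show "finite (range (F k))" using F simple_functionD(1)[of borel "F k"] by simp
  qed (use F in auto)
qed

locale cz_kernel_bounds =
  fixes m :: nat and K :: "('n::finite) kernel" and C \<delta> :: real
  assumes m_pos: "1 \<le> m" and C_pos: "0 < C" and \<delta>_pos: "0 < \<delta>"
  and size_bound: "\<And>x y. y \<in> {1..m} \<rightarrow>\<^sub>E UNIV \<Longrightarrow> \<exists>j\<in>{1..m}. x \<noteq> y j \<Longrightarrow>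
    norm (K x y) \<le> C / (\<Sum>i=1..m. norm (x - y i)) ^ (CARD('n) * m)"
  and smooth_left: "\<And>x x' y. y \<in> {1..m} \<rightarrow>\<^sub>E UNIV \<Longrightarrow>
    norm (x - x') \<le> 1 / 2 * Max ((\<lambda>i. norm (x - y i)) ` {1..m}) \<Longrightarrow>
    norm (K x y - K x' y) \<le> C * norm (x - x') powr \<delta>
      / (\<Sum>i=1..m. norm (x - y i)) powr (real (CARD('n) * m) + \<delta>)"
  and smooth_right: "\<And>j x y z. j \<in> {1..m} \<Longrightarrow> y \<in> {1..m} \<rightarrow>\<^sub>E UNIV \<Longrightarrow>
    norm (y j - z) \<le> 1 / 2 * Max ((\<lambda>i. norm (x - y i)) ` {1..m}) \<Longrightarrow>
    norm (K x y - K x (y(j := z))) \<le> C * norm (y j - z) powr \<delta>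
      / (\<Sum>i=1..m. norm (x - y i)) powr (real (CARD('n) * m) + \<delta>)"
begin

lemma norm_K_le:
  assumes "y \<in> {1..m} \<rightarrow>\<^sub>E UNIV" "j \<in> {1..m}" "d > 0" "d \<le> norm (x - y j)"
  shows "norm (K x y) \<le> C / d ^ (CARD('n) * m)"
proof -
  have "norm (x - y j) \<le> (\<Sum>i=1..m. norm (x - y i))"
    using assms by (intro member_le_sum) auto
  then have le: "d \<le> (\<Sum>i=1..m. norm (x - y i))" using assms by linarith
  have "x \<noteq> y j" using assms by auto
  then have "norm (K x y) \<le> C / (\<Sum>i=1..m. norm (x - y i)) ^ (CARD('n) * m)"
    using assms by (intro size_bound) auto
  also have "\<dots> \<le> C / d ^ (CARD('n) * m)"
    using le assms C_pos by (intro divide_left_mono power_mono mult_pos_pos zero_less_power) auto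
  finally show ?thesis .
qed

text \<open>
  The slots are changed one at a time; the hypothesis on the mixed points \<open>w\<close> makes the smoothness
  condition applicable at every intermediate step.
\<close>

lemma norm_K_diff_le:
  assumes y: "y \<in> {1..m} \<rightarrow>\<^sub>E UNIV" and z: "z \<in> {1..m} \<rightarrow>\<^sub>E UNIV" and S: "0 < S"
    and mixed: "\<And>w. w \<in> {1..m} \<rightarrow>\<^sub>E UNIV \<Longrightarrow> (\<And>i. i \<in> {1..m} \<Longrightarrow> w i = y i \<or> w i = z i) \<Longrightarrow>
      S \<le> (\<Sum>i=1..m. norm (x - w i)) \<and>
      (\<forall>k\<in>{1..m}. norm (y k - z k) \<le> 1 / 2 * Max ((\<lambda>i. norm (x - w i)) ` {1..m}))"
  shows "norm (K x y - K x z) \<le>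
    (\<Sum>k=1..m. C * norm (y k - z k) powr \<delta> / S powr (real (CARD('n) * m) + \<delta>))"
proof -
  define w where "w j = (\<lambda>i. if i \<in> {1..j} then z i else y i)" for j :: nat
  have w: "w j \<in> {1..m} \<rightarrow>\<^sub>E UNIV" if "j \<le> m" for j
    using that y z by (auto simp: w_def PiE_iff extensional_def)
  have w': "w j i = y i \<or> w j i = z i" for i j by (simp add: w_def)
  have tel: "norm (K x y - K x (w j)) \<le>
      (\<Sum>k=1..j. C * norm (y k - z k) powr \<delta> / S powr (real (CARD('n) * m) + \<delta>))" if "j \<le> m" for j
    using that
  proof (induction j)
    case 0
    have "w 0 = y" by (simp add: w_def fun_eq_iff)
    then show ?case by simp
  next
    case (Suc j)
    then have j: "j \<le> m" "Suc j \<in> {1..m}" by auto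
    have upd: "w (Suc j) = (w j)(Suc j := z (Suc j))" by (auto simp: w_def fun_eq_iff)
    have wj: "w j (Suc j) = y (Suc j)" by (simp add: w_def)
    have S1: "S \<le> (\<Sum>i=1..m. norm (x - w j i))"
      and M: "norm (w j (Suc j) - z (Suc j)) \<le> 1 / 2 * Max ((\<lambda>i. norm (x - w j i)) ` {1..m})"
      using mixed[OF w[OF j(1)] w'] j(2) unfolding wj by auto
    have "norm (K x (w j) - K x (w (Suc j))) \<le> C * norm (w j (Suc j) - z (Suc j)) powr \<delta>
      / (\<Sum>i=1..m. norm (x - w j i)) powr (real (CARD('n) * m) + \<delta>)"
      unfolding upd by (intro smooth_right w j M)
    also have "\<dots> \<le> C * norm (w j (Suc j) - z (Suc j)) powr \<delta> / S powr (real (CARD('n) * m) + \<delta>)"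
      using S S1 C_pos \<delta>_pos by (intro divide_left_mono powr_mono2 mult_pos_pos) auto
    finally have "norm (K x (w j) - K x (w (Suc j))) \<le>
        C * norm (y (Suc j) - z (Suc j)) powr \<delta> / S powr (real (CARD('n) * m) + \<delta>)" unfolding wj .
    moreover have "norm (K x y - K x (w (Suc j))) \<le>
        norm (K x y - K x (w j)) + norm (K x (w j) - K x (w (Suc j)))"
      using norm_triangle_ineq[of "K x y - K x (w j)" "K x (w j) - K x (w (Suc j))"] by simp
    ultimately show ?case using Suc.IH[OF j(1)] by simp
  qed
  have "w m = z" using y z by (auto simp: w_def fun_eq_iff PiE_iff extensional_def)
  then show ?thesis using tel[of m] by simp
qed

text \<open>One coordinate away from \<open>x\<close> keeps the maximum in the smoothness condition
  positive, wherever the other coordinates are. Hence the kernel is continuous in \<open>y\<close>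
  at every point except the one with all coordinates equal to \<open>x\<close>.\<close>

lemma tendsto_K:
  assumes ys: "\<And>k::nat. ys k \<in> {1..m} \<rightarrow>\<^sub>E UNIV" and y: "y \<in> {1..m} \<rightarrow>\<^sub>E UNIV"
    and lim: "\<And>i. i \<in> {1..m} \<Longrightarrow> (\<lambda>k. ys k i) \<longlonglongrightarrow> y i"
    and i0: "i0 \<in> {1..m}" "y i0 \<noteq> x"
  shows "(\<lambda>k. K x (ys k)) \<longlonglongrightarrow> K x y"
proof -
  define d where "d = norm (x - y i0)"
  have d: "d > 0" using i0 by (simp add: d_def)
  let ?p = "real (CARD('n) * m) + \<delta>"
  let ?g = "\<lambda>k. \<Sum>i=1..m. C * norm (y i - ys k i) powr \<delta> / (d / 2) powr ?p"
  \<comment> \<open>A quarter of \<open>d\<close> keeps slot \<open>i0\<close> of every mixed point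
    at distance at least \<open>d / 2\<close> from \<open>x\<close>, and half of that distance still
    dominates each displacement.\<close>
  have "\<forall>\<^sub>F k in sequentially. norm (ys k i - y i) < d / 4" if "i \<in> {1..m}" for i
    using lim[OF that] d unfolding tendsto_iff dist_norm by (metis divide_pos_pos zero_less_numeral)
  then have ev: "\<forall>\<^sub>F k in sequentially. \<forall>i\<in>{1..m}. norm (ys k i - y i) < d / 4"
    by (intro eventually_ball_finite) auto
  have "\<forall>\<^sub>F k in sequentially. norm (K x (ys k) - K x y) \<le> ?g k"
    using ev
  proof eventually_elim
    case (elim k)
    have "norm (K x y - K x (ys k)) \<le> ?g k"
    proof (rule norm_K_diff_le[OF y ys], goal_cases)
      case 1
      then show ?case using d by simp
    next
      case (2 w)
      have "norm (y i0 - w i0) \<le> d / 4"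
        using 2(2)[OF i0(1)] elim i0(1) d by (auto simp: norm_minus_commute intro: less_imp_le)
      moreover have "d \<le> norm (x - w i0) + norm (y i0 - w i0)"
        unfolding d_def using norm_triangle_ineq[of "x - w i0" "w i0 - y i0"]
        by (simp add: norm_minus_commute)
      ultimately have far: "d / 2 \<le> norm (x - w i0)" using d by linarith
      also have "\<dots> \<le> (\<Sum>i=1..m. norm (x - w i))"
        using i0 by (intro member_le_sum) auto
      finally have "d / 2 \<le> (\<Sum>i=1..m. norm (x - w i))" .
      moreover have "norm (y i - ys k i) \<le> 1 / 2 * Max ((\<lambda>i. norm (x - w i)) ` {1..m})"
        if "i \<in> {1..m}" for i
      proof -
        have "norm (y i - ys k i) \<le> d / 4"
          using elim that by (auto simp: norm_minus_commute intro: less_imp_le)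
        moreover have "norm (x - w i0) \<le> Max ((\<lambda>i. norm (x - w i)) ` {1..m})"
          using i0 by (intro Max_ge) auto
        ultimately show ?thesis using far by linarith
      qed
      ultimately show ?case by blast
    qed
    then show ?case by (simp add: norm_minus_commute)
  qed
  moreover have "?g \<longlonglongrightarrow> 0"
  proof -
    have "(\<lambda>k. norm (y i - ys k i)) \<longlonglongrightarrow> 0" if "i \<in> {1..m}" for i
      using tendsto_norm[OF tendsto_diff[OF tendsto_const[of "y i"] lim[OF that]]] by simp
    then have "(\<lambda>k. norm (y i - ys k i) powr \<delta>) \<longlonglongrightarrow> 0" if "i \<in> {1..m}" for i
      using that \<delta>_pos by (intro tendsto_zero_powrI[of _ _ _ \<delta>]) (auto intro: always_eventually)
    then have "?g \<longlonglongrightarrow> (\<Sum>i=1..m. C * 0 / (d / 2) powr ?p)"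
      using d by (intro tendsto_sum tendsto_divide tendsto_mult tendsto_const) auto
    then show ?thesis by simp
  qed
  ultimately have "(\<lambda>k. K x (ys k) - K x y) \<longlonglongrightarrow> 0"
    by (rule Lim_null_comparison)
  then show ?thesis by (simp add: LIM_zero_iff)
qed

text \<open>Derived from continuity: off one point, \<open>K x\<close> is the limit of its values at
  rounded arguments, which are finite sums of products of indicators. The result holds for every
  single \<open>x\<close> and for slot measures with atoms, where information up to Lebesgue null
  sets would not suffice.\<close>

lemma measurable_K_right:
  assumes M: "\<And>i. i \<in> {1..m} \<Longrightarrow> (\<lambda>y. y) \<in> M i \<rightarrow>\<^sub>M borel"
  shows "K x \<in> borel_measurable (Pi\<^sub>M {1..m} M)"
proof -
  obtain F :: "nat \<Rightarrow> real ^ 'n \<Rightarrow> real ^ 'n" where F[measurable]: "\<And>k. F k \<in> borel \<rightarrow>\<^sub>M borel"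
    and fin: "\<And>k. finite (range (F k))" and lim: "\<And>y. (\<lambda>k. F k y) \<longlonglongrightarrow> y"
    by (rule simple_functions_to_identity) auto
  \<comment> \<open>This factor removes the point with all coordinates \<open>x\<close>, where the
    kernel need not be continuous. Its value is restored at the end as a constant times
    \<open>1 - ?b\<close>.\<close>
  let ?b = "\<lambda>y. of_bool (\<exists>i\<in>{1..m}. y i \<noteq> x) :: complex"
  have comp[measurable]: "(\<lambda>y. y i) \<in> Pi\<^sub>M {1..m} M \<rightarrow>\<^sub>M borel" if "i \<in> {1..m}" for i
    using measurable_component_singleton[OF that, of M] M[OF that] by (rule measurable_compose)
  have ind: "(\<lambda>y. indicator A (y i) :: complex) \<in> borel_measurable (Pi\<^sub>M {1..m} M)"
    if "i \<in> {1..m}" "A \<in> sets borel" for i A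
    by (rule measurable_compose[OF comp[OF that(1)] borel_measurable_indicator[OF that(2)]])
  have b: "?b \<in> borel_measurable (Pi\<^sub>M {1..m} M)"
  proof -
    have "?b = (\<lambda>y. 1 - (\<Prod>i\<in>{1..m}. indicator {x} (y i)))"
      by (auto simp: fun_eq_iff indicator_def of_bool_def intro!: prod_zero prod.neutral[symmetric])
    then show ?thesis
      by (simp only:) (intro borel_measurable_diff borel_measurable_const borel_measurable_prod ind, auto)
  qed
  have "(\<lambda>y. K x (\<lambda>i\<in>{1..m}. F k (y i))) \<in> borel_measurable (Pi\<^sub>M {1..m} M)" for k
  proof -
    have "(\<lambda>y. K x (\<lambda>i\<in>{1..m}. F k (y i))) =
      (\<lambda>y. \<Sum>q\<in>{1..m} \<rightarrow>\<^sub>E range (F k). K x q * (\<Prod>i\<in>{1..m}. indicator (F k -` {q i}) (y i)))"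
      using PiE_sum_of_bool[of "{1..m}" "range (F k)" "\<lambda>i. F k (y i)" "\<lambda>_. 1" "K x" for y] fin
      by (auto simp: fun_eq_iff of_bool_def indicator_def)
    moreover have "F k -` {a} \<in> sets borel" for a
      using measurable_sets[OF F, of "{a}" k] by simp
    ultimately show ?thesis
      by (simp only:) (intro borel_measurable_sum borel_measurable_times borel_measurable_const
          borel_measurable_prod ind, auto)
  qed
  with b have approx: "(\<lambda>y. ?b y * K x (\<lambda>i\<in>{1..m}. F k (y i))) \<in> borel_measurable (Pi\<^sub>M {1..m} M)" for k
    by (intro borel_measurable_times)
  have "(\<lambda>y. ?b y * K x y) \<in> borel_measurable (Pi\<^sub>M {1..m} M)"
  proof (rule borel_measurable_LIMSEQ_metric[OF approx])
    fix y assume "y \<in> space (Pi\<^sub>M {1..m} M)"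
    then have "y \<in> {1..m} \<rightarrow>\<^sub>E UNIV" by (auto simp: space_PiM PiE_iff)
    then show "(\<lambda>k. ?b y * K x (\<lambda>i\<in>{1..m}. F k (y i))) \<longlonglongrightarrow> ?b y * K x y"
      by (cases "\<exists>i\<in>{1..m}. y i \<noteq> x") (auto intro!: tendsto_K lim)
  qed
  then have "(\<lambda>y. ?b y * K x y + (1 - ?b y) * K x (\<lambda>i\<in>{1..m}. x)) \<in> borel_measurable (Pi\<^sub>M {1..m} M)"
    by (rule borel_measurable_add[OF _ borel_measurable_times[OF
        borel_measurable_diff[OF borel_measurable_const b] borel_measurable_const]])
  then show ?thesis
  proof (rule measurable_cong[THEN iffD1, rotated])
    fix y assume "y \<in> space (Pi\<^sub>M {1..m} M)"
    then have "y \<in> extensional {1..m}" by (auto simp: space_PiM PiE_iff)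
    then have "y = (\<lambda>i\<in>{1..m}. x)" if "\<not> (\<exists>i\<in>{1..m}. y i \<noteq> x)"
      using that by (intro extensionalityI[of y "{1..m}"]) auto
    then show "?b y * K x y + (1 - ?b y) * K x (\<lambda>i\<in>{1..m}. x) = K x y"
      by (cases "\<exists>i\<in>{1..m}. y i \<noteq> x") auto
  qed
qed

text \<open>A single excluded coordinate suffices, since \<open>x \<noteq> q j\<close> already makes
  the maximum in the smoothness condition positive. This is the source of measurability in
  \<open>x\<close> for the approximating sums.\<close>

lemma continuous_on_K_left:
  assumes q: "q \<in> {1..m} \<rightarrow>\<^sub>E UNIV" and j: "j \<in> {1..m}"
  shows "continuous_on (- {q j}) (\<lambda>x. K x q)"
  unfolding continuous_on_def
proof
  fix x assume x: "x \<in> - {q j}"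
  let ?p = "real (CARD('n) * m) + \<delta>"
  let ?S = "\<Sum>i=1..m. norm (x - q i)"
  let ?M = "Max ((\<lambda>i. norm (x - q i)) ` {1..m})"
  have "norm (x - q j) \<le> ?M" using j by (intro Max_ge) auto
  then have "?M > 0" using x by (auto intro: less_le_trans[of 0 "norm (x - q j)"])
  have "\<forall>\<^sub>F x' in at x. dist x' x < 1 / 2 * ?M"
    unfolding eventually_at using \<open>?M > 0\<close> by (intro exI[of _ "1 / 2 * ?M"]) simp
  then have "\<forall>\<^sub>F x' in at x. norm (K x' q - K x q) \<le> C * norm (x - x') powr \<delta> / ?S powr ?p"
  proof eventually_elim
    case (elim x')
    then show ?case
      using smooth_left[OF q, of x x'] by (simp add: dist_norm norm_minus_commute)
  qed
  moreover have "((\<lambda>x'. C * norm (x - x') powr \<delta> / ?S powr ?p) \<longlongrightarrow> 0) (at x)"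
  proof -
    have "((\<lambda>x'. norm (x - x')) \<longlongrightarrow> norm (x - x)) (at x)" by (intro tendsto_intros)
    then have "((\<lambda>x'. norm (x - x') powr \<delta>) \<longlongrightarrow> 0) (at x)"
      using \<delta>_pos by (intro tendsto_zero_powrI[of _ _ _ \<delta>]) (auto intro: always_eventually)
    then have "((\<lambda>x'. C / ?S powr ?p * norm (x - x') powr \<delta>) \<longlongrightarrow> C / ?S powr ?p * 0) (at x)"
      by (intro tendsto_mult tendsto_const)
    then show ?thesis by simp
  qed
  ultimately have "((\<lambda>x'. K x' q - K x q) \<longlongrightarrow> 0) (at x)" by (rule Lim_null_comparison)
  then have "((\<lambda>x. K x q) \<longlongrightarrow> K x q) (at x)" by (simp add: LIM_zero_iff)
  then show "((\<lambda>x. K x q) \<longlongrightarrow> K x q) (at x within - {q j})"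
    by (rule tendsto_within_subset) simp
qed

end

lemma cz_kernel_imp_bounds:
  fixes K :: "('n::finite) kernel"
  assumes "cz_kernel m K" "1 \<le> m"
  shows "\<exists>C \<delta>. cz_kernel_bounds m K C \<delta>"
proof -
  from assms(1) obtain C \<delta> where "C > 0" "\<delta> > 0"
    and size: "\<forall>x. \<forall>y \<in> {1..m} \<rightarrow>\<^sub>E UNIV. (\<exists>j\<in>{1..m}. x \<noteq> y j) \<longrightarrow>
      norm (K x y) \<le> C / (\<Sum>i=1..m. norm (x - y i)) ^ (CARD('n) * m)"
    and left: "\<forall>x x'. \<forall>y \<in> {1..m} \<rightarrow>\<^sub>E UNIV.
      norm (x - x') \<le> 1 / 2 * Max ((\<lambda>i. norm (x - y i)) ` {1..m}) \<longrightarrow>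
      norm (K x y - K x' y) \<le> C * norm (x - x') powr \<delta>
        / (\<Sum>i=1..m. norm (x - y i)) powr (real (CARD('n) * m) + \<delta>)"
    and right: "\<forall>j\<in>{1..m}. \<forall>x. \<forall>y \<in> {1..m} \<rightarrow>\<^sub>E UNIV. \<forall>z.
      norm (y j - z) \<le> 1 / 2 * Max ((\<lambda>i. norm (x - y i)) ` {1..m}) \<longrightarrow>
      norm (K x y - K x (y(j := z))) \<le> C * norm (y j - z) powr \<delta>
        / (\<Sum>i=1..m. norm (x - y i)) powr (real (CARD('n) * m) + \<delta>)"
    unfolding cz_kernel_def by (elim conjE exE)
  have "cz_kernel_bounds m K C \<delta>"
    using assms(2) \<open>C > 0\<close> \<open>\<delta> > 0\<close>
    by (rule cz_kernel_bounds.intro)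
       (erule (1) size[rule_format] left[rule_format] | erule (2) right[rule_format])+
  then show ?thesis by blast
qed

section \<open>The good part and the rounding error\<close>

text \<open>Each summand of the finite expansion is a product of one-slot functions, so its integral
  factorizes. The right-hand side is the operator at discrete measures: slot \<open>i\<close> has at
  a point \<open>a\<close> the integral of \<open>u i\<close> over the fiber of \<open>c i\<close>
  above \<open>a\<close>.\<close>

lemma (in product_sigma_finite) integral_discretize:
  fixes u :: "'i \<Rightarrow> 'a \<Rightarrow> complex" and c :: "'i \<Rightarrow> 'a \<Rightarrow> 'b" and F :: "('i \<Rightarrow> 'b) \<Rightarrow> complex"
  assumes "finite I" and "finite Q"
    and u: "\<And>i. i \<in> I \<Longrightarrow> integrable (M i) (u i)"
    and c: "\<And>i q. i \<in> I \<Longrightarrow> q \<in> Q \<Longrightarrow> {y \<in> space (M i). c i y = q} \<in> sets (M i)"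
    and supp: "\<And>i y. i \<in> I \<Longrightarrow> y \<in> space (M i) \<Longrightarrow> c i y \<in> Q \<or> u i y = 0"
  shows "integrable (Pi\<^sub>M I M) (\<lambda>y. F (\<lambda>i\<in>I. c i (y i)) * (\<Prod>i\<in>I. u i (y i)))" (is ?int)
    and "(LINT y|Pi\<^sub>M I M. F (\<lambda>i\<in>I. c i (y i)) * (\<Prod>i\<in>I. u i (y i))) =
      (\<Sum>q\<in>I \<rightarrow>\<^sub>E Q. F q * (\<Prod>i\<in>I. LINT y|M i. of_bool (c i y = q i) * u i y))" (is ?eq)
proof -
  have eq: "F (\<lambda>i\<in>I. c i (y i)) * (\<Prod>i\<in>I. u i (y i)) =
      (\<Sum>q\<in>I \<rightarrow>\<^sub>E Q. F q * (\<Prod>i\<in>I. of_bool (c i (y i) = q i) * u i (y i)))"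
    if "y \<in> space (Pi\<^sub>M I M)" for y
    using that assms(1,2) supp by (intro PiE_sum_of_bool) (auto simp: space_PiM PiE_iff)
  have int: "integrable (M i) (\<lambda>y. of_bool (c i y = q i) * u i y)" if "i \<in> I" "q \<in> I \<rightarrow>\<^sub>E Q" for i q
  proof -
    have "q i \<in> Q" using that by auto
    then have "integrable (M i) (\<lambda>y. indicator {y \<in> space (M i). c i y = q i} y *\<^sub>R u i y)"
      using that by (intro integrable_mult_indicator c u)
    then show ?thesis
      by (rule Bochner_Integration.integrable_cong[THEN iffD1, rotated 2]) (auto simp: indicator_def)
  qed
  have prod: "integrable (Pi\<^sub>M I M) (\<lambda>y. \<Prod>i\<in>I. of_bool (c i (y i) = q i) * u i (y i))"
    if "q \<in> I \<rightarrow>\<^sub>E Q" for q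
    using that by (intro product_integrable_prod assms(1) int)
  have "integrable (Pi\<^sub>M I M) (\<lambda>y. \<Sum>q\<in>I \<rightarrow>\<^sub>E Q. F q * (\<Prod>i\<in>I. of_bool (c i (y i) = q i) * u i (y i)))"
    by (intro Bochner_Integration.integrable_sum integrable_mult_right prod)
  then show ?int
    by (rule Bochner_Integration.integrable_cong[THEN iffD1, rotated 2]) (simp_all add: eq)
  have "(LINT y|Pi\<^sub>M I M. F (\<lambda>i\<in>I. c i (y i)) * (\<Prod>i\<in>I. u i (y i))) =
      (LINT y|Pi\<^sub>M I M. (\<Sum>q\<in>I \<rightarrow>\<^sub>E Q. F q * (\<Prod>i\<in>I. of_bool (c i (y i) = q i) * u i (y i))))"
    by (intro Bochner_Integration.integral_cong refl eq)
  also have "\<dots> = (\<Sum>q\<in>I \<rightarrow>\<^sub>E Q. LINT y|Pi\<^sub>M I M. F q * (\<Prod>i\<in>I. of_bool (c i (y i) = q i) * u i (y i)))"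
    by (intro Bochner_Integration.integral_sum integrable_mult_right prod)
  also have "\<dots> = (\<Sum>q\<in>I \<rightarrow>\<^sub>E Q. F q * (\<Prod>i\<in>I. LINT y|M i. of_bool (c i y = q i) * u i y))"
  proof (intro sum.cong refl)
    fix q assume q: "q \<in> I \<rightarrow>\<^sub>E Q"
    have "(LINT y|Pi\<^sub>M I M. (\<Prod>i\<in>I. of_bool (c i (y i) = q i) * u i (y i))) =
        (\<Prod>i\<in>I. LINT y|M i. of_bool (c i y = q i) * u i y)"
      by (rule product_integral_prod[OF assms(1) int[OF _ q]])
    then show "(LINT y|Pi\<^sub>M I M. F q * (\<Prod>i\<in>I. of_bool (c i (y i) = q i) * u i (y i))) =
        F q * (\<Prod>i\<in>I. LINT y|M i. of_bool (c i y = q i) * u i y)" by simp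
  qed
  finally show ?eq .
qed

lemma measurable_ident_lebesgue[measurable]: "(\<lambda>x. x) \<in> lebesgue \<rightarrow>\<^sub>M (borel :: 'a::euclidean_space measure)"
  using measurable_completion[of "\<lambda>x. x" lborel borel] by simp

lemma measurable_component_lebesgue:
  "i \<in> I \<Longrightarrow> (\<lambda>y. y i) \<in> Pi\<^sub>M I (\<lambda>_. lebesgue) \<rightarrow>\<^sub>M (borel :: 'a::euclidean_space measure)"
  using measurable_component_singleton[of i I "\<lambda>_. lebesgue"] measurable_ident_lebesgue
  by (rule measurable_compose)

section \<open>The operator bound at densities of modulus at most one\<close>

lemma mult_op_bound_mult_op_norm:
  assumes "bounded_mult_op m T"
  shows "mult_op_bound m T (mult_op_norm m T)"
proof -
  let ?S = "{B. mult_op_bound m T B}"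
  have ne: "?S \<noteq> {}" using assms by (auto simp: bounded_mult_op_def)
  have "0 \<le> Inf ?S" using ne by (intro cInf_greatest) (auto simp: mult_op_bound_def)
  moreover have "lp_norm (2 / real m) (T f) \<le> Inf ?S * (\<Prod>i=1..m. lp_norm 2 (f i))"
    if f: "f \<in> {1..m} \<rightarrow>\<^sub>E lp_space 2" for f
  proof -
    let ?p = "\<Prod>i=1..m. lp_norm 2 (f i)"
    have le: "lp_norm (2 / real m) (T f) \<le> B * ?p" if "B \<in> ?S" for B
      using that f by (auto simp: mult_op_bound_def)
    have "?p \<ge> 0" by (intro prod_nonneg) (auto simp: lp_norm_def)
    show ?thesis
    \<comment> \<open>Passing to the infimum divides by the product of norms; when the product is 0,
      any one admissible bound gives the claim.\<close>
    proof (cases "?p = 0")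
      case True
      obtain B where "B \<in> ?S" using ne by blast
      then show ?thesis using le[of B] unfolding True by simp
    next
      case False
      with \<open>?p \<ge> 0\<close> have "?p > 0" by linarith
      then have "lp_norm (2 / real m) (T f) / ?p \<le> Inf ?S"
        using ne le by (intro cInf_greatest) (simp_all add: pos_divide_le_eq)
      then show ?thesis using \<open>?p > 0\<close> by (simp only: pos_divide_le_eq)
    qed
  qed
  ultimately show ?thesis unfolding mult_op_norm_def mult_op_bound_def by blast
qed

text \<open>Chebyshev's inequality with exponent \<open>2 / m\<close>. Each slot has L2 norm at most
  \<open>D powr (1 / 2)\<close>, and the m-fold product raised to \<open>2 / m\<close> is exactly
  \<open>D\<close>, so the bound is linear in \<open>D\<close>. The factor 4 dominates
  \<open>2 powr (2 / m)\<close>.\<close>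

lemma emeasure_T_good_le:
  fixes f :: "nat \<Rightarrow> ('n::finite) func"
  assumes m: "1 \<le> m" and T: "bounded_mult_op m T" and "D \<ge> 0"
    and E: "\<And>i. i \<in> {1..m} \<Longrightarrow> E i \<in> lmeasurable \<and> measure lebesgue (E i) \<le> D"
    and f: "f \<in> {1..m} \<rightarrow>\<^sub>E borel_measurable lebesgue"
    and bound: "\<And>i y. i \<in> {1..m} \<Longrightarrow> norm (f i y) \<le> indicator (E i) y"
  shows "f \<in> {1..m} \<rightarrow>\<^sub>E lp_space 2"
    and "{x. norm (T f x) > 1 / 2} \<in> sets lebesgue"
    and "emeasure lebesgue {x. norm (T f x) > 1 / 2} \<le>
      ennreal (4 * mult_op_norm m T powr (2 / real m) * D)"
proof -
  have sq: "norm (f i y) powr 2 \<le> indicator (E i) y" if "i \<in> {1..m}" for i y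
  proof -
    have "norm (f i y) powr 2 \<le> indicator (E i) y powr 2"
      by (intro powr_mono2 bound that) auto
    also have "indicator (E i) y powr 2 = (indicator (E i) y :: real)" by (simp add: indicator_def)
    finally show ?thesis .
  qed
  have intE: "integrable lebesgue (indicator (E i) :: _ \<Rightarrow> real)" if "i \<in> {1..m}" for i
    using E[OF that] by (auto simp: fmeasurable_def intro!: integrable_real_indicator)
  have int: "integrable lebesgue (\<lambda>y. norm (f i y) powr 2)" if i: "i \<in> {1..m}" for i
  proof (rule Bochner_Integration.integrable_bound[OF intE[OF i]])
    have [measurable]: "f i \<in> borel_measurable lebesgue" using f i by auto
    show "(\<lambda>y. norm (f i y) powr 2) \<in> borel_measurable lebesgue" by measurable
  qed (use sq[OF i] in auto)
  show fL: "f \<in> {1..m} \<rightarrow>\<^sub>E lp_space 2"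
    using f int by (auto simp: lp_space_def PiE_iff)
  have lp2: "lp_norm 2 (f i) \<le> D powr (1 / 2)" if i: "i \<in> {1..m}" for i
  proof -
    have "(LINT y|lebesgue. norm (f i y) powr 2) \<le> (LINT y|lebesgue. indicator (E i) y)"
      using int[OF i] intE[OF i] sq[OF i] by (intro integral_mono)
    also have "\<dots> \<le> D" using E[OF i] by (simp add: fmeasurableD)
    finally show ?thesis unfolding lp_norm_def by (intro powr_mono2) (auto intro!: integral_nonneg)
  qed
  let ?B = "mult_op_norm m T" and ?p = "2 / real m"
  have B: "mult_op_bound m T ?B" by (rule mult_op_bound_mult_op_norm[OF T])
  then have "?B \<ge> 0" by (simp add: mult_op_bound_def)
  have "lp_norm ?p (T f) \<le> ?B * (\<Prod>i=1..m. lp_norm 2 (f i))"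
    using B fL by (simp add: mult_op_bound_def)
  also have "\<dots> \<le> ?B * (\<Prod>i=1..m. D powr (1 / 2))"
    using lp2 \<open>?B \<ge> 0\<close> by (intro mult_left_mono prod_mono) (auto simp: lp_norm_def)
  finally have norm: "lp_norm ?p (T f) \<le> ?B * (D powr (1 / 2)) ^ m" by simp
  have Tf: "T f \<in> lp_space ?p" using T fL by (simp add: bounded_mult_op_def)
  then have [measurable]: "T f \<in> borel_measurable lebesgue"
    and intT: "integrable lebesgue (\<lambda>x. norm (T f x) powr ?p)" by (auto simp: lp_space_def)
  have "{x \<in> space lebesgue. norm (T f x) > 1 / 2} \<in> sets lebesgue" by measurable
  then show "{x. norm (T f x) > 1 / 2} \<in> sets lebesgue" by simp
  let ?J = "LINT x|lebesgue. norm (T f x) powr ?p"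
  have J: "?J \<ge> 0" by (intro Bochner_Integration.integral_nonneg) auto
  have "?J = (lp_norm ?p (T f)) powr ?p"
    using m J by (simp add: lp_norm_def powr_powr)
  also have "\<dots> \<le> (?B * (D powr (1 / 2)) ^ m) powr ?p"
    using norm by (intro powr_mono2) (auto simp: lp_norm_def)
  also have "\<dots> = ?B powr ?p * D"
    using m \<open>?B \<ge> 0\<close> \<open>D \<ge> 0\<close> by (cases "D = 0") (simp_all add: powr_mult powr_powr flip: powr_realpow)
  finally have J_le: "?J \<le> ?B powr ?p * D" .
  have "emeasure lebesgue {x. norm (T f x) > 1 / 2} \<le>
      emeasure lebesgue {x\<in>space lebesgue. 1 \<le> ennreal 4 * ennreal (norm (T f x) powr ?p)}"
  proof (intro emeasure_mono subsetI)
    fix x assume "x \<in> {x. norm (T f x) > 1 / 2}"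
    then have "2 powr - ?p \<le> norm (T f x) powr ?p"
      using powr_mono2[of ?p "1/2" "norm (T f x)"] by (simp add: powr_divide powr_minus_divide)
    then have "1 \<le> norm (T f x) powr ?p * 2 powr ?p"
      by (simp add: powr_minus_divide pos_divide_le_eq)
    also have "\<dots> \<le> norm (T f x) powr ?p * 2 powr 2"
      using m by (intro mult_left_mono powr_mono) (auto simp: divide_simps)
    finally have "1 \<le> 4 * norm (T f x) powr ?p" by simp
    then have "1 \<le> ennreal (4 * norm (T f x) powr ?p)" by simp
    then show "x \<in> {x\<in>space lebesgue. 1 \<le> ennreal 4 * ennreal (norm (T f x) powr ?p)}"
      by (simp add: ennreal_mult)
  qed measurable
  also have "\<dots> \<le> ennreal 4 * (\<integral>\<^sup>+ x. ennreal (norm (T f x) powr ?p) * indicator (space lebesgue) x \<partial>lebesgue)"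
    by (rule nn_integral_Markov_inequality) measurable
  also have "\<dots> = ennreal 4 * ennreal ?J"
    using intT by (simp add: nn_integral_eq_integral)
  also have "\<dots> \<le> ennreal 4 * ennreal (?B powr ?p * D)"
    using J_le by (intro mult_left_mono ennreal_leI) auto
  also have "\<dots> = ennreal (4 * ?B powr ?p * D)"
    using \<open>D \<ge> 0\<close> by (subst ennreal_mult[symmetric]) (simp_all add: mult.assoc)
  finally show "emeasure lebesgue {x. norm (T f x) > 1 / 2} \<le> ennreal (4 * ?B powr ?p * D)" .
qed

section \<open>The kernel under rounding, integrated over the slots\<close>

context cz_kernel_bounds
begin

text \<open>The factor 3 is what the smoothness condition asks for at mixed points: if
  \<open>x\<close> is three times as far from \<open>z i\<close> as \<open>y i\<close> is, it is
  still twice as far from \<open>y i\<close> as \<open>z i\<close> is. So each displacement is at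
  most half the distance, whichever of the two points the slot holds. Moreover
  \<open>norm (x - z i)\<close> is at least half of \<open>norm (x - y i)\<close>, whence the power
  of 2.\<close>

lemma K_rounding_diff_le:
  assumes y: "y \<in> {1..m} \<rightarrow>\<^sub>E UNIV" and z: "z \<in> {1..m} \<rightarrow>\<^sub>E UNIV"
    and far: "\<And>i. i \<in> {1..m} \<Longrightarrow> 3 * norm (y i - z i) \<le> norm (x - z i) \<and> x \<noteq> z i"
  shows "norm (K x z - K x y) \<le> (\<Sum>k=1..m. C * 2 powr (real (CARD('n) * m) + \<delta>) *
    norm (z k - y k) powr \<delta> * (\<Sum>i=1..m. norm (x - y i)) powr - (real (CARD('n) * m) + \<delta>))"
proof -
  let ?p = "real (CARD('n) * m) + \<delta>"
  let ?s = "\<Sum>i=1..m. norm (x - y i)"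
  have yz: "norm (x - y i) \<le> norm (x - z i) + norm (y i - z i)"
    and zy: "norm (x - z i) \<le> norm (x - y i) + norm (y i - z i)" for i
    using norm_triangle_ineq[of "x - z i" "z i - y i"] norm_triangle_ineq[of "x - y i" "y i - z i"]
    by (simp_all add: norm_minus_commute)
  have pos: "norm (x - z i) > 0" if "i \<in> {1..m}" for i using far[OF that] by simp
  have le1: "1 / 2 * norm (x - y i) \<le> norm (x - z i)" and le2: "2 * norm (y i - z i) \<le> norm (x - y i)"
    if "i \<in> {1..m}" for i
    using far[OF that] yz[of i] zy[of i] norm_ge_zero[of "y i - z i"] by linarith+
  have s_pos: "?s > 0"
  proof -
    have "norm (x - y 1) > 0" using m_pos pos[of 1] zy[of 1] far[of 1] by fastforce
    also have "norm (x - y 1) \<le> ?s" using m_pos by (intro member_le_sum) auto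
    finally show ?thesis .
  qed
  have "norm (K x z - K x y) \<le> (\<Sum>k=1..m. C * norm (z k - y k) powr \<delta> / (1 / 2 * ?s) powr ?p)"
  proof (rule norm_K_diff_le[OF z y], goal_cases)
    case 1
    then show ?case using s_pos by simp
  next
    case (2 w)
    have "1 / 2 * norm (x - y i) \<le> norm (x - w i)" if "i \<in> {1..m}" for i
      using 2(2)[OF that] le1[OF that] by auto
    then have "1 / 2 * ?s \<le> (\<Sum>i=1..m. norm (x - w i))"
      unfolding sum_distrib_left by (rule sum_mono)
    moreover have "norm (z k - y k) \<le> 1 / 2 * Max ((\<lambda>i. norm (x - w i)) ` {1..m})"
      if k: "k \<in> {1..m}" for k
    proof -
      have "norm (z k - y k) \<le> 1 / 2 * norm (x - w k)"
        using 2(2)[OF k]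
      proof
        assume "w k = z k"
        then have "norm (x - w k) = norm (x - z k)" by simp
        then show ?thesis
          using far[OF k, THEN conjunct1] norm_minus_commute[of "z k" "y k"] norm_ge_zero[of "y k - z k"]
          by linarith
      next
        assume "w k = y k"
        then show ?thesis using le2[OF k] norm_minus_commute[of "z k" "y k"] by simp
      qed
      also have "\<dots> \<le> 1 / 2 * Max ((\<lambda>i. norm (x - w i)) ` {1..m})"
        using k by (intro mult_left_mono Max_ge) auto
      finally show ?thesis .
    qed
    ultimately show ?case by blast
  qed
  also have "\<dots> = (\<Sum>k=1..m. C * 2 powr ?p * norm (z k - y k) powr \<delta> * ?s powr - ?p)"
  proof (intro sum.cong refl)
    fix k
    have "(1 / 2 * ?s) powr ?p = ?s powr ?p / 2 powr ?p"
      by (simp only: powr_mult powr_divide powr_one_eq_one) simp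
    then show "C * norm (z k - y k) powr \<delta> / (1 / 2 * ?s) powr ?p =
        C * 2 powr ?p * norm (z k - y k) powr \<delta> * ?s powr - ?p"
      by (simp only: powr_minus divide_inverse inverse_mult_distrib inverse_inverse_eq mult_ac)
  qed
  finally show ?thesis .
qed

text \<open>
  The decay exponent is distributed evenly over the \<open>m\<close> slots, so that the integrals over the slots
  other than \<open>k\<close> factorize.
\<close>

lemma sum_powr_le_prod:
  assumes k: "k \<in> {1..m}" and R: "norm (x - y k) > 0"
  shows "(\<Sum>i=1..m. norm (x - (y i :: real ^ 'n))) powr - (real (CARD('n) * m) + \<delta>) \<le>
    norm (x - y k) powr - (real CARD('n) + \<delta> / m) *
    (\<Prod>i\<in>{1..m} - {k}. (norm (x - y k) + norm (x - y i)) powr - (real CARD('n) + \<delta> / m))"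
proof -
  let ?e = "real CARD('n) + \<delta> / m"
  let ?s = "\<Sum>i=1..m. norm (x - y i)"
  have e: "?e \<ge> 0" using \<delta>_pos by simp
  have p: "real (CARD('n) * m) + \<delta> = ?e * real m" using m_pos by (simp add: field_simps)
  have "norm (x - y k) \<le> ?s" using k by (intro member_le_sum) auto
  then have s_pos: "?s > 0" using R by linarith
  have "?s powr - (?e * real m) = (?s powr - ?e) ^ m"
  proof -
    have "(?s powr - ?e) ^ m = (?s powr - ?e) powr real m"
      using s_pos by (intro powr_realpow[symmetric]) simp
    also have "\<dots> = ?s powr (- ?e * real m)" by (rule powr_powr)
    finally show ?thesis by (simp only: mult_minus_left)
  qed
  also have "\<dots> = (\<Prod>i\<in>{1..m}. ?s powr - ?e)" by simp
  also have "\<dots> = ?s powr - ?e * (\<Prod>i\<in>{1..m} - {k}. ?s powr - ?e)"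
    using k by (subst prod.remove[of _ k]) auto
  also have "\<dots> \<le> norm (x - y k) powr - ?e *
      (\<Prod>i\<in>{1..m} - {k}. (norm (x - y k) + norm (x - y i)) powr - ?e)"
  proof (intro mult_mono prod_mono)
    show "?s powr - ?e \<le> norm (x - y k) powr - ?e"
      using \<open>norm (x - y k) \<le> ?s\<close> R e by (intro powr_mono2') auto
    fix i assume i: "i \<in> {1..m} - {k}"
    have "norm (x - y k) + norm (x - y i) = (\<Sum>j\<in>{k,i}. norm (x - y j))" using i by auto
    also have "\<dots> \<le> ?s" using i k by (intro sum_mono2) auto
    finally show "0 \<le> ?s powr - ?e \<and> ?s powr - ?e \<le> (norm (x - y k) + norm (x - y i)) powr - ?e"
      using R e by (auto intro!: powr_mono2' add_pos_nonneg)
  qed (auto intro!: prod_nonneg)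
  finally show ?thesis unfolding p .
qed

definition decay_const :: "real \<Rightarrow> real" where
  "decay_const \<epsilon> = unit_ball_vol CARD('n) * 2 ^ CARD('n) / (1 - 2 powr - \<epsilon>)"

lemma decay_const_nonneg: "\<epsilon> > 0 \<Longrightarrow> decay_const \<epsilon> \<ge> 0"
  using powr_mono[of "-\<epsilon>" 0 2] by (simp add: decay_const_def)

text \<open>The integral factorizes, and each of the \<open>m - 1\<close> slots contributes
  \<open>R powr - (\<delta> / m)\<close>; the exponents add up to
  \<open>\<delta> / m - \<delta>\<close>.\<close>

lemma nn_integral_other_slots_le:
  assumes k: "k \<in> {1..m}" and R: "R > 0"
  shows "(\<integral>\<^sup>+ y. (\<Prod>i\<in>{1..m} - {k}. ennreal ((R + norm (x - y i)) powr - (real CARD('n) + \<delta> / m)))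
      \<partial>Pi\<^sub>M ({1..m} - {k}) (\<lambda>_. lebesgue :: (real ^ 'n) measure))
    \<le> ennreal (decay_const (\<delta> / m) ^ (m - 1) * R powr (\<delta> / m - \<delta>))"
proof -
  interpret product_sigma_finite "\<lambda>_::nat. lebesgue :: (real ^ 'n) measure"
    by (rule product_sigma_finite.intro) (rule sigma_finite_lebesgue)
  let ?\<epsilon> = "\<delta> / m"
  have \<epsilon>: "?\<epsilon> > 0" using \<delta>_pos m_pos by simp
  have "(\<integral>\<^sup>+ y. (\<Prod>i\<in>{1..m} - {k}. ennreal ((R + norm (x - y i)) powr - (real CARD('n) + ?\<epsilon>)))
      \<partial>Pi\<^sub>M ({1..m} - {k}) (\<lambda>_. lebesgue :: (real ^ 'n) measure)) =
    (\<Prod>i\<in>{1..m} - {k}. \<integral>\<^sup>+ y. ennreal ((R + norm (x - y)) powr - (real CARD('n) + ?\<epsilon>)) \<partial>lebesgue)"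
    by (rule product_nn_integral_prod) (auto intro!: measurable_compose[OF measurable_ident_lebesgue])
  also have "\<dots> \<le> (\<Prod>i\<in>{1..m} - {k}. ennreal (decay_const ?\<epsilon> * R powr - ?\<epsilon>))"
    using nn_integral_decay[OF \<epsilon> R, of x] by (intro prod_mono_ennreal) (simp add: decay_const_def)
  also have "\<dots> = ennreal ((decay_const ?\<epsilon> * R powr - ?\<epsilon>) ^ (m - 1))"
    using k decay_const_nonneg[OF \<epsilon>] by (simp add: ennreal_power)
  also have "(decay_const ?\<epsilon> * R powr - ?\<epsilon>) ^ (m - 1) = decay_const ?\<epsilon> ^ (m - 1) * R powr (?\<epsilon> - \<delta>)"
  proof -
    have "(R powr - ?\<epsilon>) ^ (m - 1) = R powr (- ?\<epsilon> * real (m - 1))"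
      using R by (subst powr_realpow[symmetric]) (simp_all add: powr_powr)
    also have "- ?\<epsilon> * real (m - 1) = ?\<epsilon> - \<delta>"
      using m_pos by (simp add: of_nat_diff field_simps)
    finally show ?thesis by (simp add: power_mult_distrib)
  qed
  finally show ?thesis .
qed

end

lemma measurable_norm_diff_component:
  fixes x :: "'a::euclidean_space"
  assumes "i \<in> I"
  shows "(\<lambda>y. norm (x - y i)) \<in> borel_measurable (Pi\<^sub>M I (\<lambda>_. lebesgue))"
proof -
  have [measurable]: "(\<lambda>y. y i) \<in> Pi\<^sub>M I (\<lambda>_. lebesgue) \<rightarrow>\<^sub>M (borel :: 'a measure)"
    using assms by (rule measurable_component_lebesgue)
  show ?thesis by measurable
qed

context cz_kernel_bounds
begin

text \<open>Slot \<open>k\<close> is integrated last, the others for fixed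
  \<open>norm (x - y k)\<close>. Its own exponent \<open>n + \<delta> / m\<close> and the
  \<open>\<delta> - \<delta> / m\<close> gained from the other slots combine to
  \<open>n + \<delta>\<close>, with n the dimension, so the multilinear decay condenses into an
  integrable tail in one variable.\<close>

lemma nn_integral_slot_le:
  fixes h :: "real ^ 'n \<Rightarrow> ennreal"
  assumes k: "k \<in> {1..m}" and [measurable]: "h \<in> borel_measurable lebesgue"
  shows "(\<integral>\<^sup>+ y. h (y k) * ennreal (norm (x - y k) powr - (real CARD('n) + \<delta> / m)) *
      (\<Prod>i\<in>{1..m} - {k}. ennreal ((norm (x - y k) + norm (x - y i)) powr - (real CARD('n) + \<delta> / m)))
      \<partial>Pi\<^sub>M {1..m} (\<lambda>_. lebesgue))
    \<le> ennreal (decay_const (\<delta> / m) ^ (m - 1)) *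
      (\<integral>\<^sup>+ y. h y * ennreal (norm (x - y) powr - (real CARD('n) + \<delta>)) \<partial>lebesgue)"
proof -
  interpret product_sigma_finite "\<lambda>_::nat. lebesgue :: (real ^ 'n) measure"
    by (rule product_sigma_finite.intro) (rule sigma_finite_lebesgue)
  let ?J = "{1..m} - {k}"
  let ?e = "real CARD('n) + \<delta> / m"
  let ?f = "\<lambda>y. h (y k) * ennreal (norm (x - y k) powr - ?e) *
      (\<Prod>i\<in>?J. ennreal ((norm (x - y k) + norm (x - y i)) powr - ?e))"
  have b: "decay_const (\<delta> / m) ^ (m - 1) \<ge> 0"
    using decay_const_nonneg[of "\<delta> / m"] \<delta>_pos m_pos by simp
  have J: "insert k ?J = {1..m}" using k by auto
  have "(\<lambda>y. h (y k)) \<in> borel_measurable (Pi\<^sub>M (insert k ?J) (\<lambda>_. lebesgue))"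
    by (rule measurable_compose[OF measurable_component_singleton]) auto
  moreover have "(\<lambda>y. norm (x - y i)) \<in> borel_measurable (Pi\<^sub>M (insert k ?J) (\<lambda>_. lebesgue))"
    if "i \<in> insert k ?J" for i
    using that by (rule measurable_norm_diff_component)
  ultimately have meas: "?f \<in> borel_measurable (Pi\<^sub>M (insert k ?J) (\<lambda>_. lebesgue))"
    by (intro borel_measurable_times_ennreal borel_measurable_prod_ennreal measurable_compose[OF _ measurable_ennreal]
        powr_real_measurable borel_measurable_add borel_measurable_const) auto
  have "(\<integral>\<^sup>+ y. ?f y \<partial>Pi\<^sub>M {1..m} (\<lambda>_. lebesgue)) =
      (\<integral>\<^sup>+ t. (\<integral>\<^sup>+ z. ?f (z(k := t)) \<partial>Pi\<^sub>M ?J (\<lambda>_. lebesgue)) \<partial>lebesgue)"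
    using product_nn_integral_insert_rev[OF _ _ meas] unfolding J by simp
  also have "\<dots> \<le> (\<integral>\<^sup>+ t. ennreal (decay_const (\<delta> / m) ^ (m - 1)) *
      (h t * ennreal (norm (x - t) powr - (real CARD('n) + \<delta>))) \<partial>lebesgue)"
  proof (intro nn_integral_mono)
    fix t
    let ?R = "norm (x - t)"
    show "(\<integral>\<^sup>+ z. ?f (z(k := t)) \<partial>Pi\<^sub>M ?J (\<lambda>_. lebesgue)) \<le>
        ennreal (decay_const (\<delta> / m) ^ (m - 1)) * (h t * ennreal (?R powr - (real CARD('n) + \<delta>)))"
    \<comment> \<open>The decay integrals need a positive radius. At \<open>t = x\<close> the
      convention that 0 to any \<open>powr\<close> is 0 makes the inner integrand vanish.\<close>
    proof (cases "?R = 0")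
      case True
      then show ?thesis by simp
    next
      case False
      then have R: "?R > 0" by simp
      have "(\<integral>\<^sup>+ z. ?f (z(k := t)) \<partial>Pi\<^sub>M ?J (\<lambda>_. lebesgue)) =
          (\<integral>\<^sup>+ z. h t * ennreal (?R powr - ?e) *
            (\<Prod>i\<in>?J. ennreal ((?R + norm (x - z i)) powr - ?e)) \<partial>Pi\<^sub>M ?J (\<lambda>_. lebesgue))"
        by (intro nn_integral_cong arg_cong2[where f = "(*)"] prod.cong) auto
      also have "\<dots> = h t * ennreal (?R powr - ?e) *
          (\<integral>\<^sup>+ z. (\<Prod>i\<in>?J. ennreal ((?R + norm (x - z i)) powr - ?e)) \<partial>Pi\<^sub>M ?J (\<lambda>_. lebesgue))"
      proof (rule nn_integral_cmult)
        have "(\<lambda>z. norm (x - z i)) \<in> borel_measurable (Pi\<^sub>M ?J (\<lambda>_. lebesgue))" if "i \<in> ?J" for i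
          using that by (rule measurable_norm_diff_component)
        then show "(\<lambda>z. \<Prod>i\<in>?J. ennreal ((?R + norm (x - z i)) powr - ?e)) \<in>
            borel_measurable (Pi\<^sub>M ?J (\<lambda>_. lebesgue))"
          by (intro borel_measurable_prod_ennreal measurable_compose[OF _ measurable_ennreal]
              powr_real_measurable borel_measurable_add borel_measurable_const) auto
      qed
      also have "\<dots> \<le> h t * ennreal (?R powr - ?e) *
          ennreal (decay_const (\<delta> / m) ^ (m - 1) * ?R powr (\<delta> / m - \<delta>))"
        by (intro mult_left_mono nn_integral_other_slots_le k R) simp
      also have "\<dots> = h t * ennreal (decay_const (\<delta> / m) ^ (m - 1) * (?R powr - ?e * ?R powr (\<delta> / m - \<delta>)))"
      proof -
        have "ennreal a * ennreal (b * r) = ennreal (b * (a * r))" if "a \<ge> 0" "b \<ge> 0" "r \<ge> 0" for a b r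
          using that by (subst ennreal_mult[symmetric]) (auto simp: mult.left_commute)
        from this[OF powr_ge_zero b powr_ge_zero] show ?thesis by (simp only: mult.assoc)
      qed
      also have "?R powr - ?e * ?R powr (\<delta> / m - \<delta>) = ?R powr - (real CARD('n) + \<delta>)"
        by (simp flip: powr_add)
      finally show ?thesis
        using ennreal_mult[OF b powr_ge_zero] by (simp only: mult.left_commute)
    qed
  qed
  also have "\<dots> = ennreal (decay_const (\<delta> / m) ^ (m - 1)) *
      (\<integral>\<^sup>+ y. h y * ennreal (norm (x - y) powr - (real CARD('n) + \<delta>)) \<partial>lebesgue)"
    by (rule nn_integral_cmult) measurable
  finally show ?thesis .
qed

text \<open>What remains of the error at \<open>x\<close>, up to a constant, once all slots but the
  displaced one are integrated out. The indicator records that \<open>x\<close> is at least as far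
  from \<open>y\<close> as \<open>y\<close> is from its atom; it cuts off the singularity at
  \<open>y\<close>. It is written as a function of \<open>x\<close> because the integration in
  \<open>x\<close> comes next.\<close>

definition rounding_error :: "(nat \<Rightarrow> (real ^ 'n) set) \<Rightarrow> (nat \<Rightarrow> real ^ 'n \<Rightarrow> real ^ 'n) \<Rightarrow> real ^ 'n \<Rightarrow> ennreal"
  where "rounding_error E c x = (\<Sum>k=1..m. \<integral>\<^sup>+ y. ennreal (norm (c k y - y) powr \<delta>) *
    (ennreal (norm (x - y) powr - (real CARD('n) + \<delta>)) *
      indicator {x. norm (c k y - y) \<le> norm (x - y)} x) * indicator (E k) y \<partial>lebesgue)"

definition "rounding_const = C * 2 powr (real (CARD('n) * m) + \<delta>) * decay_const (\<delta> / m) ^ (m - 1)"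

lemma rounding_const_nonneg: "rounding_const \<ge> 0"
  using decay_const_nonneg[of "\<delta> / m"] \<delta>_pos m_pos C_pos by (simp add: rounding_const_def)

text \<open>In the term belonging to slot \<open>k\<close> only the restriction to
  \<open>E k\<close> is kept. The other slots are enlarged to the whole space, where the decay is
  already integrable, so no further measures of the sets enter as factors.\<close>

lemma nn_integral_K_rounding_diff_le:
  assumes [measurable]: "\<And>k. k \<in> {1..m} \<Longrightarrow> c k \<in> lebesgue \<rightarrow>\<^sub>M borel"
    "\<And>k. k \<in> {1..m} \<Longrightarrow> E k \<in> sets lebesgue"
    and far: "\<And>i y. i \<in> {1..m} \<Longrightarrow> y \<in> E i \<Longrightarrow> 3 * norm (y - c i y) \<le> norm (x - c i y) \<and> x \<noteq> c i y"
  shows "(\<integral>\<^sup>+ y. ennreal (norm (K x (\<lambda>i\<in>{1..m}. c i (y i)) - K x y)) * (\<Prod>i\<in>{1..m}. indicator (E i) (y i))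
      \<partial>Pi\<^sub>M {1..m} (\<lambda>_. lebesgue)) \<le> ennreal rounding_const * rounding_error E c x"
proof -
  let ?P = "Pi\<^sub>M {1..m} (\<lambda>_. lebesgue :: (real ^ 'n) measure)"
  let ?p = "real (CARD('n) * m) + \<delta>" and ?e = "real CARD('n) + \<delta> / m"
  let ?a = "C * 2 powr ?p"
  let ?h = "\<lambda>k y. ennreal (norm (c k y - y) powr \<delta>) *
    indicator {y. norm (c k y - y) \<le> norm (x - y)} y * indicator (E k) y"
  let ?\<phi> = "\<lambda>k y. ?h k (y k) * ennreal (norm (x - y k) powr - ?e) *
      (\<Prod>i\<in>{1..m} - {k}. ennreal ((norm (x - y k) + norm (x - y i)) powr - ?e))"
  have h[measurable]: "?h k \<in> borel_measurable lebesgue" if k: "k \<in> {1..m}" for k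
  proof -
    note [measurable] = assms(1,2)[OF k]
    have "?h k = (\<lambda>y. ennreal (norm (c k y - y) powr \<delta>) *
        (if norm (c k y - y) \<le> norm (x - y) then 1 else 0) * indicator (E k) y)"
      by (auto simp: fun_eq_iff indicator_def)
    moreover have "\<dots> \<in> borel_measurable lebesgue" by measurable
    ultimately show ?thesis by (simp only:)
  qed
  have \<phi>: "?\<phi> k \<in> borel_measurable ?P" if "k \<in> {1..m}" for k
  proof -
    have "(\<lambda>y. norm (x - y i)) \<in> borel_measurable ?P" if "i \<in> {1..m}" for i
      using that by (rule measurable_norm_diff_component)
    moreover have "(\<lambda>y. ?h k (y k)) \<in> borel_measurable ?P"
      by (rule measurable_compose[OF measurable_component_singleton[OF that] h[OF that]])
    ultimately show ?thesis using that
      by (intro borel_measurable_times_ennreal borel_measurable_prod_ennreal measurable_compose[OF _ measurable_ennreal]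
        powr_real_measurable borel_measurable_add borel_measurable_const) auto
  qed
  have "ennreal (norm (K x (\<lambda>i\<in>{1..m}. c i (y i)) - K x y)) * (\<Prod>i\<in>{1..m}. indicator (E i) (y i)) \<le>
      (\<Sum>k=1..m. ennreal ?a * ?\<phi> k y)" if "y \<in> space ?P" for y
  proof (cases "\<forall>i\<in>{1..m}. y i \<in> E i")
    case True
    have y: "y \<in> {1..m} \<rightarrow>\<^sub>E UNIV" using that by (auto simp: space_PiM PiE_iff)
    let ?z = "\<lambda>i\<in>{1..m}. c i (y i)"
    have "3 * norm (y i - ?z i) \<le> norm (x - ?z i) \<and> x \<noteq> ?z i" if "i \<in> {1..m}" for i
      using far[OF that, of "y i"] True that by auto
    then have "norm (K x ?z - K x y) \<le> (\<Sum>k=1..m. ?a * norm (?z k - y k) powr \<delta> *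
        (\<Sum>i=1..m. norm (x - y i)) powr - ?p)"
      using y by (intro K_rounding_diff_le) auto
    also have "\<dots> \<le> (\<Sum>k=1..m. ?a * norm (c k (y k) - y k) powr \<delta> * (norm (x - y k) powr - ?e *
        (\<Prod>i\<in>{1..m} - {k}. (norm (x - y k) + norm (x - y i)) powr - ?e)))"
    proof (intro sum_mono)
      fix k assume k: "k \<in> {1..m}"
      have "norm (x - y k) > 0"
        using far[OF k, of "y k"] True k by auto
      from sum_powr_le_prod[of k x y, OF k this]
      show "?a * norm (?z k - y k) powr \<delta> * (\<Sum>i=1..m. norm (x - y i)) powr - ?p \<le>
        ?a * norm (c k (y k) - y k) powr \<delta> * (norm (x - y k) powr - ?e *
        (\<Prod>i\<in>{1..m} - {k}. (norm (x - y k) + norm (x - y i)) powr - ?e))"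
        using k C_pos by (intro mult_mono) auto
    qed
    finally have "ennreal (norm (K x ?z - K x y)) \<le> ennreal \<dots>" by (rule ennreal_leI)
    also have "\<dots> = (\<Sum>k=1..m. ennreal ?a * ?\<phi> k y)"
    proof (subst sum_ennreal[symmetric], goal_cases)
      case (1 k)
      show ?case using C_pos by (intro mult_nonneg_nonneg prod_nonneg) auto
    next
      case 2
      show ?case
      proof (intro sum.cong refl)
        fix k assume k: "k \<in> {1..m}"
        have yk: "y k \<in> E k" using True k by blast
        \<comment> \<open>The separation from the atom becomes a separation from \<open>y k\<close>
          itself, which is why the indicator inside \<open>?h\<close> equals 1 here.\<close>
        have "norm (x - c k (y k)) \<le> norm (x - y k) + norm (y k - c k (y k))"
          using norm_triangle_ineq[of "x - y k" "y k - c k (y k)"] by simp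
        then have "norm (c k (y k) - y k) \<le> norm (x - y k)"
          using far[OF k yk, THEN conjunct1] norm_ge_zero[of "y k - c k (y k)"]
            norm_minus_commute[of "c k (y k)" "y k"] by linarith
        then have "?h k (y k) = ennreal (norm (c k (y k) - y k) powr \<delta>)" using yk by simp
        then show "ennreal (?a * norm (c k (y k) - y k) powr \<delta> * (norm (x - y k) powr - ?e *
          (\<Prod>i\<in>{1..m} - {k}. (norm (x - y k) + norm (x - y i)) powr - ?e))) = ennreal ?a * ?\<phi> k y"
          using C_pos
          by (simp add: ennreal_mult mult.assoc prod_nonneg prod_ennreal del: ennreal_mult'')
      qed
    qed
    finally show ?thesis using True by simp
  next
    case False
    then obtain i where "i \<in> {1..m}" "y i \<notin> E i" by blast
    then have "(\<Prod>i\<in>{1..m}. indicator (E i) (y i) :: ennreal) = 0"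
      by (intro prod_zero) (auto intro!: bexI[of _ i])
    then show ?thesis by (simp only: mult_zero_right zero_le)
  qed
  then have "(\<integral>\<^sup>+ y. ennreal (norm (K x (\<lambda>i\<in>{1..m}. c i (y i)) - K x y)) *
      (\<Prod>i\<in>{1..m}. indicator (E i) (y i)) \<partial>?P) \<le> (\<integral>\<^sup>+ y. (\<Sum>k=1..m. ennreal ?a * ?\<phi> k y) \<partial>?P)"
    by (rule nn_integral_mono)
  also have "\<dots> = (\<Sum>k=1..m. \<integral>\<^sup>+ y. ennreal ?a * ?\<phi> k y \<partial>?P)"
    by (intro nn_integral_sum borel_measurable_times_ennreal[OF borel_measurable_const] \<phi>)
  also have "\<dots> = (\<Sum>k=1..m. ennreal ?a * (\<integral>\<^sup>+ y. ?\<phi> k y \<partial>?P))"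
    by (intro sum.cong refl nn_integral_cmult \<phi>)
  also have "\<dots> \<le> (\<Sum>k=1..m. ennreal ?a * (ennreal (decay_const (\<delta> / m) ^ (m - 1)) *
      (\<integral>\<^sup>+ y. ?h k y * ennreal (norm (x - y) powr - (real CARD('n) + \<delta>)) \<partial>lebesgue)))"
    by (intro sum_mono mult_left_mono nn_integral_slot_le h) auto
  also have "\<dots> = ennreal rounding_const * rounding_error E c x"
  proof -
    have *: "(\<integral>\<^sup>+ y. ?h k y * ennreal (norm (x - y) powr - (real CARD('n) + \<delta>)) \<partial>lebesgue) =
      (\<integral>\<^sup>+ y. ennreal (norm (c k y - y) powr \<delta>) * (ennreal (norm (x - y) powr - (real CARD('n) + \<delta>)) *
      indicator {x. norm (c k y - y) \<le> norm (x - y)} x) * indicator (E k) y \<partial>lebesgue)" for k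
      by (intro nn_integral_cong) (auto simp: indicator_def mult_ac)
    have "ennreal rounding_const = ennreal ?a * ennreal (decay_const (\<delta> / m) ^ (m - 1))"
      using C_pos decay_const_nonneg[of "\<delta> / m"] \<delta>_pos m_pos
      unfolding rounding_const_def by (subst ennreal_mult) auto
    then show ?thesis
      unfolding rounding_error_def * by (simp add: sum_distrib_left mult.assoc)
  qed
  finally show ?thesis .
qed

text \<open>Tonelli's theorem: for fixed \<open>y\<close> the integral in \<open>x\<close> is the
  tail integral, whose bound is independent of the displacement, and the remaining integral in
  \<open>y\<close> is the measure of \<open>E k\<close>.\<close>

lemma nn_integral_rounding_error_le:
  assumes c: "\<And>k. k \<in> {1..m} \<Longrightarrow> c k \<in> lebesgue \<rightarrow>\<^sub>M borel"
    and E: "\<And>k. k \<in> {1..m} \<Longrightarrow> E k \<in> sets lebesgue" "\<And>k. k \<in> {1..m} \<Longrightarrow> emeasure lebesgue (E k) \<le> ennreal D"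
  shows "(\<integral>\<^sup>+ x. rounding_error E c x \<partial>lebesgue) \<le>
      ennreal (real m * (2 powr (real CARD('n) + \<delta>) * decay_const \<delta>)) * ennreal D"
    and "rounding_error E c \<in> borel_measurable lebesgue"
proof -
  interpret L: sigma_finite_measure "lebesgue :: (real ^ 'n) measure" by (rule sigma_finite_lebesgue)
  interpret P: pair_sigma_finite "lebesgue :: (real ^ 'n) measure" "lebesgue :: (real ^ 'n) measure" ..
  let ?t = "2 powr (real CARD('n) + \<delta>) * decay_const \<delta>"
  let ?g = "\<lambda>k x y. ennreal (norm (c k y - y) powr \<delta>) *
    (ennreal (norm (x - y) powr - (real CARD('n) + \<delta>)) *
      indicator {x. norm (c k y - y) \<le> norm (x - y)} x) * indicator (E k) y"
  have g: "case_prod (?g k) \<in> borel_measurable (lebesgue \<Otimes>\<^sub>M lebesgue)" if k: "k \<in> {1..m}" for k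
  proof -
    note [measurable] = c[OF k] E(1)[OF k]
    have "case_prod (?g k) = (\<lambda>z. ennreal (norm (c k (snd z) - snd z) powr \<delta>) *
      (ennreal (norm (fst z - snd z) powr - (real CARD('n) + \<delta>)) *
        (if norm (c k (snd z) - snd z) \<le> norm (fst z - snd z) then 1 else 0)) * indicator (E k) (snd z))"
      by (auto simp: fun_eq_iff indicator_def)
    moreover have "\<dots> \<in> borel_measurable (lebesgue \<Otimes>\<^sub>M lebesgue)"
      by measurable
    ultimately show ?thesis by (simp only:)
  qed
  show "rounding_error E c \<in> borel_measurable lebesgue"
    unfolding rounding_error_def[abs_def]
    by (intro borel_measurable_sum L.borel_measurable_nn_integral g)
  have "(\<integral>\<^sup>+ x. rounding_error E c x \<partial>lebesgue) = (\<Sum>k=1..m. \<integral>\<^sup>+ x. \<integral>\<^sup>+ y. ?g k x y \<partial>lebesgue \<partial>lebesgue)"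
    unfolding rounding_error_def
    by (intro nn_integral_sum L.borel_measurable_nn_integral g)
  also have "\<dots> \<le> (\<Sum>k=1..m. ennreal ?t * ennreal D)"
  proof (intro sum_mono)
    fix k assume k: "k \<in> {1..m}"
    have "(\<integral>\<^sup>+ x. \<integral>\<^sup>+ y. ?g k x y \<partial>lebesgue \<partial>lebesgue) = (\<integral>\<^sup>+ y. \<integral>\<^sup>+ x. ?g k x y \<partial>lebesgue \<partial>lebesgue)"
      using P.Fubini'[OF g[OF k]] by simp
    also have "\<dots> \<le> (\<integral>\<^sup>+ y. ennreal ?t * indicator (E k) y \<partial>lebesgue)"
    proof (intro nn_integral_mono)
      fix y
      show "(\<integral>\<^sup>+ x. ?g k x y \<partial>lebesgue) \<le> ennreal ?t * indicator (E k) y"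
      proof (cases "y \<in> E k")
        case True
        then show ?thesis
          using nn_integral_tail[OF \<delta>_pos, of "norm (c k y - y)" y] by (simp add: decay_const_def)
      qed simp
    qed
    also have "\<dots> = ennreal ?t * emeasure lebesgue (E k)"
      using E(1)[OF k] by (rule nn_integral_cmult_indicator)
    also have "\<dots> \<le> ennreal ?t * ennreal D"
      using E(2)[OF k] by (rule mult_left_mono) simp
    finally show "(\<integral>\<^sup>+ x. \<integral>\<^sup>+ y. ?g k x y \<partial>lebesgue \<partial>lebesgue) \<le> ennreal ?t * ennreal D" .
  qed
  also have "\<dots> = ennreal (real m * ?t) * ennreal D"
    by (simp add: ennreal_mult' ennreal_of_nat_eq_real_of_nat mult.assoc)
  finally show "(\<integral>\<^sup>+ x. rounding_error E c x \<partial>lebesgue) \<le> ennreal (real m * ?t) * ennreal D" .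
qed

end

section \<open>Weak type bound for discrete measures in all slots\<close>

text \<open>A piece of measure \<open>norm (b q)\<close> carrying the constant phase
  \<open>sgn (b q)\<close> has total charge \<open>b q\<close>. Pushing the measure with density
  \<open>g\<close> forward along \<open>c\<close> therefore recovers the discrete measure on
  \<open>Q\<close>.\<close>

lemma rounded_density:
  fixes b :: "'a::euclidean_space \<Rightarrow> complex"
  assumes Q: "finite Q"
  obtains r E c g where "E \<in> lmeasurable" "measure lebesgue E = (\<Sum>q\<in>Q. norm (b q))"
    "E = (\<Union>q\<in>Q. ball q (r q))"
    "c \<in> lebesgue \<rightarrow>\<^sub>M borel" "g \<in> borel_measurable lebesgue"
    "\<And>y. norm (g y) \<le> indicator E y"
    "\<And>y. y \<in> E \<Longrightarrow> c y \<in> Q" "\<And>y. y \<in> E \<Longrightarrow> norm (y - c y) < r (c y)"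
    "\<And>q. q \<in> Q \<Longrightarrow> (LINT y|lebesgue. of_bool (c y = q) * g y) = b q"
proof -
  obtain r F where "\<forall>q\<in>Q. F q \<subseteq> ball q (r q) \<and> F q \<in> lmeasurable \<and> measure lebesgue (F q) = norm (b q)"
    and disj: "disjoint_family_on F Q" and un: "\<Union>(F ` Q) = (\<Union>q\<in>Q. ball q (r q))"
    using ball_partition[OF Q, of "\<lambda>q. norm (b q)"] by auto
  then have F: "F q \<subseteq> ball q (r q)" "F q \<in> lmeasurable" "measure lebesgue (F q) = norm (b q)" if "q \<in> Q" for q
    using that by auto
  have FS[measurable]: "F q \<in> sets lebesgue" if "q \<in> Q" for q using F(2)[OF that] by auto
  \<comment> \<open>Finite sums of indicators make both functions measurable, and disjointness
    leaves at most one nonzero term. Outside the pieces \<open>c\<close> has the default value 0,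
    possibly an atom itself; this is harmless because \<open>g\<close> vanishes there.\<close>
  define c where "c y = (\<Sum>q\<in>Q. indicator (F q) y *\<^sub>R q)" for y
  define g where "g y = (\<Sum>q\<in>Q. indicator (F q) y *\<^sub>R sgn (b q))" for y
  have single: "(\<Sum>q'\<in>Q. indicator (F q') y *\<^sub>R f q') = f q" if "q \<in> Q" "y \<in> F q"
    for q y and f :: "'a \<Rightarrow> 'b::real_vector"
  proof -
    have "indicator (F q') y *\<^sub>R f q' = (if q' = q then f q else 0)" if "q' \<in> Q" for q'
      using disj that \<open>q \<in> Q\<close> \<open>y \<in> F q\<close> by (auto simp: disjoint_family_on_def indicator_def)
    then show ?thesis using Q \<open>q \<in> Q\<close> by simp
  qed
  have c: "c y = q" if "q \<in> Q" "y \<in> F q" for q y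
    unfolding c_def by (rule single[OF that])
  have g: "g y = sgn (b q)" if "q \<in> Q" "y \<in> F q" for q y
    unfolding g_def by (rule single[OF that])
  have g0: "g y = 0" if "\<And>q. q \<in> Q \<Longrightarrow> y \<notin> F q" for y
    using that by (simp add: g_def)
  show thesis
  proof (rule that[of "\<Union>(F ` Q)" r c g])
    show "\<Union>(F ` Q) \<in> lmeasurable" using Q F by (intro fmeasurable.finite_UN) auto
    show "measure lebesgue (\<Union>(F ` Q)) = (\<Sum>q\<in>Q. norm (b q))"
    proof (subst measure_finite_Union)
      show "emeasure lebesgue (F q) \<noteq> \<infinity>" if "q \<in> Q" for q
        using fmeasurableD2[OF F(2)[OF that]] unfolding infinity_ennreal_def .
    qed (use Q F(3) disj FS in auto)
    show "c \<in> lebesgue \<rightarrow>\<^sub>M borel" "g \<in> borel_measurable lebesgue"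
      unfolding c_def[abs_def] g_def[abs_def] by measurable
    show "norm (g y) \<le> indicator (\<Union>(F ` Q)) y" for y
      using g g0 by (cases "\<exists>q\<in>Q. y \<in> F q") (auto simp: norm_sgn)
    show "c y \<in> Q" "norm (y - c y) < r (c y)" if y: "y \<in> \<Union>(F ` Q)" for y
    proof -
      obtain q where q: "q \<in> Q" "y \<in> F q" using y by auto
      then have "y \<in> ball q (r q)" using F(1) by blast
      then show "c y \<in> Q" "norm (y - c y) < r (c y)"
        using c[OF q] q by (simp_all add: dist_norm norm_minus_commute)
    qed
    show "(LINT y|lebesgue. of_bool (c y = q) * g y) = b q" if q: "q \<in> Q" for q
    proof -
      have eq: "of_bool (c y = q) * g y = indicator (F q) y *\<^sub>R sgn (b q)" for y
      proof (cases "\<exists>q'\<in>Q. y \<in> F q'")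
        case True
        then obtain q' where "q' \<in> Q" "y \<in> F q'" by auto
        moreover have "y \<notin> F q" if "q' \<noteq> q"
          using disj q that \<open>q' \<in> Q\<close> \<open>y \<in> F q'\<close> by (auto simp: disjoint_family_on_def)
        ultimately show ?thesis
          using c g by (cases "q' = q") auto
      next
        case False
        then show ?thesis using q g0 by auto
      qed
      have "emeasure lebesgue (F q) < \<infinity>"
        using fmeasurableD2[OF F(2)[OF q]] by (simp only: infinity_ennreal_def top.not_eq_extremum)
      then have "(LINT y|lebesgue. of_bool (c y = q) * g y) = measure lebesgue (F q) *\<^sub>R sgn (b q)"
        unfolding eq by (intro has_bochner_integral_integral_eq has_bochner_integral_indicator FS q)
      also have "\<dots> = b q" using F(3)[OF q] by (cases "b q = 0") (simp_all add: sgn_div_norm)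
      finally show ?thesis .
    qed
  qed (use un in auto)
qed

context cz_kernel_bounds
begin

text \<open>The terms bound, in this order, the tripled balls (15 is 3 times the factor 5 of Vitali
  covering, for each of \<open>m\<close> slots), the set where T(g) exceeds 1/2, and the set where
  the rounding error bound reaches 1/2, the factor 2 coming from Markov's inequality.\<close>

definition weak_type_const :: "real \<Rightarrow> real" where
  "weak_type_const B = real m * 15 ^ CARD('n) + 4 * B powr (2 / real m) +
    2 * rounding_const * (real m * (2 powr (real CARD('n) + \<delta>) * decay_const \<delta>))"

text \<open>Level 1 is split evenly between T(g) and the rounding error. The level set is only
  enclosed in a measurable \<open>U\<close>, which is enough for the passage to the limit, where
  such sets are intersected.\<close>

lemma discrete_weak_type_normalized:
  fixes b :: "nat \<Rightarrow> real ^ 'n \<Rightarrow> complex"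
  assumes T: "cz_operator m K T" and Q: "finite Q" and "D \<ge> 0"
    and b: "\<And>i. i \<in> {1..m} \<Longrightarrow> (\<Sum>q\<in>Q. norm (b i q)) \<le> D"
  obtains U where "U \<in> sets lebesgue"
    "{x. norm (\<Sum>q\<in>{1..m} \<rightarrow>\<^sub>E Q. K x q * (\<Prod>i\<in>{1..m}. b i (q i))) > 1} \<subseteq> U"
    "emeasure lebesgue U \<le> ennreal (weak_type_const (mult_op_norm m T) * D)"
proof -
  interpret product_sigma_finite "\<lambda>_::nat. lebesgue :: (real ^ 'n) measure"
    by (rule product_sigma_finite.intro) (rule sigma_finite_lebesgue)
  let ?P = "Pi\<^sub>M {1..m} (\<lambda>_. lebesgue :: (real ^ 'n) measure)"
  define \<Phi> where "\<Phi> i r E c g \<longleftrightarrow> E \<in> lmeasurable \<and> measure lebesgue E = (\<Sum>q\<in>Q. norm (b i q)) \<and>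
    E = (\<Union>q\<in>Q. ball q (r q)) \<and>
    c \<in> lebesgue \<rightarrow>\<^sub>M borel \<and> g \<in> borel_measurable lebesgue \<and>
    (\<forall>y. norm (g y) \<le> indicator E y) \<and>
    (\<forall>y\<in>E. c y \<in> Q \<and> norm (y - c y) < r (c y)) \<and>
    (\<forall>q\<in>Q. (LINT y|lebesgue. of_bool (c y = q) * g y) = b i q)"
    for i :: nat and r E c and g :: "real ^ 'n \<Rightarrow> complex"
  have "\<exists>r E c g. \<Phi> i r E c g" for i
  proof -
    obtain r E c g where "E \<in> lmeasurable" "measure lebesgue E = (\<Sum>q\<in>Q. norm (b i q))"
      "E = (\<Union>q\<in>Q. ball q (r q))" "c \<in> lebesgue \<rightarrow>\<^sub>M borel" "g \<in> borel_measurable lebesgue"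
      "\<And>y. norm (g y) \<le> indicator E y" "\<And>y. y \<in> E \<Longrightarrow> c y \<in> Q" "\<And>y. y \<in> E \<Longrightarrow> norm (y - c y) < r (c y)"
      "\<And>q. q \<in> Q \<Longrightarrow> (LINT y|lebesgue. of_bool (c y = q) * g y) = b i q"
      by (rule rounded_density[OF Q, of "b i"]) (rule that; assumption)
    then have "\<Phi> i r E c g" unfolding \<Phi>_def by (intro conjI allI ballI)
    then show ?thesis by blast
  qed
  then obtain r E c g where rEcg: "\<And>i. \<Phi> i (r i) (E i) (c i) (g i)"
    by metis
  have E: "\<And>i. E i \<in> lmeasurable" "\<And>i. measure lebesgue (E i) = (\<Sum>q\<in>Q. norm (b i q))"
      "\<And>i. E i = (\<Union>q\<in>Q. ball q (r i q))"
    and cm: "\<And>i. c i \<in> lebesgue \<rightarrow>\<^sub>M borel" and gm: "\<And>i. g i \<in> borel_measurable lebesgue"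
    and g: "\<And>i y. norm (g i y) \<le> indicator (E i) y"
    and cQ: "\<And>i y. y \<in> E i \<Longrightarrow> c i y \<in> Q" and cr: "\<And>i y. y \<in> E i \<Longrightarrow> norm (y - c i y) < r i (c i y)"
    and gb: "\<And>i q. q \<in> Q \<Longrightarrow> (LINT y|lebesgue. of_bool (c i y = q) * g i y) = b i q"
    subgoal for i using rEcg[of i] unfolding \<Phi>_def by (elim conjE)
    subgoal for i using rEcg[of i] unfolding \<Phi>_def by (elim conjE)
    subgoal for i using rEcg[of i] unfolding \<Phi>_def by (elim conjE)
    subgoal for i using rEcg[of i] unfolding \<Phi>_def by (elim conjE)
    subgoal for i using rEcg[of i] unfolding \<Phi>_def by (elim conjE)
    subgoal for i y using rEcg[of i] unfolding \<Phi>_def by (elim conjE) (erule spec)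
    subgoal for i y using rEcg[of i] unfolding \<Phi>_def by (elim conjE) (drule (1) bspec, erule conjunct1)
    subgoal for i y using rEcg[of i] unfolding \<Phi>_def by (elim conjE) (drule (1) bspec, erule conjunct2)
    subgoal for i q using rEcg[of i] unfolding \<Phi>_def by (elim conjE) (drule (1) bspec)
    done
  have ES: "E i \<in> sets lebesgue" for i using E(1) by auto
  have Ele: "measure lebesgue (E i) \<le> D" if "i \<in> {1..m}" for i using E(2) b[OF that] by simp
  have eEle: "emeasure lebesgue (E i) \<le> ennreal D" if "i \<in> {1..m}" for i
    unfolding emeasure_eq_ennreal_measure[OF fmeasurableD2[OF E(1)]] by (rule ennreal_leI[OF Ele[OF that]])
  have g0: "g i y = 0" if "y \<notin> E i" for i y using g[of i y] that by simp
  have gint: "integrable lebesgue (g i)" for i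
  proof (rule Bochner_Integration.integrable_bound[of _ "indicator (E i) :: _ \<Rightarrow> real"])
    show "integrable lebesgue (indicator (E i) :: _ \<Rightarrow> real)"
      using E(1)[of i] by (auto simp: fmeasurable_def intro!: integrable_real_indicator)
  qed (use gm g in auto)
  define f where "f = (\<lambda>i\<in>{1..m}. g i)"
  have f: "f \<in> {1..m} \<rightarrow>\<^sub>E borel_measurable lebesgue" using gm by (auto simp: f_def)
  have bT: "bounded_mult_op m T" using T by (simp add: cz_operator_def)
  have "norm (f i y) \<le> indicator (E i) y" if "i \<in> {1..m}" for i y
    using g[of i y] that by (simp add: f_def)
  note good = emeasure_T_good_le[OF m_pos bT \<open>D \<ge> 0\<close> conjI[OF E(1) Ele] f this]
  \<comment> \<open>Tripled radii match the factor 3 of the rounding estimate: outside,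
    \<open>x\<close> is at least \<open>3 * r\<close> away from an atom whose spread points lie
    within \<open>r\<close>.\<close>
  define \<Omega> where "\<Omega> = (\<Union>i\<in>{1..m}. \<Union>q\<in>Q. ball q (3 * r i q))"
  have \<Omega>_sets: "\<Omega> \<in> sets lebesgue" unfolding \<Omega>_def using Q by (intro sets.finite_UN) auto
  have \<Omega>_le: "emeasure lebesgue \<Omega> \<le> ennreal (real m * 15 ^ CARD('n) * D)"
  proof -
    have "emeasure lebesgue \<Omega> \<le> (\<Sum>i\<in>{1..m}. emeasure lebesgue (\<Union>q\<in>Q. ball q (3 * r i q)))"
      unfolding \<Omega>_def using Q by (intro emeasure_subadditive_finite) auto
    also have "\<dots> \<le> (\<Sum>i\<in>{1..m}. ennreal (15 ^ CARD('n)) * ennreal D)"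
    proof (intro sum_mono)
      fix i assume i: "i \<in> {1..m}"
      have "emeasure lebesgue (\<Union>q\<in>Q. ball q (3 * r i q)) \<le> ennreal (15 ^ CARD('n)) * emeasure lebesgue (E i)"
        using emeasure_Union_dilated_balls_le[OF Q, of 3 "\<lambda>q. q" "r i"] E(3)[of i] by simp
      also have "\<dots> \<le> ennreal (15 ^ CARD('n)) * ennreal D"
        using eEle[OF i] by (rule mult_left_mono) simp
      finally show "emeasure lebesgue (\<Union>q\<in>Q. ball q (3 * r i q)) \<le> ennreal (15 ^ CARD('n)) * ennreal D" .
    qed
    also have "\<dots> = ennreal (real m * 15 ^ CARD('n) * D)"
      using \<open>D \<ge> 0\<close> by (simp add: ennreal_of_nat_eq_real_of_nat flip: ennreal_mult)
    finally show ?thesis .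
  qed
  have "AE x in lebesgue. x \<notin> (\<Inter>i\<in>{1..m}. fun_supp (f i)) \<longrightarrow>
      T f x = (LINT y|?P. K x y * (\<Prod>i=1..m. f i (y i)))"
    using T good(1) by (simp add: cz_operator_def)
  then obtain Z where Z: "Z \<in> null_sets lebesgue"
    and TZ: "\<And>x. x \<notin> Z \<Longrightarrow> x \<notin> (\<Inter>i\<in>{1..m}. fun_supp (f i)) \<Longrightarrow>
      T f x = (LINT y|?P. K x y * (\<Prod>i=1..m. f i (y i)))"
    by (elim AE_E3) auto
  let ?H = "rounding_error E c"
  let ?h = "real m * (2 powr (real CARD('n) + \<delta>) * decay_const \<delta>)"
  have h: "?h \<ge> 0" using decay_const_nonneg[OF \<delta>_pos] by simp
  have Hm: "?H \<in> borel_measurable lebesgue"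
    and Hi: "(\<integral>\<^sup>+ x. ?H x \<partial>lebesgue) \<le> ennreal ?h * ennreal D"
    using nn_integral_rounding_error_le[of c E D] cm ES eEle by auto
  define W where "W = {x \<in> space lebesgue. 1 \<le> ennreal (2 * rounding_const) * ?H x}"
  have W_sets: "W \<in> sets lebesgue" unfolding W_def using Hm by measurable
  have W_le: "emeasure lebesgue W \<le> ennreal (2 * rounding_const * ?h * D)"
  proof -
    have "emeasure lebesgue W \<le> ennreal (2 * rounding_const) * (\<integral>\<^sup>+ x. ?H x * indicator (space lebesgue) x \<partial>lebesgue)"
      unfolding W_def using Hm by (intro nn_integral_Markov_inequality) auto
    also have "\<dots> \<le> ennreal (2 * rounding_const) * (ennreal ?h * ennreal D)"
      using Hi by (intro mult_left_mono) auto
    also have "\<dots> = ennreal (2 * rounding_const * ?h * D)"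
    proof -
      have "ennreal a * (ennreal b * ennreal D) = ennreal (a * b * D)" if "a \<ge> 0" "b \<ge> 0" for a b
        using that \<open>D \<ge> 0\<close> by (simp add: ennreal_mult mult.assoc)
      then show ?thesis using h rounding_const_nonneg by simp
    qed
    finally show ?thesis .
  qed
  \<comment> \<open>\<open>Z\<close> holds the points where the kernel formula for
    \<open>T f\<close> may fail. The atoms are removed separately because a ball of radius 0 does
    not contain its centre.\<close>
  define U where "U = \<Omega> \<union> {x. norm (T f x) > 1 / 2} \<union> W \<union> (Q \<union> Z)"
  have Q_null: "Q \<in> null_sets lebesgue"
    using Q by (simp add: finite_imp_null_set_lborel null_sets_completionI)
  show thesis
  proof (rule that[of U])
    have QZ: "Q \<union> Z \<in> null_sets lebesgue" using Q_null Z by (rule null_sets.Un)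
    have \<Omega>T: "\<Omega> \<union> {x. norm (T f x) > 1 / 2} \<in> sets lebesgue"
      using \<Omega>_sets good(2) by (rule sets.Un)
    then show "U \<in> sets lebesgue"
      unfolding U_def by (rule sets.Un[OF sets.Un[OF _ W_sets] null_setsD2[OF QZ]])
    have "emeasure lebesgue U = emeasure lebesgue (\<Omega> \<union> {x. norm (T f x) > 1 / 2} \<union> W)"
      unfolding U_def using sets.Un[OF \<Omega>T W_sets] QZ by (rule emeasure_Un_null_set)
    also have "\<dots> \<le> emeasure lebesgue (\<Omega> \<union> {x. norm (T f x) > 1 / 2}) + emeasure lebesgue W"
      using \<Omega>T W_sets by (rule emeasure_subadditive)
    also have "\<dots> \<le> emeasure lebesgue \<Omega> + emeasure lebesgue {x. norm (T f x) > 1 / 2} + emeasure lebesgue W"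
      using \<Omega>_sets good(2) by (intro add_right_mono emeasure_subadditive)
    also have "\<dots> \<le> ennreal (real m * 15 ^ CARD('n) * D) +
        ennreal (4 * mult_op_norm m T powr (2 / real m) * D) + ennreal (2 * rounding_const * ?h * D)"
      by (intro add_mono \<Omega>_le good(3) W_le)
    also have "\<dots> = ennreal (weak_type_const (mult_op_norm m T) * D)"
    proof -
      have "ennreal (a * D) + ennreal (b * D) + ennreal (c * D) = ennreal ((a + b + c) * D)"
        if "a \<ge> 0" "b \<ge> 0" "c \<ge> 0" for a b c
        using that \<open>D \<ge> 0\<close> by (simp add: distrib_right flip: ennreal_plus)
      then show ?thesis
        unfolding weak_type_const_def by this (use h rounding_const_nonneg in simp_all)
    qed
    finally show "emeasure lebesgue U \<le> ennreal (weak_type_const (mult_op_norm m T) * D)" .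
    show "{x. norm (\<Sum>q\<in>{1..m} \<rightarrow>\<^sub>E Q. K x q * (\<Prod>i\<in>{1..m}. b i (q i))) > 1} \<subseteq> U"
    proof (rule subsetI, rule ccontr)
      fix x assume "x \<in> {x. norm (\<Sum>q\<in>{1..m} \<rightarrow>\<^sub>E Q. K x q * (\<Prod>i\<in>{1..m}. b i (q i))) > 1}"
      then have big: "norm (\<Sum>q\<in>{1..m} \<rightarrow>\<^sub>E Q. K x q * (\<Prod>i\<in>{1..m}. b i (q i))) > 1"
        by (rule CollectD)
      assume "x \<notin> U"
      then have x: "x \<notin> \<Omega>" "x \<notin> Q" "x \<notin> Z" "norm (T f x) \<le> 1 / 2" "x \<notin> W"
        unfolding U_def by (simp_all add: not_less)
      obtain d where d: "d > 0" "\<And>q. q \<in> Q \<Longrightarrow> d \<le> norm (x - q)"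
        using finite_set_avoid[OF Q, of x] x(2) unfolding dist_norm by metis
      have far: "3 * norm (y - c i y) \<le> norm (x - c i y) \<and> x \<noteq> c i y" if "i \<in> {1..m}" "y \<in> E i" for i y
      proof -
        have "x \<notin> ball (c i y) (3 * r i (c i y))"
          using x(1) that cQ by (auto simp: \<Omega>_def)
        then show ?thesis
          using cr[OF that(2)] cQ[OF that(2)] x(2) by (auto simp: dist_norm norm_minus_commute)
      qed
      \<comment> \<open>At least two thirds of the distance from \<open>x\<close> to the atom
        survives the displacement. Hence the kernel is bounded where \<open>?g\<close> is nonzero,
        and \<open>x\<close> lies outside the support of the first density, which makes the kernel
        formula for \<open>T f\<close> available at \<open>x\<close>.\<close>
      have sep: "d / 2 \<le> norm (x - y)" if "i \<in> {1..m}" "y \<in> E i" for i y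
      proof -
        have "norm (x - c i y) \<le> norm (x - y) + norm (y - c i y)"
          using norm_triangle_ineq[of "x - y" "y - c i y"] by simp
        then show ?thesis
          using far[OF that, THEN conjunct1] d(2)[OF cQ[OF that(2)]] norm_ge_zero[of "y - c i y"] by linarith
      qed
      let ?c = "\<lambda>y. \<lambda>i\<in>{1..m}. c i (y i)"
      let ?g = "\<lambda>y. \<Prod>i\<in>{1..m}. g i (y i)"
      have int_c: "integrable ?P (\<lambda>y. K x (?c y) * ?g y)"
        and eq_c: "(LINT y|?P. K x (?c y) * ?g y) = (\<Sum>q\<in>{1..m} \<rightarrow>\<^sub>E Q. K x q * (\<Prod>i\<in>{1..m}. b i (q i)))"
      proof -
        have *: "{y \<in> space lebesgue. c i y = q} \<in> sets lebesgue" for i q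
          using measurable_sets[OF cm, of "{q}" i] by (simp add: vimage_def)
        have **: "c i y \<in> Q \<or> g i y = 0" for i y using cQ g0 by blast
        show "integrable ?P (\<lambda>y. K x (?c y) * ?g y)"
          by (intro integral_discretize(1)[OF _ Q] gint * **) auto
        have "(LINT y|?P. K x (?c y) * ?g y) = (\<Sum>q\<in>{1..m} \<rightarrow>\<^sub>E Q. K x q *
            (\<Prod>i\<in>{1..m}. LINT y|lebesgue. of_bool (c i y = q i) * g i y))"
          by (intro integral_discretize(2)[OF _ Q] gint * **) auto
        also have "\<dots> = (\<Sum>q\<in>{1..m} \<rightarrow>\<^sub>E Q. K x q * (\<Prod>i\<in>{1..m}. b i (q i)))"
          by (intro sum.cong prod.cong refl arg_cong2[where f = "(*)"] gb) auto
        finally show "(LINT y|?P. K x (?c y) * ?g y) = \<dots>" .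
      qed
      have intg: "integrable ?P ?g"
        by (intro product_integrable_prod gint) auto
      have int: "integrable ?P (\<lambda>y. K x y * ?g y)"
      proof (rule Bochner_Integration.integrable_bound)
        show "integrable ?P (\<lambda>y. complex_of_real (C / (d / 2) ^ (CARD('n) * m)) * ?g y)"
          by (intro integrable_mult_right intg)
        show "AE y in ?P. norm (K x y * ?g y) \<le> norm (complex_of_real (C / (d / 2) ^ (CARD('n) * m)) * ?g y)"
        proof (rule AE_I2)
          fix y assume "y \<in> space ?P"
          then have y: "y \<in> {1..m} \<rightarrow>\<^sub>E UNIV" by (auto simp: space_PiM PiE_iff)
          have "?g y = 0 \<or> norm (K x y) \<le> C / (d / 2) ^ (CARD('n) * m)"
          proof (cases "y 1 \<in> E 1")
            case True
            then show ?thesis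
              using norm_K_le[OF y, of 1 "d / 2" x] sep[of 1 "y 1"] m_pos d(1) by simp
          next
            case False
            then have "?g y = 0" using g0 m_pos by (intro prod_zero) (auto intro!: bexI[of _ 1])
            then show ?thesis by blast
          qed
          moreover have "norm (a * G) \<le> norm (complex_of_real \<kappa> * G)" if "G = 0 \<or> norm a \<le> \<kappa>"
            for a G :: complex and \<kappa>
            using that by (cases "G = 0") (auto simp: norm_mult intro!: mult_right_mono)
          ultimately show "norm (K x y * ?g y) \<le> norm (complex_of_real (C / (d / 2) ^ (CARD('n) * m)) * ?g y)"
            by blast
        qed
        show "(\<lambda>y. K x y * ?g y) \<in> borel_measurable ?P"
          using intg by (intro borel_measurable_times measurable_K_right measurable_ident_lebesgue) auto
      qed
      have "x \<notin> fun_supp (f 1)"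
      proof -
        have "f 1 y = 0" if "y \<in> ball x (d / 2)" for y
          using that sep[of 1 y] m_pos g0[of y 1] by (auto simp: f_def dist_norm)
        then have "AE y in lebesgue. y \<in> ball x (d / 2) \<longrightarrow> f 1 y = 0" by simp
        then show ?thesis
          using d(1) unfolding fun_supp_def by (auto intro!: exI[of _ "ball x (d / 2)"])
      qed
      then have "T f x = (LINT y|?P. K x y * (\<Prod>i=1..m. f i (y i)))"
        using m_pos by (intro TZ x) auto
      also have "\<dots> = (LINT y|?P. K x y * ?g y)"
        by (intro Bochner_Integration.integral_cong refl arg_cong2[where f = "(*)"] prod.cong) (auto simp: f_def)
      finally have Tf: "T f x = (LINT y|?P. K x y * ?g y)" .
      have "ennreal (norm ((LINT y|?P. K x (?c y) * ?g y) - T f x)) =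
          ennreal (norm (LINT y|?P. K x (?c y) * ?g y - K x y * ?g y))"
        unfolding Tf using int_c int by simp
      also have "\<dots> \<le> (\<integral>\<^sup>+ y. ennreal (norm (K x (?c y) * ?g y - K x y * ?g y)) \<partial>?P)"
        using int_c int by (intro integral_norm_bound_ennreal) auto
      also have "\<dots> \<le> (\<integral>\<^sup>+ y. ennreal (norm (K x (?c y) - K x y)) * (\<Prod>i\<in>{1..m}. indicator (E i) (y i)) \<partial>?P)"
      proof (intro nn_integral_mono)
        fix y
        have "norm (?g y) \<le> (\<Prod>i\<in>{1..m}. indicator (E i) (y i))"
          unfolding prod_norm[symmetric] using g by (intro prod_mono) auto
        then have "norm (K x (?c y) * ?g y - K x y * ?g y) \<le>
            norm (K x (?c y) - K x y) * (\<Prod>i\<in>{1..m}. indicator (E i) (y i))"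
          by (simp add: norm_mult mult_left_mono flip: left_diff_distrib)
        then have "ennreal (norm (K x (?c y) * ?g y - K x y * ?g y)) \<le>
            ennreal (norm (K x (?c y) - K x y) * (\<Prod>i\<in>{1..m}. indicator (E i) (y i)))"
          by (rule ennreal_leI)
        also have "\<dots> = ennreal (norm (K x (?c y) - K x y)) * (\<Prod>i\<in>{1..m}. indicator (E i) (y i))"
          by (simp add: ennreal_mult prod_nonneg ennreal_indicator flip: prod_ennreal)
        finally show "ennreal (norm (K x (?c y) * ?g y - K x y * ?g y)) \<le> \<dots>" .
      qed
      also have "\<dots> \<le> ennreal rounding_const * ?H x"
        using cm ES far by (intro nn_integral_K_rounding_diff_le) auto
      \<comment> \<open>Outside \<open>W\<close> the error is below 1/2; with
        \<open>norm (T f x) \<le> 1 / 2\<close> this contradicts a value above 1.\<close>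
      finally have "ennreal 2 * ennreal (norm ((LINT y|?P. K x (?c y) * ?g y) - T f x)) \<le>
          ennreal 2 * (ennreal rounding_const * ?H x)" by (rule mult_left_mono) simp
      also have "\<dots> < 1"
        using x(5) rounding_const_nonneg by (simp add: W_def ennreal_mult mult.assoc)
      finally have "ennreal (2 * norm ((LINT y|?P. K x (?c y) * ?g y) - T f x)) < 1"
        by (subst ennreal_mult) simp_all
      then have "2 * norm ((LINT y|?P. K x (?c y) * ?g y) - T f x) < 1"
        by (simp only: ennreal_less_one_iff)
      then show False
        using big x(4) norm_triangle_ineq[of "(LINT y|?P. K x (?c y) * ?g y) - T f x" "T f x"]
        unfolding eq_c by simp
    qed
  qed
qed

end

text \<open>Homogeneity. Multiplying slot \<open>i\<close> by \<open>D / V i\<close> brings every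
  mass below \<open>D\<close> and multiplies the sum by \<open>D ^ m\<close> over the product of the
  \<open>V i\<close>; \<open>D\<close> is the value for which this factor is \<open>1 / t\<close>.
  If some \<open>V i\<close> is 0, the sum itself vanishes.\<close>

lemma (in cz_kernel_bounds) discrete_weak_type:
  fixes w :: "nat \<Rightarrow> real ^ 'n \<Rightarrow> complex" and V :: "nat \<Rightarrow> real"
  assumes T: "cz_operator m K T" and Q: "finite Q" and t: "t > 0"
    and w: "\<And>i. i \<in> {1..m} \<Longrightarrow> (\<Sum>q\<in>Q. norm (w i q)) \<le> V i"
  obtains U where "U \<in> sets lebesgue"
    "{x. norm (\<Sum>q\<in>{1..m} \<rightarrow>\<^sub>E Q. K x q * (\<Prod>i\<in>{1..m}. w i (q i))) > t} \<subseteq> U"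
    "emeasure lebesgue U \<le> ennreal (weak_type_const (mult_op_norm m T) *
      (t powr (- 1 / real m) * (\<Prod>i\<in>{1..m}. V i powr (1 / real m))))"
proof (cases "\<exists>i\<in>{1..m}. V i = 0")
  case True
  then obtain i where i: "i \<in> {1..m}" "V i = 0" by blast
  then have "(\<Sum>q\<in>Q. norm (w i q)) = 0"
    using w[OF i(1)] sum_nonneg[of Q "\<lambda>q. norm (w i q)"] by simp
  then have "w i q = 0" if "q \<in> Q" for q
    using Q that by (simp add: sum_nonneg_eq_0_iff)
  then have "(\<Prod>j\<in>{1..m}. w j (q j)) = 0" if "q \<in> {1..m} \<rightarrow>\<^sub>E Q" for q
    using that i(1) PiE_mem[OF that i(1)] by (intro prod_zero) (auto intro!: bexI[of _ i])
  then have "(\<Sum>q\<in>{1..m} \<rightarrow>\<^sub>E Q. K x q * (\<Prod>i\<in>{1..m}. w i (q i))) = 0" for x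
    by (intro sum.neutral) simp
  then have "{x. norm (\<Sum>q\<in>{1..m} \<rightarrow>\<^sub>E Q. K x q * (\<Prod>i\<in>{1..m}. w i (q i))) > t} \<subseteq> {}"
    using t by (simp only: norm_zero) auto
  then show thesis by (intro that[of "{}"]) auto
next
  case False
  have V: "V i > 0" if "i \<in> {1..m}" for i
    using False that w[OF that] sum_nonneg[of Q "\<lambda>q. norm (w i q)"] by (force simp: less_le)
  define D where "D = t powr (- 1 / real m) * (\<Prod>i\<in>{1..m}. V i powr (1 / real m))"
  have D: "D > 0" unfolding D_def
  proof (intro mult_pos_pos prod_pos)
    show "V i powr (1 / real m) > 0" if "i \<in> {1..m}" for i using V[OF that] by simp
  qed (use t in simp)
  have "D ^ m = (t powr (- 1 / real m)) ^ m * (\<Prod>i\<in>{1..m}. (V i powr (1 / real m)) ^ m)"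
    by (simp add: D_def power_mult_distrib prod_power_distrib)
  also have "(t powr (- 1 / real m)) ^ m = t powr - 1"
    using t m_pos by (subst powr_realpow[symmetric]) (simp_all add: powr_powr)
  also have "(\<Prod>i\<in>{1..m}. (V i powr (1 / real m)) ^ m) = (\<Prod>i\<in>{1..m}. V i)"
  proof (intro prod.cong refl)
    fix i assume "i \<in> {1..m}"
    then show "(V i powr (1 / real m)) ^ m = V i"
      using V[of i] m_pos by (subst powr_realpow[symmetric]) (simp_all add: powr_powr)
  qed
  finally have Dm: "t * D ^ m = (\<Prod>i\<in>{1..m}. V i)"
    using t by (simp add: powr_minus_divide)
  define b where "b i q = w i q * of_real (D / V i)" for i q
  have "(\<Sum>q\<in>Q. norm (b i q)) \<le> D" if i: "i \<in> {1..m}" for i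
  proof -
    have "(\<Sum>q\<in>Q. norm (b i q)) = (\<Sum>q\<in>Q. norm (w i q)) * (D / V i)"
      unfolding sum_distrib_right using D V[OF i] by (intro sum.cong) (simp_all add: b_def norm_mult norm_divide)
    also have "\<dots> \<le> V i * (D / V i)"
      using w[OF i] D V[OF i] by (intro mult_right_mono) auto
    also have "\<dots> = D" using V[OF i] by simp
    finally show ?thesis .
  qed
  then obtain U where U: "U \<in> sets lebesgue"
    "{x. norm (\<Sum>q\<in>{1..m} \<rightarrow>\<^sub>E Q. K x q * (\<Prod>i\<in>{1..m}. b i (q i))) > 1} \<subseteq> U"
    "emeasure lebesgue U \<le> ennreal (weak_type_const (mult_op_norm m T) * D)"
    using discrete_weak_type_normalized[OF T Q less_imp_le[OF D], of b] by blast
  have scale: "(\<Sum>q\<in>{1..m} \<rightarrow>\<^sub>E Q. K x q * (\<Prod>i\<in>{1..m}. b i (q i))) =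
      (\<Sum>q\<in>{1..m} \<rightarrow>\<^sub>E Q. K x q * (\<Prod>i\<in>{1..m}. w i (q i))) / of_real t" for x
  proof -
    have "(\<Prod>i\<in>{1..m}. D / V i) = D ^ m / (\<Prod>i\<in>{1..m}. V i)" by (simp add: prod_dividef)
    also have "\<dots> = D ^ m / (t * D ^ m)" by (simp only: Dm)
    also have "\<dots> = 1 / t" using D by simp
    finally have "complex_of_real (\<Prod>i\<in>{1..m}. D / V i) = of_real (1 / t)" by (rule arg_cong)
    then have "(\<Prod>i\<in>{1..m}. complex_of_real (D / V i)) = 1 / of_real t"
      by (simp only: of_real_prod of_real_divide of_real_1)
    then have "(\<Prod>i\<in>{1..m}. b i (q i)) = (\<Prod>i\<in>{1..m}. w i (q i)) / of_real t" for q
      unfolding b_def prod.distrib by simp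
    then show ?thesis by (simp only: sum_divide_distrib times_divide_eq_right)
  qed
  show thesis
  proof (rule that[OF U(1)])
    have "norm (z / complex_of_real t) > 1 \<longleftrightarrow> norm z > t" for z
      using t by (simp add: norm_divide pos_less_divide_eq)
    then show "{x. norm (\<Sum>q\<in>{1..m} \<rightarrow>\<^sub>E Q. K x q * (\<Prod>i\<in>{1..m}. w i (q i))) > t} \<subseteq> U"
      using U(2) unfolding scale by simp
  qed (use U(3) in \<open>simp only: D_def\<close>)
qed

section \<open>Jordan components of discrete measures\<close>

text \<open>Since \<^const>\<open>ennreal\<close> sends negative numbers to \<open>0\<close>, only the points of positive weight carry mass.\<close>

definition point_masses :: "'a::{t1_space,second_countable_topology} set \<Rightarrow> ('a \<Rightarrow> real) \<Rightarrow> 'a measure" where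
  "point_masses P w = distr (point_measure P (\<lambda>q. ennreal (w q))) borel (\<lambda>q. q)"

lemma sets_point_masses[measurable_cong, simp]: "sets (point_masses P w) = sets borel"
  and space_point_masses[simp]: "space (point_masses P w) = UNIV"
  by (simp_all add: point_masses_def)

lemma emeasure_point_masses:
  assumes "finite P" "A \<in> sets borel"
  shows "emeasure (point_masses P w) A = (\<Sum>q\<in>P \<inter> A. ennreal (w q))"
  using assms unfolding point_masses_def
  by (subst emeasure_distr) (auto simp: space_point_measure emeasure_point_measure_finite
      sets_point_measure Int_commute measurable_def)

lemma finite_measure_point_masses: "finite P \<Longrightarrow> finite_measure (point_masses P w)"
  by (rule finite_measureI) (simp add: emeasure_point_masses)

lemma measure_point_masses:
  assumes "finite P" "A \<in> sets borel"
  shows "measure (point_masses P w) A = (\<Sum>q\<in>P \<inter> A. max 0 (w q))"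
proof -
  have "emeasure (point_masses P w) A = (\<Sum>q\<in>P \<inter> A. ennreal (w q))"
    by (rule emeasure_point_masses[OF assms])
  also have "\<dots> = (\<Sum>q\<in>P \<inter> A. ennreal (max 0 (w q)))"
    by (intro sum.cong refl) (simp add: max_def ennreal_neg)
  also have "\<dots> = ennreal (\<Sum>q\<in>P \<inter> A. max 0 (w q))" by (rule sum_ennreal) simp
  finally show ?thesis unfolding measure_def by (simp add: sum_nonneg)
qed

text \<open>The supremum defining the positive variation of \<open>A\<close> is attained at the
  finite set of points of \<open>P \<inter> A\<close> with positive weight.\<close>

lemma pos_var_finite_support:
  fixes \<nu> :: "(real ^ 'n::finite) set \<Rightarrow> real"
  assumes P: "finite P" and \<nu>: "\<And>A. A \<in> sets borel \<Longrightarrow> \<nu> A = (\<Sum>q\<in>P \<inter> A. w q)"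
  shows "pos_var \<nu> = point_masses P w"
proof -
  have "(SUP B \<in> {B \<in> sets borel. B \<subseteq> A}. ennreal (\<nu> B)) = emeasure (point_masses P w) A"
    if A: "A \<in> sets borel" for A
  proof (intro antisym SUP_least)
    fix B assume B: "B \<in> {B \<in> sets borel. B \<subseteq> A}"
    have "\<nu> B \<le> (\<Sum>q\<in>P \<inter> B. max 0 (w q))" using B \<nu> by (auto intro!: sum_mono)
    also have "\<dots> \<le> (\<Sum>q\<in>P \<inter> A. max 0 (w q))" using B P by (intro sum_mono2) auto
    finally have "ennreal (\<nu> B) \<le> ennreal (\<Sum>q\<in>P \<inter> A. max 0 (w q))" by (rule ennreal_leI)
    also have "\<dots> = (\<Sum>q\<in>P \<inter> A. ennreal (max 0 (w q)))"
      by (rule sum_ennreal[symmetric]) simp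
    also have "\<dots> = (\<Sum>q\<in>P \<inter> A. ennreal (w q))"
      by (intro sum.cong refl) (simp add: max_def ennreal_neg)
    also have "\<dots> = emeasure (point_masses P w) A" using P A by (simp add: emeasure_point_masses)
    finally show "ennreal (\<nu> B) \<le> emeasure (point_masses P w) A" .
  next
    let ?B = "{q \<in> P \<inter> A. w q > 0}"
    have B: "?B \<in> sets borel" using P by (intro borel_closed finite_imp_closed) auto
    have "emeasure (point_masses P w) A = (\<Sum>q\<in>P \<inter> A. ennreal (w q))"
      using P A by (simp add: emeasure_point_masses)
    also have "\<dots> = (\<Sum>q\<in>?B. ennreal (w q))"
      using P by (intro sum.mono_neutral_right) (auto simp: ennreal_eq_0_iff)
    also have "\<dots> = ennreal (\<Sum>q\<in>?B. w q)" by (rule sum_ennreal) auto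
    also have "(\<Sum>q\<in>?B. w q) = \<nu> ?B"
      unfolding \<nu>[OF B] by (rule arg_cong[where f = "sum w"]) auto
    also have "ennreal (\<nu> ?B) \<le> (SUP B \<in> {B \<in> sets borel. B \<subseteq> A}. ennreal (\<nu> B))"
      using B by (intro SUP_upper) auto
    finally show "emeasure (point_masses P w) A \<le> (SUP B \<in> {B \<in> sets borel. B \<subseteq> A}. ennreal (\<nu> B))" .
  qed
  then have "pos_var \<nu> = measure_of UNIV (sets borel) (emeasure (point_masses P w))"
    unfolding pos_var_def
    by (intro measure_of_eq) (auto simp: sets.sigma_sets_eq[of borel, simplified])
  also have "\<dots> = point_masses P w"
    using measure_of_of_measure[of "point_masses P w"] by simp
  finally show ?thesis .
qed

lemma neg_var_finite_support:
  fixes \<nu> :: "(real ^ 'n::finite) set \<Rightarrow> real"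
  assumes "finite P" and "\<And>A. A \<in> sets borel \<Longrightarrow> \<nu> A = (\<Sum>q\<in>P \<inter> A. w q)"
  shows "neg_var \<nu> = point_masses P (\<lambda>q. - w q)"
  unfolding neg_var_def using assms by (intro pos_var_finite_support) (auto simp: sum_negf)

text \<open>The fibers of \<open>c\<close> form one of the finite Borel partitions in the supremum.
  As that supremum is taken in the reals, boundedness has to be shown; the sum of all
  \<open>\<bar>w q\<bar>\<close> is a common bound.\<close>

lemma sum_fibers_le_total_var:
  fixes \<nu> :: "(real ^ 'n::finite) set \<Rightarrow> real" and c :: "real ^ 'n \<Rightarrow> 'b::{t1_space}"
  assumes P: "finite P" and \<nu>: "\<And>A. A \<in> sets borel \<Longrightarrow> \<nu> A = (\<Sum>q\<in>P \<inter> A. w q)"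
    and c: "c \<in> borel \<rightarrow>\<^sub>M borel" and fin: "finite (range c)"
  shows "(\<Sum>q\<in>range c. \<bar>\<nu> (c -` {q})\<bar>) \<le> total_var \<nu>"
proof -
  let ?\<P> = "{\<P>. finite \<P> \<and> disjoint \<P> \<and> \<P> \<subseteq> sets borel \<and> \<Union>\<P> = (UNIV :: (real ^ 'n) set)}"
  have bound: "(\<Sum>E\<in>\<P>. \<bar>\<nu> E\<bar>) \<le> (\<Sum>q\<in>P. \<bar>w q\<bar>)" if "\<P> \<in> ?\<P>" for \<P>
  proof -
    have "(\<Sum>E\<in>\<P>. \<bar>\<nu> E\<bar>) \<le> (\<Sum>E\<in>\<P>. \<Sum>q\<in>P \<inter> E. \<bar>w q\<bar>)"
      using that \<nu> by (intro sum_mono) (auto simp: subset_iff)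
    also have "\<dots> = sum (\<lambda>q. \<bar>w q\<bar>) (\<Union>E\<in>\<P>. P \<inter> E)"
      using that P by (intro sum.UNION_disjoint[symmetric]) (auto simp: disjoint_def)
    also have "\<dots> \<le> (\<Sum>q\<in>P. \<bar>w q\<bar>)" using P by (intro sum_mono2) auto
    finally show ?thesis .
  qed
  let ?p = "(\<lambda>q. c -` {q}) ` range c"
  have "c -` {q} \<in> sets borel" for q
    using measurable_sets[OF c, of "{q}"] by simp
  then have p: "?p \<in> ?\<P>"
    using fin by (auto simp: disjoint_def)
  have "(\<Sum>q\<in>range c. \<bar>\<nu> (c -` {q})\<bar>) = (\<Sum>E\<in>?p. \<bar>\<nu> E\<bar>)"
    by (subst sum.reindex) (auto simp: inj_on_def)
  also have "\<dots> \<le> total_var \<nu>"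
    unfolding total_var_def using bound by (intro cSUP_upper p bdd_aboveI2)
  finally show ?thesis .
qed

text \<open>Points of the list may coincide, and their coefficients may then cancel; the Jordan
  components only see the merged weight of each point.\<close>

lemma discrete_measure_eq_sum:
  fixes p :: "nat \<Rightarrow> real ^ 'n::finite"
  assumes "A \<in> sets borel"
  shows "discrete_measure N a p A = (\<Sum>q\<in>p ` {1..N} \<inter> A. \<Sum>j | j \<in> {1..N} \<and> p j = q. a j)"
proof -
  have "(\<Sum>q\<in>p ` {1..N} \<inter> A. \<Sum>j | j \<in> {1..N} \<and> p j = q. a j) =
      (\<Sum>q\<in>p ` {1..N}. \<Sum>j | j \<in> {1..N} \<and> p j = q. a j * indicator A (p j))"
    by (rule sum.mono_neutral_cong_left) (auto intro!: sum.cong sum.neutral)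
  also have "\<dots> = (\<Sum>j\<in>{1..N}. a j * indicator A (p j))"
    by (rule sum.image_gen[symmetric]) simp
  finally show ?thesis
    using assms by (simp add: discrete_measure_def measure_return)
qed

lemma integrable_lp_space_1:
  assumes "f \<in> lp_space 1"
  shows "integrable lebesgue f" and "lp_norm 1 f = (LINT y|lebesgue. norm (f y))"
proof -
  have [measurable]: "f \<in> borel_measurable lebesgue" and int: "integrable lebesgue (\<lambda>y. norm (f y))"
    using assms by (simp_all add: lp_space_def)
  show "integrable lebesgue f" using int by (simp add: integrable_norm_iff)
  have "(LINT y|lebesgue. norm (f y)) \<ge> 0" by (intro Bochner_Integration.integral_nonneg) auto
  then show "lp_norm 1 f = (LINT y|lebesgue. norm (f y))" by (simp add: lp_norm_def)
qed

text \<open>The counterpart for densities of the fiber bound for measures: triangle inequality on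
  each fiber, then summation over the fibers.\<close>

lemma sum_fibers_le_lp_norm:
  fixes c :: "real ^ 'n \<Rightarrow> real ^ ('n::finite)"
  assumes f: "f \<in> lp_space 1" and c: "c \<in> borel \<rightarrow>\<^sub>M borel" and fin: "finite (range c)"
  shows "(\<Sum>q\<in>range c. norm (LINT y|lebesgue. of_bool (c y = q) * f y)) \<le> lp_norm 1 f"
proof -
  have c': "{y. c y = q} \<in> sets lebesgue" for q
  proof -
    have "c -` {q} \<in> sets lborel" using measurable_sets[OF c, of "{q}"] by simp
    then have "c -` {q} \<in> sets lebesgue" by (rule sets_completionI_sets)
    then show ?thesis by (simp add: vimage_def)
  qed
  have int: "integrable lebesgue (\<lambda>y. of_bool (c y = q) * norm (f y))" for q
    using integrable_mult_indicator[OF c' integrable_norm[OF integrable_lp_space_1(1)[OF f]], of q]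
    by (rule Bochner_Integration.integrable_cong[THEN iffD1, rotated 2]) (auto simp: indicator_def)
  have "(\<Sum>q\<in>range c. norm (LINT y|lebesgue. of_bool (c y = q) * f y)) \<le>
      (\<Sum>q\<in>range c. LINT y|lebesgue. of_bool (c y = q) * norm (f y))"
  proof (intro sum_mono)
    fix q
    show "norm (LINT y|lebesgue. of_bool (c y = q) * f y) \<le> (LINT y|lebesgue. of_bool (c y = q) * norm (f y))"
    proof -
      have "norm (of_bool (c y = q) * f y) = of_bool (c y = q) * norm (f y)" for y by simp
      then show ?thesis
        using integral_norm_bound[of lebesgue "\<lambda>y. of_bool (c y = q) * f y"] by (simp only:)
    qed
  qed
  also have "\<dots> = (LINT y|lebesgue. (\<Sum>q\<in>range c. of_bool (c y = q) * norm (f y)))"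
    by (rule Bochner_Integration.integral_sum[symmetric]) (rule int)
  also have "\<dots> = (LINT y|lebesgue. norm (f y))"
  proof (intro Bochner_Integration.integral_cong refl)
    fix y
    have "(\<Sum>q\<in>range c. of_bool (c y = q) * norm (f y)) = (\<Sum>q\<in>range c. if c y = q then norm (f y) else 0)"
      by (intro sum.cong) auto
    then show "(\<Sum>q\<in>range c. of_bool (c y = q) * norm (f y)) = norm (f y)"
      using fin by simp
  qed
  finally show ?thesis using integrable_lp_space_1(2)[OF f] by simp
qed

section \<open>Passage to measures and functions\<close>

text \<open>The exceptional set lies in a rectangle with one side of measure 0. This confines a slot
  carrying a discrete measure to its atoms.\<close>

lemma (in product_sigma_finite) AE_PiM_component_subset:
  assumes "finite I" "i \<in> I" "A \<in> sets (M i)" "emeasure (M i) (space (M i) - A) = 0"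
  shows "AE y in Pi\<^sub>M I M. y i \<in> A"
proof (rule AE_I)
  let ?N = "Pi\<^sub>E I (\<lambda>j. if j = i then space (M i) - A else space (M j))"
  show "{y \<in> space (Pi\<^sub>M I M). y i \<notin> A} \<subseteq> ?N"
    using assms(2) by (auto simp: space_PiM PiE_iff extensional_def)
  have sets: "(if j = i then space (M i) - A else space (M j)) \<in> sets (M j)" for j
    using assms(3) by auto
  show "emeasure (Pi\<^sub>M I M) ?N = 0"
    using assms by (subst emeasure_PiM[OF assms(1) sets]) (auto intro!: prod_zero bexI[of _ i])
  show "?N \<in> sets (Pi\<^sub>M I M)"
    using assms(1) sets by (rule sets_PiM_I_finite)
qed

lemma closed_meas_supp: "closed (meas_supp \<nu>)"
proof -
  have "- meas_supp \<nu> = \<Union>{U. open U \<and> (\<forall>B\<in>sets borel. B \<subseteq> U \<longrightarrow> \<nu> B = 0)}"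
    unfolding meas_supp_def by blast
  then show ?thesis unfolding closed_def by (simp add: open_Union)
qed

lemma closed_fun_supp: "closed (fun_supp f)"
proof -
  have "- fun_supp f = \<Union>{U. open U \<and> (AE y in lebesgue. y \<in> U \<longrightarrow> f y = 0)}"
    unfolding fun_supp_def by blast
  then show ?thesis unfolding closed_def by (simp add: open_Union)
qed

lemma closed_common_supp: "closed (common_supp m l \<nu> f)"
  unfolding common_supp_def by (intro closed_Int closed_INT ballI closed_meas_supp closed_fun_supp)

text \<open>One finite set \<open>P\<close> serves all measure slots, with weight 0 wherever a
  particular \<open>\<nu> i\<close> has no atom. The excluded points \<open>x\<close> are then the
  same for every slot.\<close>

locale cz_discrete_data = cz_kernel_bounds m K C \<delta>
  for m and K :: "('n::finite) kernel" and C \<delta> +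
  fixes l :: nat and P :: "(real ^ 'n) set" and w :: "nat \<Rightarrow> real ^ 'n \<Rightarrow> real"
    and \<nu> :: "nat \<Rightarrow> (real ^ 'n) set \<Rightarrow> real" and f :: "nat \<Rightarrow> 'n func"
  assumes l: "l \<in> {1..m}" and P: "finite P"
    and \<nu>: "\<And>i A. i \<in> {1..l} \<Longrightarrow> A \<in> sets borel \<Longrightarrow> \<nu> i A = (\<Sum>q\<in>P \<inter> A. w i q)"
    and f: "\<And>i. i \<in> {l+1..m} \<Longrightarrow> f i \<in> lp_space 1"
begin

text \<open>
  \<open>\<mu> S\<close> are the slot measures of the summand \<open>S\<close> of \<^const>\<open>cz_apply\<close>. The index sets are chosen so
  that every \<open>\<mu> S i\<close>, also for \<open>i\<close> outside \<open>{1..m}\<close>, is \<open>\<sigma>\<close>-finite.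
\<close>

definition \<mu> :: "nat set \<Rightarrow> nat \<Rightarrow> (real ^ 'n) measure" where
  "\<mu> S i = (if i \<in> {1..l} then point_masses P (if i \<in> S then (\<lambda>q. - w i q) else w i) else lebesgue)"

definition u :: "nat \<Rightarrow> 'n func" where
  "u i = (if i \<le> l then (\<lambda>_. 1) else f i)"

text \<open>The mass at \<open>q\<close> of the push-forward under \<open>c\<close> of the measure
  in slot \<open>i\<close>, be it \<open>\<nu> i\<close> or the one with density \<open>f i\<close>.
  For finite-valued \<open>c\<close> these are discrete measures in all slots.\<close>

definition weight :: "(real ^ 'n \<Rightarrow> real ^ 'n) \<Rightarrow> nat \<Rightarrow> real ^ 'n \<Rightarrow> complex" where
  "weight c i q = (if i \<le> l then of_real (\<nu> i (c -` {q})) else LINT y|lebesgue. of_bool (c y = q) * f i y)"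

lemma prod_slots: "(\<Prod>i\<in>{1..m}. g i) = (\<Prod>i\<in>{1..l}. g i) * (\<Prod>i\<in>{l+1..m}. g i)"
  for g :: "nat \<Rightarrow> 'b::comm_monoid_mult"
proof -
  have "{1..m} = {1..l} \<union> {l+1..m}" using l by auto
  then show ?thesis by (simp add: prod.union_disjoint)
qed

lemma sigma_finite_\<mu>: "product_sigma_finite (\<mu> S)"
proof (rule product_sigma_finite.intro)
  show "sigma_finite_measure (\<mu> S i)" for i
    using sigma_finite_lebesgue finite_measure_point_masses[OF P]
    by (auto simp: \<mu>_def finite_measure_def)
qed

lemma ident_\<mu>: "(\<lambda>y. y) \<in> \<mu> S i \<rightarrow>\<^sub>M borel"
  by (auto simp: \<mu>_def measurable_ident_sets)

lemma space_\<mu>[simp]: "space (\<mu> S i) = UNIV"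
  by (simp add: \<mu>_def)

lemma integrable_u:
  assumes "i \<in> {1..m}"
  shows "integrable (\<mu> S i) (u i)"
proof (cases "i \<le> l")
  case True
  interpret finite_measure "point_masses P v" for v using P by (rule finite_measure_point_masses)
  show ?thesis using True assms by (simp add: \<mu>_def u_def)
next
  case False
  then show ?thesis using integrable_lp_space_1(1)[OF f[of i]] assms by (simp add: \<mu>_def u_def)
qed

text \<open>The two descriptions of the slot measures can differ at index 0, which the product over
  \<open>{1..m}\<close> does not see. Setting \<open>u i\<close> to 1 in the measure slots lets all
  slots be treated alike.\<close>

lemma cz_apply_eq:
  "cz_apply m K l \<nu> f x = (\<Sum>S\<in>Pow {1..l}. (- 1) ^ card S *
    (LINT y|Pi\<^sub>M {1..m} (\<mu> S). K x y * (\<Prod>i\<in>{1..m}. u i (y i))))"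
  unfolding cz_apply_def
proof (intro sum.cong refl arg_cong2[where f = "(*)"])
  fix S assume S: "S \<in> Pow {1..l}"
  have "Pi\<^sub>M {1..m} (\<lambda>i. if i \<in> S then neg_var (\<nu> i) else if i \<le> l then pos_var (\<nu> i) else lebesgue) =
      Pi\<^sub>M {1..m} (\<mu> S)"
  proof (rule PiM_cong[OF refl])
    fix i assume i: "i \<in> {1..m}"
    show "(if i \<in> S then neg_var (\<nu> i) else if i \<le> l then pos_var (\<nu> i) else lebesgue) = \<mu> S i"
    proof (cases "i \<le> l")
      case True
      then have il: "i \<in> {1..l}" using i by simp
      have "pos_var (\<nu> i) = point_masses P (w i)" "neg_var (\<nu> i) = point_masses P (\<lambda>q. - w i q)"
        using pos_var_finite_support[OF P \<nu>[OF il]] neg_var_finite_support[OF P \<nu>[OF il]] by simp_all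
      then show ?thesis using il True by (simp add: \<mu>_def)
    next
      case False
      then have "i \<notin> S" using S by auto
      then show ?thesis using False by (simp add: \<mu>_def)
    qed
  qed
  moreover have "(\<Prod>i=l+1..m. f i (y i)) = (\<Prod>i\<in>{1..m}. u i (y i))" for y
    unfolding prod_slots by (simp add: u_def)
  ultimately show "(LINT y|Pi\<^sub>M {1..m} (\<lambda>i. if i \<in> S then neg_var (\<nu> i)
        else if i \<le> l then pos_var (\<nu> i) else lebesgue). K x y * (\<Prod>i=l+1..m. f i (y i))) =
      (LINT y|Pi\<^sub>M {1..m} (\<mu> S). K x y * (\<Prod>i\<in>{1..m}. u i (y i)))" by simp
qed

text \<open>After rounding, every integral is a finite sum of products of masses. The alternating
  sum over \<open>S\<close> is the expansion of a product of differences, so the Jordan components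
  recombine into the signed masses.\<close>

lemma sum_signed_discretization:
  assumes c: "c \<in> borel \<rightarrow>\<^sub>M borel" and fin: "finite (range c)"
  shows "(\<Sum>S\<in>Pow {1..l}. (- 1) ^ card S *
      (LINT y|Pi\<^sub>M {1..m} (\<mu> S). K x (\<lambda>i\<in>{1..m}. c (y i)) * (\<Prod>i\<in>{1..m}. u i (y i)))) =
    (\<Sum>q\<in>{1..m} \<rightarrow>\<^sub>E range c. K x q * (\<Prod>i\<in>{1..m}. weight c i (q i)))"
proof -
  have fiber: "c -` {q} \<in> sets borel" for q using measurable_sets[OF c, of "{q}"] by simp
  let ?pm = "\<lambda>v i q. complex_of_real (measure (point_masses P (v i)) (c -` {q}))"
  let ?neg = "?pm (\<lambda>i q. - w i q)" and ?pos = "?pm w"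
  let ?\<gamma> = "\<lambda>i q. LINT y|lebesgue. of_bool (c y = q) * f i y"
  have diff: "?pos i q - ?neg i q = weight c i q" if "i \<in> {1..l}" for i q
  proof -
    have "measure (point_masses P (w i)) (c -` {q}) - measure (point_masses P (\<lambda>q. - w i q)) (c -` {q}) =
        (\<Sum>a\<in>P \<inter> c -` {q}. max 0 (w i a) - max 0 (- w i a))"
      using P fiber by (simp add: measure_point_masses sum_subtractf)
    also have "\<dots> = \<nu> i (c -` {q})"
      unfolding \<nu>[OF that fiber] by (intro sum.cong refl) (simp add: max_def)
    finally show ?thesis using that by (simp add: weight_def flip: of_real_diff)
  qed
  have slot: "(LINT y|\<mu> S i. of_bool (c y = q) * u i y) =
      (if i \<in> {1..l} then if i \<in> S then ?neg i q else ?pos i q else ?\<gamma> i q)"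
    if "i \<in> {1..m}" for S i q
  proof (cases "i \<in> {1..l}")
    case True
    have "(LINT y|point_masses P v. of_bool (c y = q) * (1 :: complex)) =
        of_real (measure (point_masses P v) (c -` {q}))" for v
    proof -
      have "(LINT y|point_masses P v. of_bool (c y = q) * (1 :: complex)) =
          (LINT y|point_masses P v. complex_of_real (indicator (c -` {q}) y))"
        by (intro Bochner_Integration.integral_cong) (auto simp: indicator_def)
      then show ?thesis using fiber by simp
    qed
    then show ?thesis using True by (simp add: \<mu>_def u_def)
  next
    case False
    then show ?thesis using that by (auto simp: \<mu>_def u_def)
  qed
  have "(LINT y|Pi\<^sub>M {1..m} (\<mu> S). K x (\<lambda>i\<in>{1..m}. c (y i)) * (\<Prod>i\<in>{1..m}. u i (y i))) =
      (\<Sum>q\<in>{1..m} \<rightarrow>\<^sub>E range c. K x q *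
        ((\<Prod>i\<in>S. ?neg i (q i)) * (\<Prod>i\<in>{1..l} - S. ?pos i (q i)) * (\<Prod>i\<in>{l+1..m}. ?\<gamma> i (q i))))"
    if S: "S \<in> Pow {1..l}" for S
  proof -
    interpret product_sigma_finite "\<mu> S" by (rule sigma_finite_\<mu>)
    have "(LINT y|Pi\<^sub>M {1..m} (\<mu> S). K x (\<lambda>i\<in>{1..m}. c (y i)) * (\<Prod>i\<in>{1..m}. u i (y i))) =
        (\<Sum>q\<in>{1..m} \<rightarrow>\<^sub>E range c. K x q * (\<Prod>i\<in>{1..m}. LINT y|\<mu> S i. of_bool (c y = q i) * u i y))"
    proof (rule integral_discretize(2))
      fix i q
      have "c \<in> \<mu> S i \<rightarrow>\<^sub>M borel" by (rule measurable_compose[OF ident_\<mu> c])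
      from measurable_sets[OF this, of "{q}"]
      show "{y \<in> space (\<mu> S i). c y = q} \<in> sets (\<mu> S i)" by (simp add: vimage_def)
    qed (use fin integrable_u in auto)
    also have "\<dots> = (\<Sum>q\<in>{1..m} \<rightarrow>\<^sub>E range c. K x q *
        ((\<Prod>i\<in>S. ?neg i (q i)) * (\<Prod>i\<in>{1..l} - S. ?pos i (q i)) * (\<Prod>i\<in>{l+1..m}. ?\<gamma> i (q i))))"
    proof (intro sum.cong refl arg_cong2[where f = "(*)"])
      fix q
      have "(\<Prod>i\<in>{1..m}. LINT y|\<mu> S i. of_bool (c y = q i) * u i y) =
          (\<Prod>i\<in>{1..m}. if i \<in> {1..l} then if i \<in> S then ?neg i (q i) else ?pos i (q i) else ?\<gamma> i (q i))"
        by (intro prod.cong refl slot)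
      also have "\<dots> = (\<Prod>i\<in>{1..l}. if i \<in> S then ?neg i (q i) else ?pos i (q i)) * (\<Prod>i\<in>{l+1..m}. ?\<gamma> i (q i))"
        unfolding prod_slots by (intro arg_cong2[where f = "(*)"] prod.cong) auto
      also have "(\<Prod>i\<in>{1..l}. if i \<in> S then ?neg i (q i) else ?pos i (q i)) =
          (\<Prod>i\<in>S. ?neg i (q i)) * (\<Prod>i\<in>{1..l} - S. ?pos i (q i))"
      proof -
        have "{1..l} = S \<union> ({1..l} - S)" using S by auto
        then have "(\<Prod>i\<in>{1..l}. if i \<in> S then ?neg i (q i) else ?pos i (q i)) =
            (\<Prod>i\<in>S \<union> ({1..l} - S). if i \<in> S then ?neg i (q i) else ?pos i (q i))" by (simp only:)
        also have "\<dots> = (\<Prod>i\<in>S. if i \<in> S then ?neg i (q i) else ?pos i (q i)) *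
            (\<Prod>i\<in>{1..l} - S. if i \<in> S then ?neg i (q i) else ?pos i (q i))"
          using S by (intro prod.union_disjoint) (auto intro: finite_subset)
        also have "\<dots> = (\<Prod>i\<in>S. ?neg i (q i)) * (\<Prod>i\<in>{1..l} - S. ?pos i (q i))"
          by (intro arg_cong2[where f = "(*)"] prod.cong) auto
        finally show ?thesis .
      qed
      finally show "(\<Prod>i\<in>{1..m}. LINT y|\<mu> S i. of_bool (c y = q i) * u i y) =
        (\<Prod>i\<in>S. ?neg i (q i)) * (\<Prod>i\<in>{1..l} - S. ?pos i (q i)) * (\<Prod>i\<in>{l+1..m}. ?\<gamma> i (q i))" .
    qed
    finally show ?thesis .
  qed
  then have "(\<Sum>S\<in>Pow {1..l}. (- 1) ^ card S *
      (LINT y|Pi\<^sub>M {1..m} (\<mu> S). K x (\<lambda>i\<in>{1..m}. c (y i)) * (\<Prod>i\<in>{1..m}. u i (y i)))) =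
    (\<Sum>S\<in>Pow {1..l}. (- 1) ^ card S * (\<Sum>q\<in>{1..m} \<rightarrow>\<^sub>E range c. K x q *
        ((\<Prod>i\<in>S. ?neg i (q i)) * (\<Prod>i\<in>{1..l} - S. ?pos i (q i)) * (\<Prod>i\<in>{l+1..m}. ?\<gamma> i (q i)))))"
    by (intro sum.cong refl arg_cong2[where f = "(*)"])
  also have "\<dots> = (\<Sum>q\<in>{1..m} \<rightarrow>\<^sub>E range c. K x q * ((\<Sum>S\<in>Pow {1..l}. (- 1) ^ card S *
        (\<Prod>i\<in>S. ?neg i (q i)) * (\<Prod>i\<in>{1..l} - S. ?pos i (q i))) * (\<Prod>i\<in>{l+1..m}. ?\<gamma> i (q i))))"
    unfolding sum_distrib_left sum_distrib_right
    by (subst sum.swap) (intro sum.cong refl, simp only: mult_ac)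
  also have "\<dots> = (\<Sum>q\<in>{1..m} \<rightarrow>\<^sub>E range c. K x q * (\<Prod>i\<in>{1..m}. weight c i (q i)))"
  proof (intro sum.cong refl arg_cong2[where f = "(*)"])
    fix q
    have "(\<Sum>S\<in>Pow {1..l}. (- 1) ^ card S * (\<Prod>i\<in>S. ?neg i (q i)) * (\<Prod>i\<in>{1..l} - S. ?pos i (q i))) =
        (\<Prod>i\<in>{1..l}. ?pos i (q i) - ?neg i (q i))"
      by (rule prod_diff_conv_sum[symmetric]) simp
    also have "\<dots> = (\<Prod>i\<in>{1..l}. weight c i (q i))"
      by (intro prod.cong refl diff)
    moreover have "(\<Prod>i\<in>{l+1..m}. ?\<gamma> i (q i)) = (\<Prod>i\<in>{l+1..m}. weight c i (q i))"
      by (intro prod.cong refl) (auto simp: weight_def)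
    ultimately show "(\<Sum>S\<in>Pow {1..l}. (- 1) ^ card S * (\<Prod>i\<in>S. ?neg i (q i)) *
        (\<Prod>i\<in>{1..l} - S. ?pos i (q i))) * (\<Prod>i\<in>{l+1..m}. ?\<gamma> i (q i)) = (\<Prod>i\<in>{1..m}. weight c i (q i))"
      unfolding prod_slots by (simp only:)
  qed
  finally show ?thesis .
qed

text \<open>Dominated convergence. Slot 1 carries a discrete measure since \<open>1 \<le> l\<close>,
  and rounding fixes its atoms, so all rounded arguments keep one coordinate at distance at least
  \<open>d\<close> from \<open>x\<close>. The size condition then bounds the kernel uniformly in
  \<open>k\<close>, and continuity of the kernel gives the pointwise limit.\<close>

lemma cz_apply_approximation:
  assumes c: "\<And>k::nat. c k \<in> borel \<rightarrow>\<^sub>M borel" and fin: "\<And>k. finite (range (c k))"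
    and lim: "\<And>y. (\<lambda>k. c k y) \<longlonglongrightarrow> y" and fix_P: "\<And>k y. y \<in> P \<Longrightarrow> c k y = y" and x: "x \<notin> P"
  shows "(\<lambda>k. \<Sum>q\<in>{1..m} \<rightarrow>\<^sub>E range (c k). K x q * (\<Prod>i\<in>{1..m}. weight (c k) i (q i)))
    \<longlonglongrightarrow> cz_apply m K l \<nu> f x"
proof -
  obtain d where d: "d > 0" "\<And>q. q \<in> P \<Longrightarrow> d \<le> norm (x - q)"
    using finite_set_avoid[OF P, of x] x unfolding dist_norm by metis
  let ?C = "complex_of_real (C / d ^ (CARD('n) * m))"
  let ?c = "\<lambda>k y. \<lambda>i\<in>{1..m}. c k (y i)"
  let ?u = "\<lambda>y. \<Prod>i\<in>{1..m}. u i (y i)"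
  have slot1: "1 \<in> {1..m}" using m_pos by simp
  have "(\<lambda>k. LINT y|Pi\<^sub>M {1..m} (\<mu> S). K x (?c k y) * ?u y) \<longlonglongrightarrow> (LINT y|Pi\<^sub>M {1..m} (\<mu> S). K x y * ?u y)" for S
  proof -
    interpret product_sigma_finite "\<mu> S" by (rule sigma_finite_\<mu>)
    have intu: "integrable (Pi\<^sub>M {1..m} (\<mu> S)) ?u"
      by (intro product_integrable_prod integrable_u) auto
    have AE1: "AE y in Pi\<^sub>M {1..m} (\<mu> S). y 1 \<in> P"
    proof (rule AE_PiM_component_subset[OF _ slot1])
      have "P \<in> sets borel" using P by (intro borel_closed finite_imp_closed)
      then show "P \<in> sets (\<mu> S 1)" "emeasure (\<mu> S 1) (space (\<mu> S 1) - P) = 0"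
        using l P by (simp_all add: \<mu>_def emeasure_point_masses)
    qed simp
    show ?thesis
    proof (rule integral_dominated_convergence)
      show "(\<lambda>y. K x y * ?u y) \<in> borel_measurable (Pi\<^sub>M {1..m} (\<mu> S))"
        using intu by (intro borel_measurable_times measurable_K_right ident_\<mu>) auto
      show "(\<lambda>y. K x (?c k y) * ?u y) \<in> borel_measurable (Pi\<^sub>M {1..m} (\<mu> S))" for k
      proof (rule borel_measurable_integrable[OF integral_discretize(1)[where Q = "range (c k)"]])
        fix i q
        have "c k \<in> \<mu> S i \<rightarrow>\<^sub>M borel" by (rule measurable_compose[OF ident_\<mu> c])
        from measurable_sets[OF this, of "{q}"]
        show "{y \<in> space (\<mu> S i). c k y = q} \<in> sets (\<mu> S i)" by (simp add: vimage_def)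
      qed (use fin integrable_u in auto)
      show "integrable (Pi\<^sub>M {1..m} (\<mu> S)) (\<lambda>y. norm (?C * ?u y))"
        by (intro integrable_norm integrable_mult_right intu)
      show "AE y in Pi\<^sub>M {1..m} (\<mu> S). (\<lambda>k. K x (?c k y) * ?u y) \<longlonglongrightarrow> K x y * ?u y"
        using AE1 AE_space
      proof eventually_elim
        case (elim y)
        have y: "y \<in> {1..m} \<rightarrow>\<^sub>E UNIV" using elim(2) by (auto simp: space_PiM PiE_iff)
        have "y 1 \<noteq> x" using elim(1) x by auto
        then show ?case
          using y lim by (intro tendsto_mult tendsto_const tendsto_K[OF _ _ _ slot1]) auto
      qed
      show "AE y in Pi\<^sub>M {1..m} (\<mu> S). norm (K x (?c k y) * ?u y) \<le> norm (?C * ?u y)" for k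
        using AE1
      proof eventually_elim
        case (elim y)
        have "d \<le> norm (x - ?c k y 1)" using d(2)[OF elim] fix_P[OF elim] slot1 by simp
        then have "norm (K x (?c k y)) \<le> C / d ^ (CARD('n) * m)"
          using d(1) slot1 by (intro norm_K_le[where j = 1]) auto
        also have "\<dots> \<le> norm ?C" unfolding norm_of_real by (rule abs_ge_self)
        finally show ?case unfolding norm_mult by (rule mult_right_mono) simp
      qed
    qed
  qed
  then have "(\<lambda>k. \<Sum>S\<in>Pow {1..l}. (- 1) ^ card S * (LINT y|Pi\<^sub>M {1..m} (\<mu> S). K x (?c k y) * ?u y))
      \<longlonglongrightarrow> cz_apply m K l \<nu> f x"
    unfolding cz_apply_eq by (intro tendsto_sum tendsto_mult tendsto_const)
  then show ?thesis unfolding sum_signed_discretization[OF c fin] .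
qed

definition slot_norm :: "nat \<Rightarrow> real" where
  "slot_norm i = (if i \<le> l then total_var (\<nu> i) else lp_norm 1 (f i))"

lemma sum_weight_le:
  assumes c: "c \<in> borel \<rightarrow>\<^sub>M borel" and fin: "finite (range c)" and i: "i \<in> {1..m}"
  shows "(\<Sum>q\<in>range c. norm (weight c i q)) \<le> slot_norm i"
proof (cases "i \<le> l")
  case True
  then have "i \<in> {1..l}" using i by simp
  from sum_fibers_le_total_var[OF P \<nu>[OF this] c fin] True show ?thesis
    by (simp add: weight_def slot_norm_def)
next
  case False
  then show ?thesis
    using sum_fibers_le_lp_norm[OF f[of i] c fin] i by (simp add: weight_def slot_norm_def)
qed

text \<open>At a point outside \<open>P\<close> with value above \<open>t\<close>, all late
  approximants exceed \<open>t\<close> as well, so the point lies in every \<open>U k\<close> from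
  some index on. These tail intersections increase, and each is contained in one \<open>U k\<close>,
  so no constant is lost in the limit.\<close>

lemma weak_type:
  assumes T: "cz_operator m K T" and t: "t > 0"
  shows "{x. x \<notin> common_supp m l \<nu> f \<and> norm (cz_apply m K l \<nu> f x) > t} \<in> sets lebesgue" (is "?X \<in> _")
    and "emeasure lebesgue {x. x \<notin> common_supp m l \<nu> f \<and> norm (cz_apply m K l \<nu> f x) > t} \<le>
      ennreal (weak_type_const (mult_op_norm m T) * t powr (- 1 / real m)
        * (\<Prod>i=1..l. total_var (\<nu> i) powr (1 / real m))
        * (\<Prod>i=l+1..m. lp_norm 1 (f i) powr (1 / real m)))"
proof -
  obtain F :: "nat \<Rightarrow> real ^ 'n \<Rightarrow> real ^ 'n" where F[measurable]: "\<And>k. F k \<in> borel \<rightarrow>\<^sub>M borel"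
    and F': "\<And>k. finite (range (F k))" "\<And>y. (\<lambda>k. F k y) \<longlonglongrightarrow> y"
    by (rule simple_functions_to_identity) auto
  define c where "c k y = (if y \<in> P then y else F k y)" for k y
  have P_sets[measurable]: "P \<in> sets borel" using P by (intro borel_closed finite_imp_closed)
  have c: "c k \<in> borel \<rightarrow>\<^sub>M borel" for k unfolding c_def[abs_def] by measurable
  have fin: "finite (range (c k))" for k
    using F'(1)[of k] P by (intro finite_subset[of "range (c k)" "P \<union> range (F k)"]) (auto simp: c_def)
  have lim: "(\<lambda>k. c k y) \<longlonglongrightarrow> y" for y using F'(2)[of y] by (cases "y \<in> P") (simp_all add: c_def)
  have fix_P: "c k y = y" if "y \<in> P" for k y using that by (simp add: c_def)
  let ?A = "\<lambda>k x. \<Sum>q\<in>{1..m} \<rightarrow>\<^sub>E range (c k). K x q * (\<Prod>i\<in>{1..m}. weight (c k) i (q i))"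
  have A_lim: "(\<lambda>k. ?A k x) \<longlonglongrightarrow> cz_apply m K l \<nu> f x" if "x \<notin> P" for x
    using c fin lim fix_P that by (rule cz_apply_approximation)
  have P_null: "P \<in> null_sets lebesgue"
    using P by (simp add: finite_imp_null_set_lborel null_sets_completionI)
  show "?X \<in> sets lebesgue"
  proof -
    \<comment> \<open>Off this set every approximant is continuous in \<open>x\<close> and the
      approximation converges. Countability makes \<open>N\<close>, and any part of the level set
      inside it, Borel.\<close>
    define N where "N = P \<union> (\<Union>k. range (c k))"
    have N: "countable N" unfolding N_def
      by (intro countable_Un countable_UN countableI_type countable_finite[OF P] countable_finite[OF fin])
    have countable_sets: "A \<in> sets borel" if "countable A" for A :: "(real ^ 'n) set"
      by (rule sets.countable[OF _ that]) (rule borel_closed[OF closed_singleton])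
    note N_sets[measurable] = countable_sets[OF N]
    have "(\<lambda>x. indicator (- N) x *\<^sub>R ?A k x) \<in> borel_measurable borel" for k
    proof -
      have "(\<lambda>x. indicator (- N) x *\<^sub>R K x q) \<in> borel_measurable borel" if q: "q \<in> {1..m} \<rightarrow>\<^sub>E range (c k)" for q
      proof (rule borel_measurable_continuous_on_indicator)
        have "q 1 \<in> range (c k)" using PiE_mem[OF q, of 1] m_pos by simp
        then have "q 1 \<in> N" unfolding N_def by blast
        then have "- N \<subseteq> - {q 1}" by auto
        then show "continuous_on (- N) (\<lambda>x. K x q)"
          using q m_pos by (intro continuous_on_subset[OF continuous_on_K_left]) auto
      qed measurable
      then have "(\<lambda>x. \<Sum>q\<in>{1..m} \<rightarrow>\<^sub>E range (c k). (indicator (- N) x *\<^sub>R K x q) *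
          (\<Prod>i\<in>{1..m}. weight (c k) i (q i))) \<in> borel_measurable borel"
        by (intro borel_measurable_sum borel_measurable_times borel_measurable_const)
      then show ?thesis by (simp add: scaleR_sum_right)
    qed
    then have "(\<lambda>x. indicator (- N) x *\<^sub>R cz_apply m K l \<nu> f x) \<in> borel_measurable borel"
    proof (rule borel_measurable_LIMSEQ_metric)
      show "(\<lambda>k. indicator (- N) x *\<^sub>R ?A k x) \<longlonglongrightarrow> indicator (- N) x *\<^sub>R cz_apply m K l \<nu> f x" for x
        using A_lim[of x] by (cases "x \<in> N") (auto simp: N_def)
    qed
    then have [measurable]: "(\<lambda>x. norm (indicator (- N) x *\<^sub>R cz_apply m K l \<nu> f x)) \<in> borel_measurable borel"
      by measurable
    have "{x. t < norm (indicator (- N) x *\<^sub>R cz_apply m K l \<nu> f x)} \<in> sets borel"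
      by measurable
    then have "{x. t < norm (indicator (- N) x *\<^sub>R cz_apply m K l \<nu> f x)} - common_supp m l \<nu> f \<in> sets borel"
      by (rule sets.Diff[OF _ borel_closed[OF closed_common_supp]])
    moreover have "?X \<inter> N \<in> sets borel"
      by (rule countable_sets) (rule countable_subset[OF _ N], blast)
    ultimately have "({x. t < norm (indicator (- N) x *\<^sub>R cz_apply m K l \<nu> f x)} - common_supp m l \<nu> f) \<union>
        (?X \<inter> N) \<in> sets borel" by (rule sets.Un)
    also have "({x. t < norm (indicator (- N) x *\<^sub>R cz_apply m K l \<nu> f x)} - common_supp m l \<nu> f) \<union> (?X \<inter> N) = ?X"
      using t by (auto simp: indicator_def split: if_splits)
    finally show ?thesis by (simp add: sets_completionI_sets)
  qed
  let ?R = "weak_type_const (mult_op_norm m T) *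
      (t powr (- 1 / real m) * (\<Prod>i\<in>{1..m}. slot_norm i powr (1 / real m)))"
  define good where "good k U \<longleftrightarrow> U \<in> sets lebesgue \<and> {x. norm (?A k x) > t} \<subseteq> U \<and>
    emeasure lebesgue U \<le> ennreal ?R" for k U
  have "\<exists>U. good k U" for k
  proof -
    obtain U where "U \<in> sets lebesgue" "{x. norm (?A k x) > t} \<subseteq> U" "emeasure lebesgue U \<le> ennreal ?R"
      by (rule discrete_weak_type[OF T fin t sum_weight_le[OF c fin]])
    then have "good k U" unfolding good_def by (intro conjI)
    then show ?thesis by blast
  qed
  then obtain U where "\<And>k. good k (U k)" by metis
  then have U: "\<And>k. U k \<in> sets lebesgue" "\<And>k. {x. norm (?A k x) > t} \<subseteq> U k"
      "\<And>k. emeasure lebesgue (U k) \<le> ennreal ?R" unfolding good_def by (simp_all only:)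
  define V where "V n = (\<Inter>k\<in>{n..}. U k)" for n
  have V: "V n \<in> sets lebesgue" for n unfolding V_def using U(1) by (intro sets.countable_INT) auto
  have "?X \<subseteq> (\<Union>n. V n) \<union> P"
  proof
    fix x assume "x \<in> ?X"
    then have big: "norm (cz_apply m K l \<nu> f x) > t" by simp
    show "x \<in> (\<Union>n. V n) \<union> P"
    proof (cases "x \<in> P")
      case False
      from order_tendstoD(1)[OF tendsto_norm[OF A_lim[OF False]] big]
      obtain n where "\<And>k. k \<ge> n \<Longrightarrow> norm (?A k x) > t" unfolding eventually_sequentially by auto
      then have "x \<in> V n" unfolding V_def using U(2) by blast
      then show ?thesis by blast
    qed simp
  qed
  then have "emeasure lebesgue ?X \<le> emeasure lebesgue ((\<Union>n. V n) \<union> P)"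
    using V P_null by (intro emeasure_mono) auto
  also have "\<dots> = emeasure lebesgue (\<Union>n. V n)"
    using V P_null by (intro emeasure_Un_null_set) auto
  also have "\<dots> = (SUP n. emeasure lebesgue (V n))"
  proof (rule SUP_emeasure_incseq[symmetric])
    show "incseq V" unfolding V_def by (intro incseq_SucI INT_anti_mono) auto
  qed (use V in auto)
  also have "\<dots> \<le> ennreal ?R"
  proof (rule SUP_least)
    fix n
    have "emeasure lebesgue (V n) \<le> emeasure lebesgue (U n)"
      using U(1) unfolding V_def by (intro emeasure_mono) auto
    also note U(3)[of n]
    finally show "emeasure lebesgue (V n) \<le> ennreal ?R" .
  qed
  also have "(\<Prod>i\<in>{1..m}. slot_norm i powr (1 / real m)) =
      (\<Prod>i=1..l. total_var (\<nu> i) powr (1 / real m)) * (\<Prod>i=l+1..m. lp_norm 1 (f i) powr (1 / real m))"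
    unfolding prod_slots by (simp add: slot_norm_def)
  finally show "emeasure lebesgue ?X \<le>
      ennreal (weak_type_const (mult_op_norm m T) * t powr (- 1 / real m)
        * (\<Prod>i=1..l. total_var (\<nu> i) powr (1 / real m))
        * (\<Prod>i=l+1..m. lp_norm 1 (f i) powr (1 / real m)))" by (simp only: mult.assoc)
qed

end

lemma discrete_data:
  fixes K :: "('n::finite) kernel" and \<nu> :: "nat \<Rightarrow> (real ^ 'n) set \<Rightarrow> real"
  assumes K: "cz_kernel_bounds m K C \<delta>" and l: "l \<in> {1..m}"
    and \<nu>: "\<forall>i\<in>{1..l}. \<nu> i = discrete_measure N (a i) (p i)"
    and f: "\<forall>i\<in>{l+1..m}. f i \<in> lp_space 1"
  shows "\<exists>P w. cz_discrete_data m K C \<delta> l P w \<nu> f"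
proof -
  define P where "P = (\<Union>i\<in>{1..l}. p i ` {1..N})"
  define w where "w i q = (\<Sum>j | j \<in> {1..N} \<and> p i j = q. a i j)" for i q
  have P: "finite P" by (simp add: P_def)
  have "\<nu> i A = (\<Sum>q\<in>P \<inter> A. w i q)" if i: "i \<in> {1..l}" and A: "A \<in> sets borel" for i A
  proof -
    have "\<nu> i A = (\<Sum>q\<in>p i ` {1..N} \<inter> A. w i q)"
      using \<nu> i discrete_measure_eq_sum[OF A, of N "a i" "p i"] by (simp add: w_def)
    also have "\<dots> = (\<Sum>q\<in>P \<inter> A. w i q)"
    proof (rule sum.mono_neutral_left)
      show "\<forall>q\<in>P \<inter> A - p i ` {1..N} \<inter> A. w i q = 0"
        unfolding w_def by (auto intro!: sum.neutral)
      show "p i ` {1..N} \<inter> A \<subseteq> P \<inter> A" unfolding P_def using i by blast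
    qed (use P in auto)
    finally show ?thesis .
  qed
  then have "cz_discrete_data m K C \<delta> l P w \<nu> f"
    using K l P f by (intro cz_discrete_data.intro cz_discrete_data_axioms.intro) auto
  then show ?thesis by blast
qed

theorem theorem2:
  shows "\<exists>A3 :: nat \<Rightarrow> ('n::finite) kernel \<Rightarrow> real \<Rightarrow> real.
    \<forall>(m::nat) (K :: 'n kernel) (T :: 'n multi_op). 1 \<le> m \<and> cz_operator m K T \<longrightarrow>
      (\<forall>t>0. \<forall>l\<in>{1..m}. \<forall>(N::nat) (a :: nat \<Rightarrow> nat \<Rightarrow> real) (p :: nat \<Rightarrow> nat \<Rightarrow> real ^ 'n)
          (\<nu> :: nat \<Rightarrow> (real ^ 'n) set \<Rightarrow> real) (f :: nat \<Rightarrow> 'n func).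
        1 \<le> N \<and>
        (\<forall>i\<in>{1..l}. \<nu> i = discrete_measure N (a i) (p i)) \<and>
        (\<forall>i\<in>{l+1..m}. f i \<in> lp_space 1 \<inter> linf_space \<and> linf_norm (f i) \<le> ereal (t powr (1 / real m)))
        \<longrightarrow>
        {x. x \<notin> common_supp m l \<nu> f \<and> norm (cz_apply m K l \<nu> f x) > t} \<in> sets lebesgue \<and>
        emeasure lebesgue {x. x \<notin> common_supp m l \<nu> f \<and> norm (cz_apply m K l \<nu> f x) > t}
          \<le> ennreal (A3 m K (mult_op_norm m T) * t powr (- 1 / real m)
               * (\<Prod>i=1..l. total_var (\<nu> i) powr (1 / real m))
               * (\<Prod>i=l+1..m. lp_norm 1 (f i) powr (1 / real m))))"
proof -
  \<comment> \<open>With \<open>T\<close> quantified inside, a choice of \<open>A\<close> for each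
    pair of \<open>m\<close> and \<open>K\<close> depends on the operator only through its
    norm.\<close>
  define \<Phi> where "\<Phi> m K A \<longleftrightarrow> (\<forall>T :: 'n multi_op. 1 \<le> m \<and> cz_operator m K T \<longrightarrow>
      (\<forall>t>0. \<forall>l\<in>{1..m}. \<forall>(N::nat) (a :: nat \<Rightarrow> nat \<Rightarrow> real) (p :: nat \<Rightarrow> nat \<Rightarrow> real ^ 'n)
          (\<nu> :: nat \<Rightarrow> (real ^ 'n) set \<Rightarrow> real) (f :: nat \<Rightarrow> 'n func).
        1 \<le> N \<and>
        (\<forall>i\<in>{1..l}. \<nu> i = discrete_measure N (a i) (p i)) \<and>
        (\<forall>i\<in>{l+1..m}. f i \<in> lp_space 1 \<inter> linf_space \<and> linf_norm (f i) \<le> ereal (t powr (1 / real m)))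
        \<longrightarrow>
        {x. x \<notin> common_supp m l \<nu> f \<and> norm (cz_apply m K l \<nu> f x) > t} \<in> sets lebesgue \<and>
        emeasure lebesgue {x. x \<notin> common_supp m l \<nu> f \<and> norm (cz_apply m K l \<nu> f x) > t}
          \<le> ennreal (A (mult_op_norm m T) * t powr (- 1 / real m)
               * (\<Prod>i=1..l. total_var (\<nu> i) powr (1 / real m))
               * (\<Prod>i=l+1..m. lp_norm 1 (f i) powr (1 / real m)))))"
    for m and K :: "'n kernel" and A :: "real \<Rightarrow> real"
  have "\<exists>A. \<Phi> m K A" for m and K :: "'n kernel"
  proof (cases "cz_kernel m K \<and> 1 \<le> m")
    case True
    \<comment> \<open>These constants are drawn from the kernel before any operator enters, so the
      bound built from them depends only on the permitted data.\<close>
    then obtain C \<delta> where K: "cz_kernel_bounds m K C \<delta>"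
      using cz_kernel_imp_bounds by blast
    show ?thesis
      unfolding \<Phi>_def
    proof (intro exI[of _ "cz_kernel_bounds.weak_type_const TYPE('n) m C \<delta>"] allI impI ballI, goal_cases)
      case (1 T t l N a p \<nu> f)
      then have T: "cz_operator m K T" and l: "l \<in> {1..m}" and t: "t > 0"
        and \<nu>: "\<forall>i\<in>{1..l}. \<nu> i = discrete_measure N (a i) (p i)"
        and f: "\<forall>i\<in>{l+1..m}. f i \<in> lp_space 1" by auto
      obtain P w where "cz_discrete_data m K C \<delta> l P w \<nu> f"
        using discrete_data[OF K l \<nu> f] by blast
      then interpret cz_discrete_data m K C \<delta> l P w \<nu> f .
      show ?case using weak_type[OF T t] by (rule conjI)
    qed
  next
    \<comment> \<open>No operator is associated with such \<open>m\<close> and \<open>K\<close>, so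
      the claim is vacuous.\<close>
    case False
    then show ?thesis by (auto simp: \<Phi>_def cz_operator_def)
  qed
  then obtain A3 where "\<forall>m K. \<Phi> m K (A3 m K)" by metis
  then show ?thesis unfolding \<Phi>_def by (rule exI[of _ A3])
qed

end
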